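(* Let $\nu_1>0$, $\nu_j\ge 0$ $(2\le j\le Q)$ and $0<\alpha_{j+1}\le\alpha_j\le1$ $(1\le j<Q)$. Let $Y(t)$ be the solution to $$\sum_{j=1}^Q\nu_j\,{}_{C}D_{0,t}^{\alpha_j}Y(t)=-Y(t),\quad t\in(0,T],\qquad Y(0)=Y_0,$$ satisfying $Y(t)-Y(0)=c_1t^{\sigma_1}+c_2t^{\sigma_2}+\cdots$, where $\{c_k\}$ are constants and $0<\sigma_k<\sigma_{k+1}$ for $k>0$. Let $y^n$ be the solution to the scheme $$\sum_{j=1}^Q \nu_j\,\mathcal{A}_{0,-1}^{\alpha_j,n,m_j}\hat y=-y^n,\qquad y^0=Y_0,\qquad \hat y=y-y^0,$$ where $m_j$ $(j=1,\dots,Q)$ are positive integers with $\sigma_{m_j}\le2$. Let $e^n=Y(t_n)-y^n$, $m=\max\{m_1,\dots,m_Q\}$ and $q=\min_{1\le j\le Q}\{\sigma_{m_j+1}-\alpha_j\}$. Then for $K\ge1$, $$\left(\tau\sum_{n=1}^K|e^n|^2\right)^{1/2}\le C\tau^{\min\{2,\,q+\frac12\}}+C\max_{1\le r\le m}|e^r|\sum_{j=1}^Q\tau^{\frac12-\alpha_j}K^{\max\{0,\ \sigma_m-\alpha_j-\frac32\}},$$ where $C>0$ is a constant independent of $\tau$ and of the time indices $n$ and $K$.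
   Context: ${}_CD^{\alpha}_{0,t}$ is the Caputo derivative of order $\alpha$ with base point $0$. $T>0$, $n_T$ is a positive integer, $\tau=T/n_T$, $t_n=n\tau$ $(0\le n\le n_T)$, $1\le K\le n_T$, and $y^n$ approximates $Y(t_n)$. Set $\omega^{(\alpha)}_k=(-1)^k\binom{\alpha}{k}$, $g^{(\alpha)}_{0}=\frac{2+\alpha}{2}\omega^{(\alpha)}_{0}$, $g^{(\alpha)}_{k}=\frac{2+\alpha}{2}\omega^{(\alpha)}_{k}-\frac{\alpha}{2}\omega^{(\alpha)}_{k-1}$ for $k\ge1$. For a grid function $U$ with $U^k=U(t_k)$, $$\mathcal{A}_{0,-1}^{\alpha,n,m}U=\frac{1}{\tau^{\alpha}}\sum_{k=0}^{n}g^{(\alpha)}_{n-k}U^k+\frac{1}{\tau^{\alpha}}\sum_{k=1}^m w_{n,k}^{(\alpha)}U^k,$$ where, with the exponents $\sigma_1,\sigma_2,\dots$ from the expansion of $Y$, the starting weights $w^{(\alpha)}_{n,k}$ solve $$\sum_{k=1}^m w_{n,k}^{(\alpha)}k^{\sigma_r}=\frac{\Gamma(\sigma_r+1)}{\Gamma(\sigma_r+1-\alpha)}n^{\sigma_r-\alpha}-\sum_{k=0}^{n}g^{(\alpha)}_{n-k}k^{\sigma_r},\qquad 1\le r\le m.$$ *)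

theory Defs
  imports "HOL-Analysis.Analysis"
begin

(* Caputo derivative with base point 0, at a point t of (0,T], for orders 0 < \<alpha> \<le> 1 only:
     D = 1/Gamma(1-\<alpha>) * int_0^t (t-s)^(-\<alpha>) U'(s) ds   if \<alpha> < 1,     D = U'(t)   if \<alpha> = 1.
   The relational form requires U' to exist and the (weakly singular) integral to converge.
   For \<alpha> = 1 the derivative is taken within [0,T], hence from the left at t = T. *)
definition has_caputo_derivative ::
    "real \<Rightarrow> real \<Rightarrow> (real \<Rightarrow> real) \<Rightarrow> real \<Rightarrow> real \<Rightarrow> bool" where
  "has_caputo_derivative T \<alpha> U D t \<longleftrightarrow>
     (if \<alpha> = 1 then (U has_real_derivative D) (at t within {0..T})
      else \<exists>U'. (\<forall>s\<in>{0<..<t}. (U has_real_derivative U' s) (at s)) \<and>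
                (\<lambda>s. (t - s) powr (-\<alpha>) * U' s) absolutely_integrable_on {0..t} \<and>
                D = 1 / Gamma (1 - \<alpha>) * integral {0..t} (\<lambda>s. (t - s) powr (-\<alpha>) * U' s))"

(* In what follows, indices j, k, r that start at 1 in the mathematics also start at 1 here;
   the values of \<nu>, \<alpha>, \<sigma>, c, ms at 0 are never used. *)

definition multiterm_solution ::
    "real \<Rightarrow> nat \<Rightarrow> (nat \<Rightarrow> real) \<Rightarrow> (nat \<Rightarrow> real) \<Rightarrow> real \<Rightarrow> (real \<Rightarrow> real) \<Rightarrow> bool" where
  "multiterm_solution T Q \<nu> \<alpha> Y0 Y \<longleftrightarrow>
     continuous_on {0..T} Y \<and> Y 0 = Y0 \<and>
     (\<forall>t\<in>{0<..T}. \<exists>D. (\<forall>j\<in>{1..Q}. has_caputo_derivative T (\<alpha> j) Y (D j) t) \<and>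
                        (\<Sum>j=1..Q. \<nu> j * D j) = - Y t)"

definition omega_coeff :: "real \<Rightarrow> nat \<Rightarrow> real" where
  "omega_coeff \<alpha> k = (-1) ^ k * (\<alpha> gchoose k)"

definition g_coeff :: "real \<Rightarrow> nat \<Rightarrow> real" where
  "g_coeff \<alpha> k =
     (if k = 0 then (2 + \<alpha>) / 2 * omega_coeff \<alpha> 0
      else (2 + \<alpha>) / 2 * omega_coeff \<alpha> k - \<alpha> / 2 * omega_coeff \<alpha> (k - 1))"

(* The systems (one for each n \<ge> 1) are generalized Vandermonde systems, so w n k is uniquely
   determined for 1 \<le> k \<le> m; it does not depend on the step size. *)
definition starting_weights ::
    "real \<Rightarrow> (nat \<Rightarrow> real) \<Rightarrow> nat \<Rightarrow> (nat \<Rightarrow> nat \<Rightarrow> real) \<Rightarrow> bool" where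
  "starting_weights \<alpha> \<sigma> m w \<longleftrightarrow>
     (\<forall>n\<ge>1. \<forall>r\<in>{1..m}.
        (\<Sum>k=1..m. w n k * real k powr \<sigma> r) =
          Gamma (\<sigma> r + 1) / Gamma (\<sigma> r + 1 - \<alpha>) * real n powr (\<sigma> r - \<alpha>)
          - (\<Sum>k=0..n. g_coeff \<alpha> (n - k) * real k powr \<sigma> r))"

(* A grid function is given by its values U k at t_k = k * \<tau>. *)
definition A_op ::
    "real \<Rightarrow> (nat \<Rightarrow> nat \<Rightarrow> real) \<Rightarrow> real \<Rightarrow> nat \<Rightarrow> nat \<Rightarrow> (nat \<Rightarrow> real) \<Rightarrow> real" where
  "A_op \<tau> w \<alpha> n m U =
     1 / \<tau> powr \<alpha> * (\<Sum>k=0..n. g_coeff \<alpha> (n - k) * U k)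
     + 1 / \<tau> powr \<alpha> * (\<Sum>k=1..m. w n k * U k)"

(* For n < m_j the correction term involves y at later grid points, so the first steps are coupled. *)
definition scheme_solution ::
    "real \<Rightarrow> nat \<Rightarrow> nat \<Rightarrow> (nat \<Rightarrow> real) \<Rightarrow> (nat \<Rightarrow> real) \<Rightarrow> (nat \<Rightarrow> nat) \<Rightarrow>
     (nat \<Rightarrow> nat \<Rightarrow> nat \<Rightarrow> real) \<Rightarrow> real \<Rightarrow> (nat \<Rightarrow> real) \<Rightarrow> bool" where
  "scheme_solution \<tau> nT Q \<nu> \<alpha> ms w Y0 y \<longleftrightarrow>
     y 0 = Y0 \<and>
     (\<forall>n\<in>{1..nT}.
        (\<Sum>j=1..Q. \<nu> j * A_op \<tau> (w j) (\<alpha> j) n (ms j) (\<lambda>k. y k - y 0)) = - y n)"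

end

theory Submission imports Defs begin

text \<open>
Write \<open>e\<close> for the error and \<open>\<tau>\<close> for the step. Subtracting the scheme from the equation at \<open>t_n\<close> gives
\<open>e n + (\<Sum>j. \<nu> j / \<tau> powr \<alpha> j * (\<Sum>k=1..n. g_coeff (\<alpha> j) (n - k) * e k)) = \<rho> n\<close>, where the residual \<open>\<rho>\<close>
collects the truncation errors of the difference formulas on \<open>Y\<close> and the starting weights applied to the
first \<open>m\<close> errors. Testing with \<open>e n\<close> and summing leaves the quadratic forms of the convolutions on the left,
and the theorem is a balance between what these forms control and how fast the residual decays in \<open>n\<close>.

The forms are nonnegative for the following reason. The partial sums of the coefficients are nonnegative from the third one on, all coefficients
from the fourth one on are nonpositive, and a positive third coefficient is dominated by the negative
second one; hence each form is bounded below by a weighted sum of squares (\<open>g_form_lower_bound\<close>). For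
\<open>\<alpha> < 1\<close> the weights decay like \<open>n powr (- \<alpha>)\<close>; for \<open>\<alpha> = 1\<close> the formula is BDF2, whose form controls only the
squares of single values. The two cases are united by the weight \<open>K powr (- \<alpha> / 2) * n powr (- \<alpha> / 2)\<close>
(\<open>g_form_coercive\<close>): it is summable against a bound on single values without a logarithm. So the part
of the residual that stems from the order \<open>\<alpha> j\<close> is absorbed by the form of the same order, at the price
\<open>\<tau> powr \<alpha> j * K powr (\<alpha> j / 2) * n powr (\<alpha> j / 2)\<close> per square (\<open>energy_estimate\<close>).

To bound the residual, the behaviour of \<open>Y\<close> must be known beyond its values. Applying the fractional integral of order \<open>\<alpha> 1\<close> turns the equation into
\<open>Y - Y0 = d * t powr \<alpha> 1 + (\<Sum>i. \<kappa> i * I^(b i) (Y - Y0))\<close> with positive orders \<open>b i\<close>. Substituting this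
identity into itself often enough leaves finitely many powers and a fourth-order integral \<open>I^4 V\<close> of a
bounded function (\<open>multiterm_solution_decomposition\<close>). Abel summation shows that the assumed series
determines \<open>Y\<close> up to \<open>O(t powr \<sigma> (m + 1))\<close>, so once \<open>t powr \<sigma> 1, ..., t powr \<sigma> m\<close> are split off, only powers of
exponent at least \<open>min 4 (\<sigma> (m + 1))\<close> remain (\<open>decomposition_matches_expansion\<close>).

It remains to apply the formulas to these parts. On \<open>t powr p\<close> the plain formula has the scaled defect \<open>O(n powr (p - \<alpha> - 2) + n powr (- \<alpha> - 1))\<close>
(\<open>power_defect_bound\<close>): powers of \<open>n\<close> are expanded in the coefficients of \<open>(1 - z)^a\<close>, on which convolution
with the formula is explicit, and the two leading orders cancel. The starting weights solve a generalized
Vandermonde system whose right-hand sides are these defects, so they obey the same bound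
(\<open>starting_weights_bound\<close>), and they make the corrected formula exact on the split-off powers. On \<open>I^4 V\<close>
the formula is of second order uniformly in \<open>n\<close>, because its defect is an integral of \<open>V\<close> against a kernel
that scales like \<open>\<tau>\<^sup>2 * (t - s) powr (1 - \<alpha>)\<close> (\<open>smooth_truncation_bound\<close>).

Inserting the residual bounds into the energy estimate gives the two terms of the claim: the sums over \<open>n\<close>
of the truncation errors produce the exponent \<open>min 2 (q + 1/2)\<close>, those of the starting weights the powers
of \<open>K\<close>.
\<close>

section \<open>The coefficients of powers of 1 - z\<close>

text \<open>Vandermonde's identity: \<open>omega_coeff a\<close> are the coefficients of \<open>(1 - z)^a\<close>, and the generating functions multiply.\<close>
lemma omega_coeff_convolution:
  "(\<Sum>k=0..n. omega_coeff a (n - k) * omega_coeff b k) = omega_coeff (a + b) n"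
proof -
  have "(\<Sum>k=0..n. omega_coeff a (n - k) * omega_coeff b k)
      = (\<Sum>k=0..n. (-1) ^ n * ((b gchoose k) * (a gchoose (n - k))))"
  proof (rule sum.cong[OF refl])
    fix k assume "k \<in> {0..n}"
    then have "(-1::real) ^ (n - k) * (-1) ^ k = (-1) ^ n"
      by (simp flip: power_add)
    then show "omega_coeff a (n - k) * omega_coeff b k = (-1) ^ n * ((b gchoose k) * (a gchoose (n - k)))"
      unfolding omega_coeff_def by (metis (no_types, opaque_lifting) mult.assoc mult.left_commute mult.commute)
  qed
  also have "\<dots> = omega_coeff (a + b) n"
    unfolding omega_coeff_def sum_distrib_left[symmetric] gbinomial_Vandermonde
    by (simp add: add.commute)
  finally show ?thesis .
qed

lemma omega_coeff_0 [simp]: "omega_coeff a 0 = 1"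
  by (simp add: omega_coeff_def)

lemma omega_coeff_Suc: "omega_coeff a (Suc k) = omega_coeff a k * (real k - a) / (real k + 1)"
proof -
  have "fact (Suc k) * (a gchoose Suc k) = fact k * (a gchoose k) * (a - real k)"
    by (simp only: gbinomial_mult_fact prod.atLeast0_lessThan_Suc mult.assoc)
  then have "fact k * ((real k + 1) * (a gchoose Suc k)) = fact k * ((a gchoose k) * (a - real k))"
    by (simp add: algebra_simps)
  then have "(real k + 1) * (a gchoose Suc k) = (a gchoose k) * (a - real k)"
    by (simp only: mult_cancel_left) simp
  then have "(a gchoose Suc k) = (a gchoose k) * (a - real k) / (real k + 1)"
    by (simp add: eq_divide_eq mult.commute)
  then have "omega_coeff a (Suc k) = - ((-1) ^ k * ((a gchoose k) * (a - real k) / (real k + 1)))"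
    by (simp add: omega_coeff_def)
  also have "\<dots> = (-1) ^ k * (a gchoose k) * (- (a - real k)) / (real k + 1)"
    by (simp only: mult_minus_right minus_divide_left times_divide_eq_right mult.assoc)
  finally show ?thesis by (simp add: omega_coeff_def)
qed

lemma omega_coeff_partial_sum: "(\<Sum>k\<le>n. omega_coeff a k) = omega_coeff (a - 1) n"
  unfolding omega_coeff_def using gbinomial_sum_lower_neg[of a n] by (simp add: mult.commute)

lemma omega_coeff_diff: "omega_coeff (a + 1) (Suc k) = omega_coeff a (Suc k) - omega_coeff a k"
  unfolding omega_coeff_def using gbinomial_Suc_Suc[of a k] by (simp add: algebra_simps)

text \<open>The generating function of \<open>g_coeff a\<close> is \<open>(1 - z)^a * (1 + a / 2 * (1 - z))\<close>. In this form its convolution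
with any \<open>omega_coeff b\<close> is explicit, and the second summand is visibly a correction of one order less.\<close>
lemma g_coeff_omega: "g_coeff a k = omega_coeff a k + a / 2 * omega_coeff (a + 1) k"
proof (cases k)
  case 0 then show ?thesis by (simp add: g_coeff_def field_simps)
next
  case (Suc i)
  have "g_coeff a (Suc i) = (1 + a / 2) * omega_coeff a (Suc i) - a / 2 * omega_coeff a i"
    by (simp add: g_coeff_def add_divide_distrib)
  also have "\<dots> = omega_coeff a (Suc i) + a / 2 * (omega_coeff a (Suc i) - omega_coeff a i)"
    by (simp add: algebra_simps)
  finally show ?thesis unfolding Suc omega_coeff_diff .
qed

lemma omega_coeff_limit: "(\<lambda>n. omega_coeff a n * real n powr (a + 1)) \<longlonglongrightarrow> inverse (Gamma (- a))"
proof -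
  have "\<forall>\<^sub>F n in sequentially. (a gchoose n) / ((-1)^n / exp ((a+1) * of_real (ln (real n)))) = omega_coeff a n * real n powr (a + 1)"
    using eventually_gt_at_top[of 0]
  proof eventually_elim
    case (elim n)
    have "inverse ((-1::real) ^ n) = (-1) ^ n" by (simp flip: power_inverse)
    then show ?case using elim by (simp add: omega_coeff_def powr_def divide_inverse)
  qed
  from Lim_transform_eventually[OF gbinomial_asymptotic this] show ?thesis .
qed

lemma omega_coeff_bound: "\<exists>C>0. \<forall>n\<ge>1. \<bar>omega_coeff a n\<bar> \<le> C * real n powr (- a - 1)"
proof -
  have "Bseq (\<lambda>n. omega_coeff a n * real n powr (a + 1))"
    by (rule convergent_imp_Bseq[OF convergentI[OF omega_coeff_limit]])
  then obtain C where C: "C > 0" "\<And>n. norm (omega_coeff a n * real n powr (a + 1)) \<le> C"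
    by (auto elim: BseqE)
  have "\<bar>omega_coeff a n\<bar> \<le> C * real n powr (- a - 1)" if n: "n \<ge> 1" for n
  proof -
    have "real n powr (a+1) * real n powr (-a-1) = 1" using n by (simp flip: powr_add)
    then have "\<bar>omega_coeff a n\<bar> = norm (omega_coeff a n * real n powr (a + 1)) * real n powr (- a - 1)"
      by (simp add: abs_mult)
    also have "\<dots> \<le> C * real n powr (- a - 1)" using C(2) by (intro mult_right_mono) auto
    finally show ?thesis .
  qed
  with C show ?thesis by blast
qed

text \<open>A Lagrange remainder that is uniform on the whole interval up to \<open>1\<close>, where the binomial series itself
need not converge.\<close>
lemma powr_Taylor_remainder:
  fixes s :: real
  shows "\<exists>C. \<forall>x\<in>{0<..1}. \<bar>(1 + x) powr s - (\<Sum>m<N. (s gchoose m) * x ^ m)\<bar> \<le> C * x ^ N"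
proof (intro exI ballI)
  fix x :: real assume x: "x \<in> {0<..1}"
  define diff where "diff = (\<lambda>m t. fact m * (s gchoose m) * (1 + t) powr (s - real m))"
  have der: "DERIV (diff m) t :> diff (Suc m) t" if "0 \<le> t" for m t
  proof -
    have "((\<lambda>t. (1 + t) powr (s - real m)) has_real_derivative (s - real m) * (1 + t) powr (s - real m - 1)) (at t)"
      using that by (auto intro!: derivative_eq_intros)
    from DERIV_cmult[OF this, of "fact m * (s gchoose m)"]
    have "DERIV (diff m) t :> fact m * (s gchoose m) * ((s - real m) * (1 + t) powr (s - real m - 1))"
      by (simp only: diff_def)
    also have "s - real m - 1 = s - real (Suc m)" by simp
    also have "fact m * (s gchoose m) * ((s - real m) * (1 + t) powr (s - real (Suc m))) = diff (Suc m) t"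
    proof -
      have "fact (Suc m) * (s gchoose Suc m) = fact m * (s gchoose m) * (s - real m)"
        by (simp only: gbinomial_mult_fact prod.atLeast0_lessThan_Suc mult.assoc)
      then show ?thesis unfolding diff_def by (simp only: mult.assoc)
    qed
    finally show ?thesis .
  qed
  show "\<bar>(1 + x) powr s - (\<Sum>m<N. (s gchoose m) * x ^ m)\<bar>
      \<le> \<bar>s gchoose N\<bar> * 2 powr \<bar>s - real N\<bar> * x ^ N"
  proof (cases "N = 0")
    case True
    have "(1 + x) powr s \<le> (1 + x) powr \<bar>s\<bar>" using x by (intro powr_mono) auto
    also have "\<dots> \<le> 2 powr \<bar>s\<bar>" using x by (intro powr_mono2) auto
    finally show ?thesis using True by simp
  next
    case False
    obtain t where t: "0 < t" "t < x" "(1 + x) powr s = (\<Sum>m<N. diff m 0 / fact m * x ^ m) + diff N t / fact N * x ^ N"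
      proof -
      have "\<exists>t>0. t < x \<and> (1 + x) powr s = (\<Sum>m<N. diff m 0 / fact m * x ^ m) + diff N t / fact N * x ^ N"
        using x False der by (intro Maclaurin) (auto simp: diff_def)
      then show ?thesis using that by blast
    qed
    have "(1 + t) powr (s - real N) \<le> (1 + t) powr \<bar>s - real N\<bar>" using t by (intro powr_mono) auto
    also have "\<dots> \<le> 2 powr \<bar>s - real N\<bar>" using x t by (intro powr_mono2) auto
    finally have b: "(1 + t) powr (s - real N) \<le> 2 powr \<bar>s - real N\<bar>" .
    have "(1 + x) powr s - (\<Sum>m<N. (s gchoose m) * x ^ m) = (s gchoose N) * (1 + t) powr (s - real N) * x ^ N"
      using t(3) by (simp add: diff_def)
    then show ?thesis using b x
      by (auto simp: abs_mult intro!: mult_mono)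
  qed
qed

text \<open>Turns a rate for the increments of a convergent sequence into a rate for the sequence; this is how
an asymptotic expansion is obtained from an exact recurrence.\<close>
lemma tail_bound_from_increments:
  fixes z :: "nat \<Rightarrow> real"
  assumes lim: "z \<longlonglongrightarrow> L" and C: "C \<ge> 0"
    and inc: "\<And>n. n \<ge> 2 \<Longrightarrow> \<bar>z (Suc n) - z n\<bar> \<le> C / real n ^ 4" and n: "n \<ge> 2"
  shows "\<bar>z n - L\<bar> \<le> 8 * C / real n ^ 3"
proof -
  \<comment> \<open>The increments are dominated by those of \<open>1/(n-1)^3\<close>.\<close>
  have step: "1 / real k ^ 4 \<le> 1 / (real k - 1) ^ 3 - 1 / real k ^ 3" if "k \<ge> 2" for k
  proof -
    define a b where "a = real k - 1" and "b = real k"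
    have ab: "a \<ge> 1" "b = a + 1" using that by (auto simp: a_def b_def)
    have "a ^ 3 \<le> (b ^ 3 - a ^ 3) * b"
    proof -
      have "(b ^ 3 - a ^ 3) * b - a ^ 3 = 2 * a ^ 3 + 6 * a ^ 2 + 4 * a + 1"
        unfolding ab(2) by algebra
      moreover have "2 * a ^ 3 + 6 * a ^ 2 + 4 * a + 1 \<ge> 0" using ab(1) by auto
      ultimately show ?thesis by linarith
    qed
    then have "a ^ 3 / (a ^ 3 * (b ^ 3 * b)) \<le> (b ^ 3 - a ^ 3) * b / (a ^ 3 * (b ^ 3 * b))"
      using ab by (intro divide_right_mono) auto
    moreover have "a ^ 3 / (a ^ 3 * (b ^ 3 * b)) = 1 / b ^ 4"
      using ab by (simp add: power4_eq_xxxx power3_eq_cube)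
    moreover have "(b ^ 3 - a ^ 3) * b / (a ^ 3 * (b ^ 3 * b)) = 1 / a ^ 3 - 1 / b ^ 3"
      using ab(1) ab(2) by (simp add: diff_divide_distrib)
    ultimately show ?thesis by (simp add: a_def b_def)
  qed
  have sum: "\<bar>z (n + i) - z n\<bar> \<le> C * (1 / (real n - 1) ^ 3 - 1 / (real (n + i) - 1) ^ 3)" for i
  proof (induction i)
    case (Suc i)
    have "\<bar>z (n + Suc i) - z n\<bar> \<le> \<bar>z (Suc (n + i)) - z (n + i)\<bar> + \<bar>z (n + i) - z n\<bar>" by simp
    also have "\<dots> \<le> C * (1 / real (n + i) ^ 4) + C * (1 / (real n - 1) ^ 3 - 1 / (real (n + i) - 1) ^ 3)"
      using inc[of "n + i"] Suc n by simp
    also have "\<dots> \<le> C * (1 / (real (n + i) - 1) ^ 3 - 1 / real (n + i) ^ 3) + C * (1 / (real n - 1) ^ 3 - 1 / (real (n + i) - 1) ^ 3)"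
      using step[of "n + i"] n C by (intro add_right_mono mult_left_mono) auto
    finally show ?case by (simp add: algebra_simps)
  qed auto
  have bnd: "\<bar>z (n + i) - z n\<bar> \<le> C * (1 / (real n - 1) ^ 3)" for i
  proof -
    have "1 / (real n - 1) ^ 3 - 1 / (real (n + i) - 1) ^ 3 \<le> 1 / (real n - 1) ^ 3" using n by simp
    from mult_left_mono[OF this C] sum[of i] show ?thesis by linarith
  qed
  have "(\<lambda>i. \<bar>z (n + i) - z n\<bar>) \<longlonglongrightarrow> \<bar>L - z n\<bar>"
    using LIMSEQ_ignore_initial_segment[OF lim, of n] by (intro tendsto_intros) (simp add: add.commute)
  then have "\<bar>L - z n\<bar> \<le> C * (1 / (real n - 1) ^ 3)"
    by (rule LIMSEQ_le_const2) (use bnd in auto)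
  also have "\<dots> \<le> C * (8 / real n ^ 3)"
  proof (intro mult_left_mono C)
    have "(real n / 2) ^ 3 \<le> (real n - 1) ^ 3" using n by (intro power_mono) auto
    then show "1 / (real n - 1) ^ 3 \<le> 8 / real n ^ 3" using n
      by (simp add: field_simps power_divide)
  qed
  finally show ?thesis by (simp add: abs_minus_commute mult.commute)
qed

text \<open>The quotient of \<open>omega_coeff (a + 1) n\<close> and \<open>omega_coeff a n\<close> is rational in \<open>n\<close>. The factor stays on the left
so that no zero has to be excluded.\<close>
lemma omega_coeff_shift: "(real n - 1 - a) * omega_coeff (a + 1) n = - (a + 1) * omega_coeff a n"
proof (cases n)
  case (Suc i)
  have "omega_coeff (a + 1) n = omega_coeff a i * (- (a + 1) / (real i + 1))"
    by (simp only: Suc omega_coeff_diff omega_coeff_Suc[of a i]) (simp add: field_simps)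
  moreover have "omega_coeff a n = omega_coeff a i * (real i - a) / (real i + 1)"
    unfolding Suc omega_coeff_Suc ..
  ultimately show ?thesis unfolding Suc by simp
qed simp

text \<open>The dictionary between \<open>n powr b\<close> and the coefficients of \<open>(1 - z)^a\<close>: a three-term expansion whose error
is three orders below the leading term. The sequence \<open>S n * n powr (- b)\<close>, with \<open>S\<close> the three-term combination,
tends to \<open>1 / Gamma (b + 1)\<close> by the leading term alone, and all three terms are rational multiples of the first.
Hence consecutive values can be compared exactly, and the two free coefficients are those for which the
increments are \<open>O(1 / n ^ 4)\<close>.\<close>
lemma power_expansion_in_omega_coeffs:
  fixes b :: real assumes b: "b > -1"
  shows "\<exists>C>0. \<forall>n\<ge>1. \<bar>real n powr b / Gamma (b + 1) - (omega_coeff (- b - 1) n - (b + 1) / 2 * omega_coeff (- b) n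
            + (b + 1) * (3 * b - 2) / 24 * omega_coeff (1 - b) n)\<bar> \<le> C * real n powr (b - 3)"
proof -
  define c2 where "c2 = (b + 1) * (3 * b - 2) / 24"
  define S where "S = (\<lambda>n. omega_coeff (- b - 1) n - (b + 1) / 2 * omega_coeff (- b) n + c2 * omega_coeff (1 - b) n)"
  define z where "z = (\<lambda>n. S n * real n powr (- b))"
  define L where "L = inverse (Gamma (b + 1))"
  define T where "T = (\<lambda>x. \<Sum>m<4. (b + 1 gchoose m) * x ^ m)"
  obtain C1 where C1: "C1 > 0" "\<And>n. n \<ge> 1 \<Longrightarrow> \<bar>omega_coeff (- b - 1) n\<bar> \<le> C1 * real n powr b"
    using omega_coeff_bound[of "- b - 1"] by auto
  obtain C2 where C2: "\<forall>x\<in>{0<..1}. \<bar>(1 + x) powr (b + 1) - T x\<bar> \<le> C2 * x ^ 4"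
    unfolding T_def using powr_Taylor_remainder[of "b + 1" 4] by blast
  have T: "T x = 1 + (b + 1) * x + (b + 1) * b / 2 * x ^ 2 + (b + 1) * b * (b - 1) / 6 * x ^ 3" for x
    by (simp add: T_def eval_nat_numeral gbinomial_prod_rev algebra_simps)
  define c where "c = b * (b - 1) * c2"
  define d1 where "d1 = (2 * b - 1) - b * (b + 1) / 2"
  define d2 where "d2 = b * (b - 1) - b * (b + 1) * (b - 1) / 2 + c"
  define A where "A = - (d1 * ((b + 1) * b * (b - 1) / 6) + d2 * ((b + 1) * b / 2))"
  define B where "B = - (d2 * ((b + 1) * b * (b - 1) / 6))"
  define D where "D = (\<lambda>x. (1 + b * x) * (1 + (b - 1) * x) - b * (b + 1) / 2 * x * (1 + (b - 1) * x) + c * x ^ 2)"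
  define P where "P = (\<lambda>x. (1 + (b - 1) * x) * ((1 + b * x) * (1 + (b + 1) * x - b * (b + 1) / 2 * x) + c * x ^ 2))"
  \<comment> \<open>\<open>\<Phi> n\<close> is the quotient of \<open>S n\<close> and its leading term; \<open>D\<close> and \<open>P\<close> are the numerators of \<open>\<Phi> n\<close> and of
      \<open>(1 + (b + 1) * x) * \<Phi> (Suc n)\<close> over the common denominator \<open>E\<close> below.\<close>
  define \<Phi> where "\<Phi> = (\<lambda>n. 1 - b * (b + 1) / (2 * (real n + b)) + c / ((real n + b) * (real n + b - 1)))"
  define E0 where "E0 = 1 / 2 * min 1 ((b + 1) / 2)"
  define M where "M = \<bar>A\<bar> + \<bar>B\<bar> + (1 + \<bar>d1\<bar> + \<bar>d2\<bar>) * \<bar>C2\<bar>"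
  have E0: "E0 > 0" using b by (simp add: E0_def)
  have D: "D x = 1 + d1 * x + d2 * x ^ 2" for x
    unfolding D_def d1_def d2_def by (simp add: field_simps power2_eq_square)
  \<comment> \<open>The correction coefficients are chosen so that the ratio of consecutive terms is
      \<open>1 + O(n^-4)\<close>: with \<open>x = 1/n\<close>, the following polynomial identity cancels all orders below \<open>4\<close>.\<close>
  have key: "P x - D x * T x = x ^ 4 * (A + B * x)" for x
    unfolding P_def D T A_def B_def d1_def d2_def c_def c2_def
    by (simp add: field_simps power2_eq_square power3_eq_cube power4_eq_xxxx)
  have S: "S n = omega_coeff (- b - 1) n * \<Phi> n" if n: "n \<ge> 2" for n
  proof -
    have pos: "real n + b > 0" "real n + b - 1 > 0" using b n by auto
    have 1: "omega_coeff (- b) n = b / (real n + b) * omega_coeff (- b - 1) n"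
      using omega_coeff_shift[of n "- b - 1"] pos by (simp add: field_simps)
    have 2: "omega_coeff (1 - b) n = (b - 1) / (real n + b - 1) * omega_coeff (- b) n"
      using omega_coeff_shift[of n "- b"] pos by (simp add: field_simps)
    have "S n = omega_coeff (- b - 1) n * (1 - (b + 1) / 2 * (b / (real n + b)) + c2 * ((b - 1) / (real n + b - 1) * (b / (real n + b))))"
      unfolding S_def 2 1 by (simp add: algebra_simps)
    also have "1 - (b + 1) / 2 * (b / (real n + b)) + c2 * ((b - 1) / (real n + b - 1) * (b / (real n + b))) = \<Phi> n"
      unfolding \<Phi>_def c_def by (simp add: mult.commute mult.left_commute)
    finally show ?thesis .
  qed
  have inc: "\<bar>z (Suc n) - z n\<bar> \<le> (C1 * (M / E0)) / real n ^ 4" if n: "n \<ge> 2" for n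
  proof -
    define x where "x = 1 / real n"
    have x: "x > 0" "x \<le> 1 / 2" "x \<le> 1" using n by (auto simp: x_def field_simps)
    have nx: "real n = 1 / x" by (simp add: x_def)
    have f1: "1 + b * x \<ge> 1 / 2"
    proof -
      have "(- 1) * x \<le> b * x" using b x by (intro mult_right_mono) auto
      then show ?thesis using x by simp
    qed
    have f2: "1 + (b - 1) * x \<ge> min 1 ((b + 1) / 2)"
    proof (cases "b \<ge> 1")
      case True then show ?thesis using x by (intro order.trans[OF min.cobounded1]) auto
    next
      case False
      have "(b - 1) * (1 / 2) \<le> (b - 1) * x" using False x by (intro mult_left_mono_neg) auto
      then show ?thesis by (intro order.trans[OF min.cobounded2]) (simp add: field_simps)
    qed
    have f3: "1 + (b + 1) * x > 0" using b x by (intro add_pos_nonneg) auto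
    have f2': "1 + (b - 1) * x > 0" using b by (intro less_le_trans[OF _ f2]) auto
    define E where "E = (1 + b * x) * (1 + (b - 1) * x)"
    have E: "E \<ge> E0" unfolding E_def E0_def using f1 f2 b by (intro mult_mono) auto
    have Dx: "\<bar>D x\<bar> \<le> 1 + \<bar>d1\<bar> + \<bar>d2\<bar>"
    proof -
      have "\<bar>d1 * x\<bar> \<le> \<bar>d1\<bar>" using x by (simp add: abs_mult mult_left_le)
      moreover have "\<bar>d2 * x ^ 2\<bar> \<le> \<bar>d2\<bar>" using x by (simp add: abs_mult mult_left_le power_le_one)
      ultimately show ?thesis unfolding D by linarith
    qed
    have n2: "Suc n \<ge> 2" using n by simp
    define u where "u = omega_coeff (- b - 1) n"
    have z1: "z n = u * real n powr (- b) * \<Phi> n" unfolding z_def S[OF n] u_def by simp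
    have pw: "real (Suc n) powr (- b) = real n powr (- b) * (1 + x) powr (- b)"
    proof -
      have "real (Suc n) = real n * (1 + x)" using n by (simp add: x_def field_simps)
      then show ?thesis using x n by (simp only: powr_mult)
    qed
    have z2: "z (Suc n) = u * real n powr (- b) * ((1 + (b + 1) * x) * (1 + x) powr (- b - 1) * \<Phi> (Suc n))"
    proof -
      have e1: "(1 + x) powr (- b) = (1 + x) powr (- b - 1) * (1 + x)"
        using x powr_add[of "1 + x" "- b - 1" 1] by simp
      have e2: "(real n + b + 1) / (real n + 1) * (1 + x) = 1 + (b + 1) * x"
      proof -
        have "1 + x = (real n + 1) / real n" using n by (simp add: x_def field_simps)
        then have "(real n + b + 1) / (real n + 1) * (1 + x) = (real n + b + 1) / real n" by simp
        then show ?thesis using n by (simp add: x_def field_simps)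
      qed
      have "z (Suc n) = u * ((real n + b + 1) / (real n + 1)) * (real n powr (- b) * (1 + x) powr (- b)) * \<Phi> (Suc n)"
        unfolding z_def S[OF n2] pw omega_coeff_Suc u_def by (simp add: algebra_simps)
      then have "z (Suc n) = u * real n powr (- b) * (((real n + b + 1) / (real n + 1) * (1 + x)) * (1 + x) powr (- b - 1) * \<Phi> (Suc n))"
        unfolding e1 by (simp only: mult_ac)
      then show ?thesis unfolding e2 .
    qed
    have gen: "(1 - k / a1 + e / (a1 * a2)) * (a1 * a2) = a1 * a2 - k * a2 + e"
      if "a1 \<noteq> 0" "a2 \<noteq> 0" for k a1 a2 e :: real
      using that by (simp add: field_simps)
    have p1: "\<Phi> n * E = D x"
    proof -
      have "real n + b = (1 + b * x) / x" "real n + b - 1 = (1 + (b - 1) * x) / x" using x by (auto simp: nx field_simps)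
      then have "\<Phi> n = 1 - b * (b + 1) / 2 * x / (1 + b * x) + c * x ^ 2 / ((1 + b * x) * (1 + (b - 1) * x))"
        unfolding \<Phi>_def by (simp add: power2_eq_square)
      moreover have ne: "1 + b * x \<noteq> 0" "1 + (b - 1) * x \<noteq> 0" using f1 f2' by linarith+
      ultimately show ?thesis by (simp only: E_def D_def gen[OF ne])
    qed
    have p2: "(1 + (b + 1) * x) * \<Phi> (Suc n) * E = P x"
    proof -
      have "real (Suc n) + b = (1 + (b + 1) * x) / x" "real (Suc n) + b - 1 = (1 + b * x) / x" using x by (auto simp: nx field_simps)
      then have "\<Phi> (Suc n) = 1 - b * (b + 1) / 2 * x / (1 + (b + 1) * x) + c * x ^ 2 / ((1 + (b + 1) * x) * (1 + b * x))"
        unfolding \<Phi>_def by (simp add: power2_eq_square)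
      moreover have ne: "1 + (b + 1) * x \<noteq> 0" "1 + b * x \<noteq> 0" using f1 f3 by linarith+
      ultimately have "\<Phi> (Suc n) * ((1 + (b + 1) * x) * (1 + b * x)) = (1 + (b + 1) * x) * (1 + b * x) - b * (b + 1) / 2 * x * (1 + b * x) + c * x ^ 2"
        by (simp only: gen[OF ne])
      moreover have "(1 + (b + 1) * x) * \<Phi> (Suc n) * E = (1 + (b - 1) * x) * (\<Phi> (Suc n) * ((1 + (b + 1) * x) * (1 + b * x)))"
        by (simp only: E_def mult_ac)
      ultimately have "(1 + (b + 1) * x) * \<Phi> (Suc n) * E = (1 + (b - 1) * x) * ((1 + (b + 1) * x) * (1 + b * x) - b * (b + 1) / 2 * x * (1 + b * x) + c * x ^ 2)"
        by (simp only:)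
      also have "\<dots> = P x" unfolding P_def by (simp add: algebra_simps)
      finally show ?thesis .
    qed
    have one: "(1 + x) powr (b + 1) * (1 + x) powr (- b - 1) = 1" using x by (simp flip: powr_add)
    have "(z (Suc n) - z n) * E = u * real n powr (- b) * ((1 + x) powr (- b - 1) * ((1 + (b + 1) * x) * \<Phi> (Suc n) * E) - \<Phi> n * E)"
      unfolding z1 z2 by (simp add: algebra_simps)
    also have "\<dots> = u * real n powr (- b) * ((1 + x) powr (- b - 1) * P x - D x * ((1 + x) powr (b + 1) * (1 + x) powr (- b - 1)))"
      unfolding p1 p2 one by simp
    also have "\<dots> = u * real n powr (- b) * ((1 + x) powr (- b - 1) * (P x - D x * (1 + x) powr (b + 1)))"
      by (simp only: right_diff_distrib mult_ac)
    finally have zE: "(z (Suc n) - z n) * E = u * real n powr (- b) * ((1 + x) powr (- b - 1) * (P x - D x * (1 + x) powr (b + 1)))" .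
    have PD: "\<bar>P x - D x * (1 + x) powr (b + 1)\<bar> \<le> M * x ^ 4"
    proof -
      have "P x - D x * (1 + x) powr (b + 1) = x ^ 4 * (A + B * x) - D x * ((1 + x) powr (b + 1) - T x)"
        using key[of x] by (simp add: algebra_simps)
      also have "\<bar>\<dots>\<bar> \<le> \<bar>x ^ 4 * (A + B * x)\<bar> + \<bar>D x * ((1 + x) powr (b + 1) - T x)\<bar>" by simp
      also have "\<dots> \<le> x ^ 4 * (\<bar>A\<bar> + \<bar>B\<bar>) + (1 + \<bar>d1\<bar> + \<bar>d2\<bar>) * (\<bar>C2\<bar> * x ^ 4)"
      proof (rule add_mono)
        have "\<bar>A + B * x\<bar> \<le> \<bar>A\<bar> + \<bar>B * x\<bar>" by simp
        also have "\<bar>B * x\<bar> \<le> \<bar>B\<bar>" using x by (simp add: abs_mult mult_left_le)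
        finally show "\<bar>x ^ 4 * (A + B * x)\<bar> \<le> x ^ 4 * (\<bar>A\<bar> + \<bar>B\<bar>)"
          using x by (simp add: abs_mult)
        have "\<bar>(1 + x) powr (b + 1) - T x\<bar> \<le> C2 * x ^ 4" using C2 x by auto
        also have "\<dots> \<le> \<bar>C2\<bar> * x ^ 4" using x by (intro mult_right_mono) auto
        finally show "\<bar>D x * ((1 + x) powr (b + 1) - T x)\<bar> \<le> (1 + \<bar>d1\<bar> + \<bar>d2\<bar>) * (\<bar>C2\<bar> * x ^ 4)"
          unfolding abs_mult using Dx by (intro mult_mono) auto
      qed
      also have "\<dots> = M * x ^ 4" by (simp add: M_def algebra_simps)
      finally show ?thesis .
    qed
    have "\<bar>z (Suc n) - z n\<bar> * E0 \<le> \<bar>z (Suc n) - z n\<bar> * \<bar>E\<bar>" using E E0 by (intro mult_left_mono) auto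
    also have "\<dots> = \<bar>u\<bar> * real n powr (- b) * ((1 + x) powr (- b - 1) * \<bar>P x - D x * (1 + x) powr (b + 1)\<bar>)"
      unfolding abs_mult[symmetric] zE by (simp add: abs_mult)
    also have "\<dots> \<le> C1 * (1 * (M * x ^ 4))"
    proof (rule mult_mono)
      have "\<bar>u\<bar> * real n powr (- b) \<le> (C1 * real n powr b) * real n powr (- b)"
        unfolding u_def using C1(2)[of n] n by (intro mult_right_mono) auto
      also have "\<dots> = C1" using n by (simp add: powr_minus)
      finally show "\<bar>u\<bar> * real n powr (- b) \<le> C1" .
      have "(1 + x) powr (- b - 1) \<le> 1" using powr_mono[of "- b - 1" 0 "1 + x"] b x by simp
      then show "(1 + x) powr (- b - 1) * \<bar>P x - D x * (1 + x) powr (b + 1)\<bar> \<le> 1 * (M * x ^ 4)"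
        using PD by (intro mult_mono) auto
    qed (use C1 in auto)
    finally have "\<bar>z (Suc n) - z n\<bar> \<le> C1 * (1 * (M * x ^ 4)) / E0" using E0 by (simp add: pos_le_divide_eq)
    then show ?thesis by (simp add: x_def power_divide mult.commute)
  qed
  have M: "M \<ge> 0" by (simp add: M_def)
  have zlim: "z \<longlonglongrightarrow> L"
  proof -
    have 1: "(\<lambda>n. omega_coeff (- b - 1) n * real n powr (- b)) \<longlonglongrightarrow> L"
      using omega_coeff_limit[of "- b - 1"] by (simp add: L_def add.commute)
    have 0: "(\<lambda>n. omega_coeff a n * real n powr (- b)) \<longlonglongrightarrow> 0" if "a + 1 > - b" for a
    proof -
      have "(\<lambda>n. real n powr (- b - (a + 1))) \<longlonglongrightarrow> 0" using that
        by (intro tendsto_neg_powr filterlim_real_sequentially) auto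
      from tendsto_mult[OF omega_coeff_limit[of a] this]
      have "(\<lambda>n. omega_coeff a n * real n powr (a + 1) * real n powr (- b - (a + 1))) \<longlonglongrightarrow> 0" by simp
      moreover have "real n powr (a + 1) * real n powr (- b - (a + 1)) = real n powr (- b)" for n
        by (simp flip: powr_add)
      ultimately show ?thesis by (simp only: mult.assoc)
    qed
    have "(\<lambda>n. omega_coeff (- b - 1) n * real n powr (- b) - (b + 1) / 2 * (omega_coeff (- b) n * real n powr (- b))
        + c2 * (omega_coeff (1 - b) n * real n powr (- b))) \<longlonglongrightarrow> L - (b + 1) / 2 * 0 + c2 * 0"
      by (intro tendsto_intros 1 0) auto
    then show ?thesis unfolding z_def S_def by (simp add: algebra_simps)
  qed
  define C where "C = 8 * (C1 * (M / E0)) + \<bar>L - S 1\<bar> + 1"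
  have fin: "\<bar>real n powr b / Gamma (b + 1) - S n\<bar> \<le> C * real n powr (b - 3)" if n: "n \<ge> 1" for n
  proof (cases "n = 1")
    case True
    then show ?thesis using M C1 E0 by (simp add: C_def L_def inverse_eq_divide)
  next
    case False
    with n have n: "n \<ge> 2" by simp
    have "S n = z n * real n powr b" unfolding z_def using n by (simp add: powr_minus)
    then have "real n powr b / Gamma (b + 1) - S n = - (z n - L) * real n powr b"
      by (simp add: L_def inverse_eq_divide algebra_simps)
    then have "\<bar>real n powr b / Gamma (b + 1) - S n\<bar> = \<bar>z n - L\<bar> * real n powr b"
      by (simp add: abs_mult abs_minus_commute)
    also have "\<dots> \<le> (8 * (C1 * (M / E0)) / real n ^ 3) * real n powr b"
      using M C1 E0 by (intro mult_right_mono tail_bound_from_increments[OF zlim _ inc n]) auto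
    also have "\<dots> = 8 * (C1 * (M / E0)) * real n powr (b - 3)"
      using n by (simp add: powr_diff powr_numeral)
    also have "\<dots> \<le> C * real n powr (b - 3)" by (intro mult_right_mono) (auto simp: C_def)
    finally show ?thesis .
  qed
  have "C > 0" using M C1 E0 by (auto simp: C_def intro!: add_nonneg_pos)
  with fin show ?thesis unfolding S_def c2_def by blast
qed

text \<open>Comparison with an integral for \<open>r \<le> 1\<close>, the largest summand for \<open>r > 1\<close>. Demanding \<open>r > 0\<close> in addition
to \<open>r \<ge> p + 1\<close> keeps the borderline \<open>p = -1\<close> free of a logarithm.\<close>
lemma sum_powr_bound:
  assumes r: "r > 0" "r \<ge> p + 1"
  shows "\<exists>C>0. \<forall>K. (\<Sum>n=1..K. real n powr p) \<le> C * real K powr r"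
proof (cases "r \<le> 1")
  case True
  have step: "real (Suc n) powr p + 1 / r * real n powr r \<le> 1 / r * real (Suc n) powr r" for n
  proof (cases "n = 0")
    case 0: True
    then show ?thesis using r True by simp
  next
    case False
    have "\<exists>\<xi>>real n. \<xi> < real (Suc n) \<and>
        real (Suc n) powr r - real n powr r = (real (Suc n) - real n) * (r * \<xi> powr (r - 1))"
      using False by (intro MVT2 has_real_derivative_powr) auto
    then obtain \<xi> where \<xi>: "real n < \<xi>" "\<xi> < real (Suc n)"
        "real (Suc n) powr r - real n powr r = r * \<xi> powr (r - 1)" by auto
    have "real (Suc n) powr p \<le> real (Suc n) powr (r - 1)" using r by (intro powr_mono) auto
    also have "\<dots> \<le> \<xi> powr (r - 1)" using True \<xi> False by (intro powr_mono2') auto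
    also have "\<dots> = 1 / r * (real (Suc n) powr r - real n powr r)" unfolding \<xi>(3) using r by simp
    finally show ?thesis by (simp add: algebra_simps)
  qed
  have "(\<Sum>n=1..K. real n powr p) \<le> 1 / r * real K powr r" for K
  proof (induction K)
    case (Suc K)
    have "(\<Sum>n=1..Suc K. real n powr p) = real (Suc K) powr p + (\<Sum>n=1..K. real n powr p)" by simp
    also have "\<dots> \<le> real (Suc K) powr p + 1 / r * real K powr r" using Suc by simp
    finally show ?case using step[of K] by linarith
  qed auto
  then show ?thesis using r by (intro exI[of _ "1 / r"]) auto
next
  case False
  have "(\<Sum>n=1..K. real n powr p) \<le> 1 * real K powr r" for K
  proof -
    have "(\<Sum>n=1..K. real n powr p) \<le> (\<Sum>n=1..K. real K powr (r - 1))"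
    proof (rule sum_mono)
      fix n assume n: "n \<in> {1..K}"
      then have "real n powr p \<le> real n powr (r - 1)" using r by (intro powr_mono) auto
      also have "\<dots> \<le> real K powr (r - 1)" using n False by (intro powr_mono2) auto
      finally show "real n powr p \<le> real K powr (r - 1)" .
    qed
    also have "\<dots> = 1 * real K powr r"
      by (cases "K = 0") (auto simp: powr_diff)
    finally show ?thesis .
  qed
  then show ?thesis by (intro exI[of _ 1]) auto
qed

section \<open>Consistency of the difference formula on powers\<close>

lemma powr_rescale:
  fixes x y p :: real
  assumes "x > 0" "y > 0"
  shows "x powr p = y powr p * (y / x) powr (- p)"
proof -
  have "y powr p * (y / x) powr (- p) = (y powr p * y powr (- p)) / x powr (- p)"
    using assms by (simp add: powr_divide)
  also have "y powr p * y powr (- p) = 1" using assms by (simp flip: powr_add)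
  also have "1 / x powr (- p) = x powr p" by (simp add: powr_minus inverse_eq_divide)
  finally show ?thesis ..
qed

lemma omega_coeff_bound_shifted:
  "\<exists>C>0. \<forall>n. \<bar>omega_coeff a n\<bar> \<le> C * (real n + 1) powr (- a - 1)"
proof -
  obtain C where C: "C > 0" "\<And>n. n \<ge> 1 \<Longrightarrow> \<bar>omega_coeff a n\<bar> \<le> C * real n powr (- a - 1)"
    using omega_coeff_bound[of a] by auto
  define D where "D = C * 2 powr \<bar>- a - 1\<bar> + 1"
  have "\<bar>omega_coeff a n\<bar> \<le> D * (real n + 1) powr (- a - 1)" for n
  proof (cases "n = 0")
    case True then show ?thesis using C by (simp add: D_def)
  next
    case False
    have "real n powr (- a - 1) = (real n + 1) powr (- a - 1) * ((real n + 1) / real n) powr (- (- a - 1))"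
      using False by (intro powr_rescale) auto
    also have "\<dots> \<le> (real n + 1) powr (- a - 1) * 2 powr \<bar>- a - 1\<bar>"
    proof (rule mult_left_mono)
      have "((real n + 1) / real n) powr (- (- a - 1)) \<le> ((real n + 1) / real n) powr \<bar>- a - 1\<bar>"
        using False by (intro powr_mono) auto
      also have "\<dots> \<le> 2 powr \<bar>- a - 1\<bar>" using False by (intro powr_mono2) (auto simp: field_simps)
      finally show "((real n + 1) / real n) powr (- (- a - 1)) \<le> 2 powr \<bar>- a - 1\<bar>" .
    qed auto
    finally have "C * real n powr (- a - 1) \<le> C * ((real n + 1) powr (- a - 1) * 2 powr \<bar>- a - 1\<bar>)"
      using C by (intro mult_left_mono) auto
    also have "\<dots> \<le> D * (real n + 1) powr (- a - 1)" by (simp add: D_def algebra_simps)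
    finally show ?thesis using C(2)[of n] False by linarith
  qed
  moreover have "D > 0" using C by (auto simp: D_def intro!: add_nonneg_pos)
  ultimately show ?thesis by blast
qed

lemma g_coeff_bound:
  assumes "\<alpha> \<ge> 0"
  shows "\<exists>C>0. \<forall>n. \<bar>g_coeff \<alpha> n\<bar> \<le> C * (real n + 1) powr (- \<alpha> - 1)"
proof -
  obtain C where C: "C > 0" "\<And>n. \<bar>omega_coeff \<alpha> n\<bar> \<le> C * (real n + 1) powr (- \<alpha> - 1)"
    using omega_coeff_bound_shifted by blast
  obtain D where D: "D > 0" "\<And>n. \<bar>omega_coeff (\<alpha> + 1) n\<bar> \<le> D * (real n + 1) powr (- (\<alpha> + 1) - 1)"
    using omega_coeff_bound_shifted by blast
  have "\<bar>g_coeff \<alpha> n\<bar> \<le> (C + \<alpha> / 2 * D) * (real n + 1) powr (- \<alpha> - 1)" for n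
  proof -
    have "\<bar>g_coeff \<alpha> n\<bar> \<le> \<bar>omega_coeff \<alpha> n\<bar> + \<alpha> / 2 * \<bar>omega_coeff (\<alpha> + 1) n\<bar>"
      unfolding g_coeff_omega using assms by (intro order.trans[OF abs_triangle_ineq]) (simp add: abs_mult)
    also have "\<dots> \<le> C * (real n + 1) powr (- \<alpha> - 1) + \<alpha> / 2 * (D * (real n + 1) powr (- (\<alpha> + 1) - 1))"
      using C D assms by (intro add_mono mult_left_mono) auto
    also have "\<dots> \<le> C * (real n + 1) powr (- \<alpha> - 1) + \<alpha> / 2 * (D * (real n + 1) powr (- \<alpha> - 1))"
      using D assms by (intro add_left_mono mult_left_mono powr_mono) auto
    finally show ?thesis by (simp add: algebra_simps)
  qed
  moreover have "C + \<alpha> / 2 * D > 0" using C D assms by (intro add_pos_nonneg) auto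
  ultimately show ?thesis by blast
qed

lemma g_coeff_convolution_omega:
  "(\<Sum>k=0..n. g_coeff \<alpha> (n - k) * omega_coeff b k) = omega_coeff (\<alpha> + b) n + \<alpha> / 2 * omega_coeff (\<alpha> + b + 1) n"
proof -
  have "(\<Sum>k=0..n. g_coeff \<alpha> (n - k) * omega_coeff b k) =
      (\<Sum>k=0..n. omega_coeff \<alpha> (n - k) * omega_coeff b k) + \<alpha> / 2 * (\<Sum>k=0..n. omega_coeff (\<alpha> + 1) (n - k) * omega_coeff b k)"
    by (simp add: g_coeff_omega algebra_simps sum.distrib sum_distrib_left)
  then show ?thesis by (simp add: omega_coeff_convolution add_ac)
qed

lemma sum_powr_bounded:
  assumes "p < -1"
  shows "\<exists>C>0. \<forall>K. (\<Sum>n=1..K. real n powr p) \<le> C"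
proof -
  have sm: "summable (\<lambda>n. real n powr p)" using assms by (simp add: summable_real_powr_iff)
  have "(\<Sum>n=1..K. real n powr p) \<le> (\<Sum>n. real n powr p) + 1" for K
  proof -
    have "(\<Sum>n=1..K. real n powr p) \<le> (\<Sum>n. real n powr p)" by (intro sum_le_suminf sm) auto
    then show ?thesis by simp
  qed
  moreover have "(\<Sum>n. real n powr p) + 1 > 0" by (intro add_nonneg_pos suminf_nonneg sm) auto
  ultimately show ?thesis by blast
qed

text \<open>The rate that all bounds below share: the first summand is the second-order consistency on \<open>t powr s\<close>, the second
the memory of the singularity at the base point, which decays like the coefficients of the formula.\<close>
abbreviation defect_rate :: "real \<Rightarrow> real \<Rightarrow> nat \<Rightarrow> real" where
  "defect_rate \<alpha> s n \<equiv> real n powr (s - \<alpha> - 2) + real n powr (- \<alpha> - 1)"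

text \<open>The effect of the memory on an error \<open>k powr (s - 3)\<close>. Of the two factors, one has an argument of at least \<open>n / 2\<close> and is
comparable to its value at \<open>n\<close>; the other is summed, and the kernel \<open>k powr (- \<alpha> - 1)\<close> is summable.\<close>
lemma convolution_power_bound:
  assumes a: "0 < \<alpha>" "\<alpha> \<le> 1"
  shows "\<exists>C>0. \<forall>n\<ge>1. (\<Sum>k=1..n. (real (n - k) + 1) powr (- \<alpha> - 1) * real k powr (s - 3))
            \<le> C * defect_rate \<alpha> s n"
proof -
  obtain C1 where C1: "C1 > 0" "\<And>K. (\<Sum>n=1..K. real n powr (- \<alpha> - 1)) \<le> C1"
    using sum_powr_bounded[of "- \<alpha> - 1"] a by auto
  have "\<exists>C>0. \<forall>K\<ge>1. (\<Sum>n=1..K. real n powr (s - 3)) \<le> C * (real K powr (s - 1) + 1)"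
  proof (cases "s > 1")
    case True
    then obtain C where "C > 0" "\<And>K. (\<Sum>n=1..K. real n powr (s - 3)) \<le> C * real K powr (s - 1)"
      using sum_powr_bound[of "s - 1" "s - 3"] by auto
    moreover have "C * real K powr (s - 1) \<le> C * (real K powr (s - 1) + 1)" for K
      using \<open>C > 0\<close> by simp
    ultimately show ?thesis using order.trans by blast
  next
    case False
    then obtain C where C: "C > 0" "\<And>K. (\<Sum>n=1..K. real n powr (s - 3)) \<le> C"
      using sum_powr_bounded[of "s - 3"] by auto
    have "C \<le> C * (real K powr (s - 1) + 1)" for K using C by (simp add: algebra_simps)
    then show ?thesis using C order.trans by blast
  qed
  then obtain C2 where C2: "C2 > 0" "\<And>K. K \<ge> 1 \<Longrightarrow> (\<Sum>n=1..K. real n powr (s - 3)) \<le> C2 * (real K powr (s - 1) + 1)"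
    by auto
  define A where "A = (2::real) powr (\<alpha> + 1)"
  define B where "B = (2::real) powr \<bar>s - 3\<bar>"
  have AB: "A > 0" "B > 0" by (auto simp: A_def B_def)
  have "(\<Sum>k=1..n. (real (n - k) + 1) powr (- \<alpha> - 1) * real k powr (s - 3))
            \<le> (A * C2 + B * C1) * defect_rate \<alpha> s n" if n: "n \<ge> 1" for n
  proof -
    \<comment> \<open>One of the two factors has an argument of at least \<open>n / 2\<close>.\<close>
    have pt: "(real (n - k) + 1) powr (- \<alpha> - 1) * real k powr (s - 3)
        \<le> A * real n powr (- \<alpha> - 1) * real k powr (s - 3) + B * real n powr (s - 3) * (real (n - k) + 1) powr (- \<alpha> - 1)"
      if k: "k \<in> {1..n}" for k
    proof (cases "2 * k \<le> n")
      case True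
      have "real n / 2 \<le> real (n - k) + 1" using True by (simp add: of_nat_diff)
      then have "(real (n - k) + 1) powr (- \<alpha> - 1) \<le> (real n / 2) powr (- \<alpha> - 1)"
        using n a by (intro powr_mono2') auto
      also have "\<dots> = A * real n powr (- \<alpha> - 1)"
      proof -
        have "(real n / 2) powr (- \<alpha> - 1) = real n powr (- \<alpha> - 1) * (real n / (real n / 2)) powr (- (- \<alpha> - 1))"
          using n by (intro powr_rescale) auto
        moreover have "real n / (real n / 2) = 2" using n by simp
        moreover have "- (- \<alpha> - 1) = \<alpha> + 1" by simp
        ultimately show ?thesis by (simp only: A_def mult.commute)
      qed
      finally have "(real (n - k) + 1) powr (- \<alpha> - 1) * real k powr (s - 3) \<le> A * real n powr (- \<alpha> - 1) * real k powr (s - 3)"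
        by (intro mult_right_mono) auto
      moreover have "0 \<le> B * real n powr (s - 3) * (real (n - k) + 1) powr (- \<alpha> - 1)" using AB by simp
      ultimately show ?thesis by linarith
    next
      case False
      have k1: "real k \<le> real n" "real n / 2 \<le> real k" "real k > 0" using k False by auto
      have "real k powr (s - 3) = real n powr (s - 3) * (real n / real k) powr (- (s - 3))"
        using k1 n by (intro powr_rescale) auto
      moreover have "(real n / real k) powr (- (s - 3)) \<le> B"
      proof -
        have "real n / real k \<ge> 1" "real n / real k \<le> 2" using k1 by (auto simp: field_simps)
        then have "(real n / real k) powr (- (s - 3)) \<le> (real n / real k) powr \<bar>s - 3\<bar>"
          by (intro powr_mono) auto
        also have "\<dots> \<le> B" unfolding B_def using \<open>real n / real k \<ge> 1\<close> \<open>real n / real k \<le> 2\<close>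
          by (intro powr_mono2) auto
        finally show ?thesis .
      qed
      ultimately have "real k powr (s - 3) \<le> real n powr (s - 3) * B"
        by (metis mult_left_mono powr_ge_zero)
      then have "real k powr (s - 3) \<le> B * real n powr (s - 3)" by (simp only: mult.commute)
      then have "(real (n - k) + 1) powr (- \<alpha> - 1) * real k powr (s - 3) \<le> (real (n - k) + 1) powr (- \<alpha> - 1) * (B * real n powr (s - 3))"
        by (intro mult_left_mono) auto
      also have "\<dots> = B * real n powr (s - 3) * (real (n - k) + 1) powr (- \<alpha> - 1)" by (simp only: mult_ac)
      finally have "(real (n - k) + 1) powr (- \<alpha> - 1) * real k powr (s - 3) \<le> B * real n powr (s - 3) * (real (n - k) + 1) powr (- \<alpha> - 1)" .
      moreover have "0 \<le> A * real n powr (- \<alpha> - 1) * real k powr (s - 3)" using AB by simp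
      ultimately show ?thesis by linarith
    qed
    have rev: "(\<Sum>k=1..n. (real (n - k) + 1) powr (- \<alpha> - 1)) = (\<Sum>k=1..n. real k powr (- \<alpha> - 1))"
      by (rule sum.reindex_bij_witness[of _ "\<lambda>i. n + 1 - i" "\<lambda>i. n + 1 - i"]) (auto simp: of_nat_diff add.commute add_diff_eq)
    have "(\<Sum>k=1..n. (real (n - k) + 1) powr (- \<alpha> - 1) * real k powr (s - 3))
       \<le> (\<Sum>k=1..n. A * real n powr (- \<alpha> - 1) * real k powr (s - 3) + B * real n powr (s - 3) * (real (n - k) + 1) powr (- \<alpha> - 1))"
      by (intro sum_mono pt)
    also have "\<dots> = A * real n powr (- \<alpha> - 1) * (\<Sum>k=1..n. real k powr (s - 3)) + B * real n powr (s - 3) * (\<Sum>k=1..n. real k powr (- \<alpha> - 1))"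
      by (simp only: sum.distrib sum_distrib_left[symmetric] rev)
    also have "\<dots> \<le> A * real n powr (- \<alpha> - 1) * (C2 * (real n powr (s - 1) + 1)) + B * real n powr (s - 3) * C1"
      using C1(2)[of n] C2(2)[OF n] AB by (intro add_mono mult_left_mono) auto
    also have "\<dots> = A * C2 * defect_rate \<alpha> s n + B * C1 * real n powr (s - 3)"
    proof -
      have "real n powr (- \<alpha> - 1) * real n powr (s - 1) = real n powr (s - \<alpha> - 2)"
        by (simp flip: powr_add)
      then show ?thesis by (simp add: algebra_simps)
    qed
    also have "\<dots> \<le> A * C2 * defect_rate \<alpha> s n + B * C1 * defect_rate \<alpha> s n"
    proof -
      have "real n powr (s - 3) \<le> real n powr (s - \<alpha> - 2)" using n a by (intro powr_mono) auto
      also have "\<dots> \<le> defect_rate \<alpha> s n" by simp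
      finally show ?thesis using AB C1 by (intro add_left_mono mult_left_mono) auto
    qed
    finally show ?thesis by (simp add: algebra_simps)
  qed
  moreover have "A * C2 + B * C1 > 0" using AB C1 C2 by (intro add_pos_pos mult_pos_pos) auto
  ultimately show ?thesis by blast
qed

text \<open>The defect of the uncorrected formula with unit step on \<open>t powr s\<close>. With the exponents
\<open>\<sigma> r\<close> it is the right-hand side of the system that defines the starting weights.\<close>
definition power_defect :: "real \<Rightarrow> real \<Rightarrow> nat \<Rightarrow> real" where
  "power_defect \<alpha> s n = Gamma (s + 1) / Gamma (s + 1 - \<alpha>) * real n powr (s - \<alpha>)
          - (\<Sum>k=0..n. g_coeff \<alpha> (n - k) * real k powr s)"

text \<open>Expand \<open>k powr s\<close> and \<open>n powr (s - \<alpha>)\<close> in the coefficients of powers of \<open>1 - z\<close>. Convolution with \<open>g_coeff \<alpha>\<close> shifts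
the exponents by \<open>\<alpha>\<close>; the leading terms agree, and the terms of next order cancel because
\<open>(s + 1) / 2 - \<alpha> / 2 = (b + 1) / 2\<close> for \<open>b = s - \<alpha>\<close>, which is what the weight \<open>\<alpha> / 2\<close> in the formula is for.\<close>
lemma power_defect_bound:
  assumes a: "0 < \<alpha>" "\<alpha> \<le> 1" and s: "s > 0"
  shows "\<exists>C>0. \<forall>n\<ge>1. \<bar>power_defect \<alpha> s n\<bar> \<le> C * defect_rate \<alpha> s n"
proof -
  define b where "b = s - \<alpha>"
  have b: "b > -1" using a s by (simp add: b_def)
  define c where "c = (\<lambda>b::real. (b + 1) * (3 * b - 2) / 24)"
  define R where "R = (\<lambda>b n. real n powr b / Gamma (b + 1) - (omega_coeff (- b - 1) n - (b + 1) / 2 * omega_coeff (- b) n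
            + c b * omega_coeff (1 - b) n))"
  obtain D where D: "D > 0" "\<And>n. n \<ge> 1 \<Longrightarrow> \<bar>R b n\<bar> \<le> D * real n powr (b - 3)"
    using power_expansion_in_omega_coeffs[OF b] unfolding R_def c_def by auto
  obtain E where E: "E > 0" "\<And>n. n \<ge> 1 \<Longrightarrow> \<bar>R s n\<bar> \<le> E * real n powr (s - 3)"
    using power_expansion_in_omega_coeffs[of s] s unfolding R_def c_def by auto
  obtain G where G: "G > 0" "\<And>n. \<bar>g_coeff \<alpha> n\<bar> \<le> G * (real n + 1) powr (- \<alpha> - 1)"
    using g_coeff_bound[of \<alpha>] a by auto
  obtain H where H: "H > 0" "\<And>n. n \<ge> 1 \<Longrightarrow> (\<Sum>k=1..n. (real (n - k) + 1) powr (- \<alpha> - 1) * real k powr (s - 3))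
            \<le> H * defect_rate \<alpha> s n"
    using convolution_power_bound[OF a, of s] by auto
  obtain W1 where W1: "W1 > 0" "\<And>n. n \<ge> 1 \<Longrightarrow> \<bar>omega_coeff (1 - b) n\<bar> \<le> W1 * real n powr (b - 2)"
    using omega_coeff_bound[of "1 - b"] by auto
  obtain W2 where W2: "W2 > 0" "\<And>n. n \<ge> 1 \<Longrightarrow> \<bar>omega_coeff (2 - b) n\<bar> \<le> W2 * real n powr (b - 3)"
    using omega_coeff_bound[of "2 - b"] by auto
  define k1 where "k1 = c b + (s + 1) / 2 * \<alpha> / 2 - c s"
  define k2 where "k2 = c s * \<alpha> / 2"
  have Gs: "Gamma (s + 1) > 0" "Gamma (b + 1) > 0" using s b by (auto intro: Gamma_real_pos)
  have split: "power_defect \<alpha> s n = Gamma (s + 1) * (k1 * omega_coeff (1 - b) n - k2 * omega_coeff (2 - b) n + R b n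
      - (\<Sum>k=0..n. g_coeff \<alpha> (n - k) * R s k))" for n
  proof -
    have ks: "real k powr s = Gamma (s + 1) * (omega_coeff (- s - 1) k - (s + 1) / 2 * omega_coeff (- s) k
            + c s * omega_coeff (1 - s) k + R s k)" for k
      unfolding R_def using Gs by simp
    have nb: "real n powr b / Gamma (b + 1) = omega_coeff (- b - 1) n - (b + 1) / 2 * omega_coeff (- b) n
            + c b * omega_coeff (1 - b) n + R b n"
      unfolding R_def by simp
    have "(\<Sum>k=0..n. g_coeff \<alpha> (n - k) * real k powr s) = Gamma (s + 1) *
      ((\<Sum>k=0..n. g_coeff \<alpha> (n - k) * omega_coeff (- s - 1) k) - (s + 1) / 2 * (\<Sum>k=0..n. g_coeff \<alpha> (n - k) * omega_coeff (- s) k)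
        + c s * (\<Sum>k=0..n. g_coeff \<alpha> (n - k) * omega_coeff (1 - s) k) + (\<Sum>k=0..n. g_coeff \<alpha> (n - k) * R s k))"
      unfolding ks by (simp add: sum_distrib_left sum.distrib sum_subtractf algebra_simps)
    also have "\<dots> = Gamma (s + 1) *
      ((omega_coeff (- b - 1) n + \<alpha> / 2 * omega_coeff (- b) n) - (s + 1) / 2 * (omega_coeff (- b) n + \<alpha> / 2 * omega_coeff (1 - b) n)
        + c s * (omega_coeff (1 - b) n + \<alpha> / 2 * omega_coeff (2 - b) n) + (\<Sum>k=0..n. g_coeff \<alpha> (n - k) * R s k))"
    proof -
      have e: "\<alpha> + (- s - 1) = - b - 1" "\<alpha> + - s = - b" "\<alpha> + (1 - s) = 1 - b"
          "- b - 1 + 1 = - b" "- b + 1 = 1 - b" "1 - b + 1 = 2 - b"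
        by (simp_all add: b_def)
      show ?thesis by (simp only: g_coeff_convolution_omega e)
    qed
    finally have "power_defect \<alpha> s n = Gamma (s + 1) * (real n powr b / Gamma (b + 1)) - Gamma (s + 1) *
      ((omega_coeff (- b - 1) n + \<alpha> / 2 * omega_coeff (- b) n) - (s + 1) / 2 * (omega_coeff (- b) n + \<alpha> / 2 * omega_coeff (1 - b) n)
        + c s * (omega_coeff (1 - b) n + \<alpha> / 2 * omega_coeff (2 - b) n) + (\<Sum>k=0..n. g_coeff \<alpha> (n - k) * R s k))"
      unfolding power_defect_def by (simp add: b_def algebra_simps)
    also have "\<dots> = Gamma (s + 1) * (k1 * omega_coeff (1 - b) n - k2 * omega_coeff (2 - b) n + R b n
      - (\<Sum>k=0..n. g_coeff \<alpha> (n - k) * R s k) + (s - \<alpha> - b) / 2 * omega_coeff (- b) n)"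
      unfolding nb k1_def k2_def by (simp add: field_simps)
    finally show ?thesis by (simp add: b_def)
  qed
  define C where "C = Gamma (s + 1) * (\<bar>k1\<bar> * W1 + \<bar>k2\<bar> * W2 + D + G * \<bar>R s 0\<bar> + G * E * H)"
  have "\<bar>power_defect \<alpha> s n\<bar> \<le> C * defect_rate \<alpha> s n" if n: "n \<ge> 1" for n
  proof -
    define X where "X = defect_rate \<alpha> s n"
    have X1: "real n powr (b - 2) \<le> X" by (simp add: X_def b_def)
    have X2: "real n powr (b - 3) \<le> X"
      by (rule order.trans[OF powr_mono X1]) (use n in auto)
    have X3: "(real n + 1) powr (- \<alpha> - 1) \<le> X"
    proof -
      have "(real n + 1) powr (- \<alpha> - 1) \<le> real n powr (- \<alpha> - 1)" using n a by (intro powr_mono2') auto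
      then show ?thesis unfolding X_def by (smt (verit) powr_ge_zero)
    qed
    have s1: "\<bar>\<Sum>k=0..n. g_coeff \<alpha> (n - k) * R s k\<bar> \<le> (G * \<bar>R s 0\<bar> + G * E * H) * X"
    proof -
      have "\<bar>\<Sum>k=0..n. g_coeff \<alpha> (n - k) * R s k\<bar> \<le> (\<Sum>k=0..n. \<bar>g_coeff \<alpha> (n - k)\<bar> * \<bar>R s k\<bar>)"
        by (intro order.trans[OF sum_abs]) (simp add: abs_mult)
      also have "\<dots> = \<bar>g_coeff \<alpha> n\<bar> * \<bar>R s 0\<bar> + (\<Sum>k=1..n. \<bar>g_coeff \<alpha> (n - k)\<bar> * \<bar>R s k\<bar>)"
        by (simp add: sum.atLeast_Suc_atMost)
      also have "\<dots> \<le> (G * (real n + 1) powr (- \<alpha> - 1)) * \<bar>R s 0\<bar> +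
          (\<Sum>k=1..n. (G * (real (n - k) + 1) powr (- \<alpha> - 1)) * (E * real k powr (s - 3)))"
      proof (intro add_mono mult_right_mono sum_mono mult_mono)
        fix k assume "k \<in> {1..n}"
        then show "\<bar>R s k\<bar> \<le> E * real k powr (s - 3)" by (intro E(2)) auto
      qed (use G E in \<open>auto simp del: of_nat_diff\<close>)
      also have "(\<Sum>k=1..n. (G * (real (n - k) + 1) powr (- \<alpha> - 1)) * (E * real k powr (s - 3)))
          = G * E * (\<Sum>k=1..n. (real (n - k) + 1) powr (- \<alpha> - 1) * real k powr (s - 3))"
        by (simp add: sum_distrib_left mult_ac)
      also have "\<dots> \<le> G * E * (H * X)" using H(2)[OF n] G E unfolding X_def by (intro mult_left_mono) auto
      also have "G * (real n + 1) powr (- \<alpha> - 1) * \<bar>R s 0\<bar> \<le> G * X * \<bar>R s 0\<bar>" using X3 G by (intro mult_right_mono mult_left_mono) auto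
      finally show ?thesis by (simp add: algebra_simps)
    qed
    have "\<bar>k1 * omega_coeff (1 - b) n\<bar> \<le> \<bar>k1\<bar> * (W1 * X)"
      unfolding abs_mult using W1(2)[OF n] W1(1) X1 by (intro mult_left_mono order.trans[OF W1(2)[OF n]] mult_left_mono) auto
    moreover have "\<bar>k2 * omega_coeff (2 - b) n\<bar> \<le> \<bar>k2\<bar> * (W2 * X)"
      unfolding abs_mult using W2(1) X2 by (intro mult_left_mono order.trans[OF W2(2)[OF n]] mult_left_mono) auto
    moreover have "\<bar>R b n\<bar> \<le> D * X" using D(1) X2 by (intro order.trans[OF D(2)[OF n]] mult_left_mono) auto
    ultimately have "\<bar>k1 * omega_coeff (1 - b) n - k2 * omega_coeff (2 - b) n + R b n - (\<Sum>k=0..n. g_coeff \<alpha> (n - k) * R s k)\<bar>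
       \<le> \<bar>k1\<bar> * (W1 * X) + \<bar>k2\<bar> * (W2 * X) + D * X + (G * \<bar>R s 0\<bar> + G * E * H) * X"
      using s1 by linarith
    then have "\<bar>power_defect \<alpha> s n\<bar> \<le> Gamma (s + 1) * (\<bar>k1\<bar> * (W1 * X) + \<bar>k2\<bar> * (W2 * X) + D * X + (G * \<bar>R s 0\<bar> + G * E * H) * X)"
      unfolding split abs_mult using Gs by simp
    then show ?thesis unfolding X_def[symmetric] C_def by (simp add: algebra_simps)
  qed
  moreover have "C > 0" unfolding C_def using Gs W1 W2 D G E H
    by (intro mult_pos_pos add_nonneg_pos add_nonneg_nonneg add_pos_nonneg) auto
  ultimately show ?thesis by blast
qed

section \<open>Coercivity of the discrete convolution\<close>

definition g_partial :: "real \<Rightarrow> nat \<Rightarrow> real" where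
  "g_partial \<alpha> N = (\<Sum>k\<le>N. g_coeff \<alpha> k)"

lemma g_partial_omega: "g_partial \<alpha> N = omega_coeff (\<alpha> - 1) N + \<alpha> / 2 * omega_coeff \<alpha> N"
  unfolding g_partial_def g_coeff_omega sum.distrib sum_distrib_left[symmetric] omega_coeff_partial_sum
  by simp

lemma omega_coeff_nonneg: "\<alpha> \<le> 1 \<Longrightarrow> omega_coeff (\<alpha> - 1) k \<ge> 0"
  by (induction k) (auto simp: omega_coeff_Suc intro!: divide_nonneg_nonneg mult_nonneg_nonneg)

lemma omega_coeff_pos: "\<alpha> < 1 \<Longrightarrow> omega_coeff (\<alpha> - 1) k > 0"
  by (induction k) (auto simp: omega_coeff_Suc intro!: divide_pos_pos mult_pos_pos)

lemma omega_coeff_nonpos: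
  assumes "0 \<le> \<alpha>" "\<alpha> \<le> 1" shows "omega_coeff \<alpha> (Suc k) \<le> 0"
proof (induction k)
  case 0 show ?case using assms by (simp add: omega_coeff_Suc)
next
  case (Suc k)
  have "omega_coeff \<alpha> (Suc k) * (real (Suc k) - \<alpha>) \<le> 0"
    using Suc assms by (intro mult_nonpos_nonneg) auto
  then show ?case unfolding omega_coeff_Suc[of \<alpha> "Suc k"] by (intro divide_nonpos_nonneg) auto
qed

text \<open>By \<open>g_partial_omega\<close> the partial sum combines \<open>omega_coeff (\<alpha> - 1)\<close> at \<open>i\<close> and \<open>Suc i\<close>, hence is an explicit multiple of the
value at \<open>i\<close>. The factor is at least \<open>1 / 4\<close> for \<open>i \<ge> 1\<close>; at \<open>i = 0\<close> it can be negative.\<close>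
lemma g_partial_lower:
  assumes "0 \<le> \<alpha>" "\<alpha> \<le> 1" and "i \<ge> 1"
  shows "g_partial \<alpha> (Suc i) \<ge> 1 / 4 * omega_coeff (\<alpha> - 1) i"
proof -
  have d: "omega_coeff \<alpha> (Suc i) = omega_coeff (\<alpha> - 1) (Suc i) - omega_coeff (\<alpha> - 1) i"
    using omega_coeff_diff[of "\<alpha> - 1" i] by simp
  have "g_partial \<alpha> (Suc i) = omega_coeff (\<alpha> - 1) i * ((1 + \<alpha> / 2) * ((real i - (\<alpha> - 1)) / (real i + 1)) - \<alpha> / 2)"
  proof -
    define t where "t = (real i - (\<alpha> - 1)) / (real i + 1)"
    have "omega_coeff (\<alpha> - 1) (Suc i) = omega_coeff (\<alpha> - 1) i * t" by (simp add: omega_coeff_Suc t_def)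
    then show ?thesis unfolding g_partial_omega d t_def[symmetric] by (simp add: algebra_simps)
  qed
  also have "\<dots> \<ge> omega_coeff (\<alpha> - 1) i * (1 / 4)"
  proof (rule mult_left_mono)
    have can: "\<alpha> / 2 * (real i + 1) / (real i + 1) = \<alpha> / 2" by (rule nonzero_mult_div_cancel_right) simp
    have "\<alpha> * \<alpha> \<le> 1 * 1" using assms by (intro mult_mono) auto
    moreover have "real i \<ge> 1" using assms by simp
    ultimately have "1 / 4 * (real i + 1) \<le> real i + 1 - \<alpha> - \<alpha> * \<alpha> / 2"
      using assms(1,2) by (simp add: field_simps)
    also have "\<dots> = (1 + \<alpha> / 2) * (real i - (\<alpha> - 1)) - \<alpha> / 2 * (real i + 1)"
      by (simp add: field_simps)
    finally have "1 / 4 * (real i + 1) \<le> (1 + \<alpha> / 2) * (real i - (\<alpha> - 1)) - \<alpha> / 2 * (real i + 1)" .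
    then have "1 / 4 \<le> ((1 + \<alpha> / 2) * (real i - (\<alpha> - 1)) - \<alpha> / 2 * (real i + 1)) / (real i + 1)"
      by (simp add: pos_le_divide_eq)
    also have "\<dots> = (1 + \<alpha> / 2) * ((real i - (\<alpha> - 1)) / (real i + 1)) - \<alpha> / 2"
      by (simp only: diff_divide_distrib[of "(1 + \<alpha> / 2) * (real i - (\<alpha> - 1))"] can times_divide_eq_right)
    finally show "1 / 4 \<le> (1 + \<alpha> / 2) * ((real i - (\<alpha> - 1)) / (real i + 1)) - \<alpha> / 2" .
  qed (use assms in \<open>auto intro: omega_coeff_nonneg\<close>)
  finally show ?thesis by simp
qed

lemma g_partial_nonneg:
  assumes "0 \<le> \<alpha>" "\<alpha> \<le> 1" "N \<ge> 2" shows "g_partial \<alpha> N \<ge> 0"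
proof -
  obtain i where i: "N = Suc i" "i \<ge> 1" using assms(3) by (cases N) auto
  have "0 \<le> 1 / 4 * omega_coeff (\<alpha> - 1) i" using omega_coeff_nonneg[of \<alpha> i] assms by simp
  also have "\<dots> \<le> g_partial \<alpha> N" using g_partial_lower[of \<alpha> i] i assms by simp
  finally show ?thesis .
qed

lemma g_coeff_nonpos:
  assumes "0 \<le> \<alpha>" "\<alpha> \<le> 1" "k \<ge> 3" shows "g_coeff \<alpha> k \<le> 0"
proof -
  obtain i where i: "k = Suc i" "i \<ge> 2" using assms(3) by (cases k) auto
  obtain j where j: "i = Suc j" using i by (cases i) auto
  have "g_coeff \<alpha> k = omega_coeff \<alpha> i * ((1 + \<alpha> / 2) * ((real i - \<alpha>) / (real i + 1)) - \<alpha> / 2)"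
  proof -
    define t where "t = (real i - \<alpha>) / (real i + 1)"
    have "omega_coeff \<alpha> (Suc i) = omega_coeff \<alpha> i * t" by (simp add: omega_coeff_Suc t_def)
    then have "g_coeff \<alpha> k = (1 + \<alpha> / 2) * (omega_coeff \<alpha> i * t) - \<alpha> / 2 * omega_coeff \<alpha> i"
      unfolding i(1) g_coeff_def by (simp add: add_divide_distrib)
    then show ?thesis unfolding t_def[symmetric] by (simp add: algebra_simps)
  qed
  also have "\<dots> \<le> 0"
  proof (rule mult_nonpos_nonneg)
    show "omega_coeff \<alpha> i \<le> 0" unfolding j using omega_coeff_nonpos assms by simp
    have can: "\<alpha> / 2 * (real i + 1) / (real i + 1) = \<alpha> / 2" by (rule nonzero_mult_div_cancel_right) simp
    have "\<alpha> * \<alpha> \<le> 1 * 1" using assms by (intro mult_mono) auto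
    moreover have "real i \<ge> 2" using i by simp
    moreover have "(1 + \<alpha> / 2) * (real i - \<alpha>) - \<alpha> / 2 * (real i + 1) = real i - 3 / 2 * \<alpha> - \<alpha> * \<alpha> / 2"
      by (simp add: field_simps)
    ultimately have "0 \<le> (1 + \<alpha> / 2) * (real i - \<alpha>) - \<alpha> / 2 * (real i + 1)"
      using assms by linarith
    then have "0 \<le> ((1 + \<alpha> / 2) * (real i - \<alpha>) - \<alpha> / 2 * (real i + 1)) / (real i + 1)" by simp
    also have "\<dots> = (1 + \<alpha> / 2) * ((real i - \<alpha>) / (real i + 1)) - \<alpha> / 2"
      by (simp only: diff_divide_distrib[of "(1 + \<alpha> / 2) * (real i - \<alpha>)"] can times_divide_eq_right)
    finally show "0 \<le> (1 + \<alpha> / 2) * ((real i - \<alpha>) / (real i + 1)) - \<alpha> / 2" .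
  qed
  finally show ?thesis .
qed

lemma g_coeff_1: "g_coeff \<alpha> (Suc 0) = - (3 * \<alpha> + \<alpha>\<^sup>2) / 2"
  and g_coeff_2: "g_coeff \<alpha> (Suc (Suc 0)) = \<alpha> / 2 * (\<alpha>\<^sup>2 / 2 + 3 * \<alpha> / 2 - 1)"
  by (simp_all add: g_coeff_def omega_coeff_Suc field_simps power2_eq_square)

text \<open>The third coefficient changes sign in \<open>\<alpha>\<close>, so the form has no sign structure coefficient by coefficient;
this is the inequality that makes up for it.\<close>
lemma g_coeff_1_2:
  assumes "0 \<le> \<alpha>" "\<alpha> \<le> 1"
  shows "4 * g_coeff \<alpha> (Suc (Suc 0)) \<le> - g_coeff \<alpha> (Suc 0)" "g_coeff \<alpha> (Suc 0) \<le> 0"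
proof -
  have "- g_coeff \<alpha> (Suc 0) - 4 * g_coeff \<alpha> (Suc (Suc 0)) = \<alpha> * (1 - \<alpha>) * (7 / 2 + \<alpha>)"
    unfolding g_coeff_1 g_coeff_2 by (simp add: field_simps power2_eq_square)
  also have "\<dots> \<ge> 0" using assms by (intro mult_nonneg_nonneg) auto
  finally show "4 * g_coeff \<alpha> (Suc (Suc 0)) \<le> - g_coeff \<alpha> (Suc 0)" by simp
  have "0 \<le> (3 * \<alpha> + \<alpha>\<^sup>2) / 2" using assms by simp
  then show "g_coeff \<alpha> (Suc 0) \<le> 0"
    unfolding g_coeff_1 by (simp only: minus_divide_left[symmetric] neg_le_0_iff_le)
qed

text \<open>The first \<open>k\<close> squares appear because the shifted copy of \<open>E\<close> loses them.\<close>
lemma autocorrelation_identity: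
  fixes E :: "nat \<Rightarrow> real"
  assumes E: "\<And>n. n > L \<Longrightarrow> E n = 0"
  shows "2 * (\<Sum>n\<le>L. E n * E n) - 2 * (\<Sum>n\<le>L. E n * E (n + k)) = (\<Sum>n\<le>L. (E (n + k) - E n)\<^sup>2) + (\<Sum>n<k. (E n)\<^sup>2)"
proof -
  have "(\<Sum>n\<le>L. (E (n + k))\<^sup>2) = (\<Sum>n\<in>{k..L + k}. (E n)\<^sup>2)"
    using sum.shift_bounds_cl_nat_ivl[of "\<lambda>n. (E n)\<^sup>2" 0 k L] by (simp add: atLeast0AtMost)
  moreover have "(\<Sum>n<k. (E n)\<^sup>2) + (\<Sum>n\<in>{k..L + k}. (E n)\<^sup>2) = (\<Sum>n\<in>{..<k} \<union> {k..L + k}. (E n)\<^sup>2)"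
    by (rule sum.union_disjoint[symmetric]) auto
  moreover have "(\<Sum>n\<in>{..<k} \<union> {k..L + k}. (E n)\<^sup>2) = (\<Sum>n\<le>L. (E n)\<^sup>2)"
    by (rule sum.mono_neutral_right) (auto simp: E)
  ultimately have "(\<Sum>n<k. (E n)\<^sup>2) + (\<Sum>n\<le>L. (E (n + k))\<^sup>2) = (\<Sum>n\<le>L. (E n)\<^sup>2)" by simp
  moreover have "(\<Sum>n\<le>L. (E (n + k) - E n)\<^sup>2) = (\<Sum>n\<le>L. (E (n + k))\<^sup>2) + (\<Sum>n\<le>L. (E n)\<^sup>2) - 2 * (\<Sum>n\<le>L. E n * E (n + k))"
    by (simp add: power2_diff sum.distrib sum_subtractf sum_distrib_left mult_ac)
  ultimately show ?thesis by (simp add: power2_eq_square)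
qed

lemma convolution_form_as_autocorrelations:
  fixes E g :: "nat \<Rightarrow> real"
  assumes E: "\<And>n. n > L \<Longrightarrow> E n = 0" and N: "N \<ge> L"
  shows "(\<Sum>n\<le>L. E n * (\<Sum>k\<le>n. g (n - k) * E k)) = (\<Sum>i\<le>N. g i * (\<Sum>n\<le>L. E n * E (n + i)))"
proof -
  have "(\<Sum>n\<le>L. E n * (\<Sum>k\<le>n. g (n - k) * E k)) = (\<Sum>n\<le>L. \<Sum>k\<le>n. g (n - k) * E k * E (k + (n - k)))"
    by (simp add: sum_distrib_left mult_ac)
  also have "\<dots> = (\<Sum>(k, i)\<in>{(k, i). k + i \<le> L}. g i * E k * E (k + i))"
    by (rule sum.triangle_reindex_eq[symmetric])
  also have "\<dots> = (\<Sum>(k, i)\<in>{..L} \<times> {..N}. g i * E k * E (k + i))"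
  proof (rule sum.mono_neutral_left)
    have z: "g i * E k * E (k + i) = 0" if "\<not> k + i \<le> L" for k i
      using E[of "k + i"] that by simp
    show "\<forall>p\<in>{..L} \<times> {..N} - {(k, i). k + i \<le> L}. (case p of (k, i) \<Rightarrow> g i * E k * E (k + i)) = 0"
    proof
      fix p assume p: "p \<in> {..L} \<times> {..N} - {(k, i). k + i \<le> L}"
      obtain k i where "p = (k, i)" by (cases p)
      with p z[of k i] show "(case p of (k, i) \<Rightarrow> g i * E k * E (k + i)) = 0" by simp
    qed
    show "{(k, i). k + i \<le> L} \<subseteq> {..L} \<times> {..N}" using N by auto
  qed simp
  also have "\<dots> = (\<Sum>k\<le>L. \<Sum>i\<le>N. g i * E k * E (k + i))" by (rule sum.cartesian_product[symmetric])
  also have "\<dots> = (\<Sum>i\<le>N. \<Sum>k\<le>L. g i * E k * E (k + i))" by (rule sum.swap)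
  finally show ?thesis by (simp add: sum_distrib_left mult_ac)
qed

text \<open>Write the form through the autocorrelations \<open>C i\<close> as \<open>g_partial N * C 0 - (\<Sum>i. g i * (C 0 - C i))\<close>. Each
\<open>C 0 - C i\<close> is at least half the sum of the first \<open>i\<close> squares, and for \<open>i \<ge> 3\<close> the coefficients are nonpositive, so
these terms contribute tails of the coefficients, which combine with the first term to partial
sums. The terms \<open>i = 1, 2\<close> together have the right sign; for this the first two entries must vanish.\<close>
lemma g_form_lower_bound_padded:
  assumes a: "0 \<le> \<alpha>" "\<alpha> \<le> 1" and E: "\<And>n. n > L \<Longrightarrow> E n = 0" "\<And>n. n < 2 \<Longrightarrow> E n = 0"
  shows "(\<Sum>n\<le>L. E n * (\<Sum>k\<le>n. g_coeff \<alpha> (n - k) * E k)) \<ge> 1 / 2 * (\<Sum>n\<le>L. g_partial \<alpha> (max 2 n) * (E n)\<^sup>2)"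
proof -
  define C where "C = (\<lambda>k. \<Sum>n\<le>L. E n * E (n + k))"
  \<comment> \<open>Large enough for \<open>C N = 0\<close> and for \<open>N \<ge> 2\<close>.\<close>
  define N where "N = L + 2"
  define g where "g = g_coeff \<alpha>"
  have id: "2 * C 0 - 2 * C k = (\<Sum>n\<le>L. (E (n + k) - E n)\<^sup>2) + (\<Sum>n<k. (E n)\<^sup>2)" for k
    unfolding C_def using autocorrelation_identity[of L E k] E by simp
  have low: "C 0 - C k \<ge> 1 / 2 * (\<Sum>n<k. (E n)\<^sup>2)" for k
    using id[of k] sum_nonneg[of "{..L}" "\<lambda>n. (E (n + k) - E n)\<^sup>2"] by simp
  have C0: "C 0 - C k \<ge> 0" for k using low[of k] sum_nonneg[of "{..<k}" "\<lambda>n. (E n)\<^sup>2"] by simp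
  have C2: "C 0 - C 2 \<le> 4 * (C 0 - C 1)"
  proof -
    \<comment> \<open>A difference over two steps is the sum of two differences over one step.\<close>
    have "(\<Sum>n\<le>L. (E (n + 2) - E n)\<^sup>2) \<le> (\<Sum>n\<le>L. 2 * (E (Suc n + 1) - E (Suc n))\<^sup>2 + 2 * (E (n + 1) - E n)\<^sup>2)"
    proof (rule sum_mono)
      fix n
      have "0 \<le> ((E (n + 2) - E (n + 1)) - (E (n + 1) - E n))\<^sup>2" by simp
      then show "(E (n + 2) - E n)\<^sup>2 \<le> 2 * (E (Suc n + 1) - E (Suc n))\<^sup>2 + 2 * (E (n + 1) - E n)\<^sup>2"
        by (simp add: power2_eq_square algebra_simps)
    qed
    also have "\<dots> = 2 * (\<Sum>n\<le>L. (E (Suc n + 1) - E (Suc n))\<^sup>2) + 2 * (\<Sum>n\<le>L. (E (n + 1) - E n)\<^sup>2)"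
      by (simp add: sum.distrib sum_distrib_left)
    also have "(\<Sum>n\<le>L. (E (Suc n + 1) - E (Suc n))\<^sup>2) \<le> (\<Sum>n\<le>L. (E (n + 1) - E n)\<^sup>2)"
    proof -
      have "(\<Sum>n\<le>L. (E (Suc n + 1) - E (Suc n))\<^sup>2) \<le> (E (0 + 1) - E 0)\<^sup>2 + (\<Sum>n\<le>L. (E (Suc n + 1) - E (Suc n))\<^sup>2)" by simp
      also have "\<dots> = (\<Sum>n\<le>Suc L. (E (n + 1) - E n)\<^sup>2)" by (rule sum.atMost_Suc_shift[symmetric])
      also have "\<dots> = (\<Sum>n\<le>L. (E (n + 1) - E n)\<^sup>2)" using E(1) by simp
      finally show ?thesis .
    qed
    finally have "(\<Sum>n\<le>L. (E (n + 2) - E n)\<^sup>2) \<le> 4 * (\<Sum>n\<le>L. (E (n + 1) - E n)\<^sup>2)" by simp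
    moreover have "(\<Sum>n<2. (E n)\<^sup>2) = 0" "(\<Sum>n<1. (E n)\<^sup>2) = 0" using E(2) by auto
    ultimately show ?thesis using id[of 2] id[of 1] by simp
  qed
  have "(\<Sum>n\<le>L. E n * (\<Sum>k\<le>n. g (n - k) * E k)) = (\<Sum>i\<le>N. g i * C i)"
    unfolding C_def by (rule convolution_form_as_autocorrelations) (auto simp: E N_def)
  also have "\<dots> = g_partial \<alpha> N * C 0 - (\<Sum>i\<le>N. g i * (C 0 - C i))"
    by (simp add: g_partial_def g_def sum_distrib_right sum_subtractf right_diff_distrib)
  also have "(\<Sum>i\<le>N. g i * (C 0 - C i)) = (\<Sum>i\<le>2. g i * (C 0 - C i)) + (\<Sum>i=3..N. g i * (C 0 - C i))"
  proof -
    have "{..N} = {..2} \<union> {3..N}" by (auto simp: N_def)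
    then show ?thesis by (simp add: sum.union_disjoint)
  qed
  finally have F: "(\<Sum>n\<le>L. E n * (\<Sum>k\<le>n. g (n - k) * E k)) = g_partial \<alpha> N * C 0 - ((\<Sum>i\<le>2. g i * (C 0 - C i)) + (\<Sum>i=3..N. g i * (C 0 - C i)))" .
  have s1: "(\<Sum>i\<le>2. g i * (C 0 - C i)) \<le> 0"
  proof -
    have "(\<Sum>i\<le>2. g i * (C 0 - C i)) = g 1 * (C 0 - C 1) + g 2 * (C 0 - C 2)" by (simp add: eval_nat_numeral)
    also have "\<dots> \<le> 0"
    proof (cases "g 2 \<ge> 0")
      case True
      have "g 2 * (C 0 - C 2) \<le> g 2 * (4 * (C 0 - C 1))" using C2 True by (rule mult_left_mono)
      also have "\<dots> = (4 * g 2) * (C 0 - C 1)" by simp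
      also have "\<dots> \<le> (- g 1) * (C 0 - C 1)" using g_coeff_1_2(1)[OF a] C0 unfolding g_def
        by (intro mult_right_mono) (auto simp: eval_nat_numeral)
      finally show ?thesis by simp
    next
      case False
      have "g 1 * (C 0 - C 1) \<le> 0" using g_coeff_1_2(2)[OF a] C0[of 1] by (intro mult_nonpos_nonneg) (auto simp: g_def)
      moreover have "g 2 * (C 0 - C 2) \<le> 0" using False C0[of 2] by (intro mult_nonpos_nonneg) auto
      ultimately show ?thesis by simp
    qed
    finally show ?thesis .
  qed
  have s2: "(\<Sum>i=3..N. g i * (C 0 - C i)) \<le> 1 / 2 * (\<Sum>n\<le>L. (g_partial \<alpha> N - g_partial \<alpha> (max 2 n)) * (E n)\<^sup>2)"
  proof -
    have "(\<Sum>i=3..N. g i * (C 0 - C i)) \<le> (\<Sum>i=3..N. g i * (1 / 2 * (\<Sum>n<i. (E n)\<^sup>2)))"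
      using g_coeff_nonpos[OF a] low by (intro sum_mono mult_left_mono_neg) (auto simp: g_def)
    also have "\<dots> = 1 / 2 * (\<Sum>i=3..N. \<Sum>n\<le>L. (if n < i then g i else 0) * (E n)\<^sup>2)"
    proof -
      have "(\<Sum>n<i. (E n)\<^sup>2) * g i = (\<Sum>n\<le>L. (if n < i then g i else 0) * (E n)\<^sup>2)" for i
      proof -
        have "(\<Sum>n<i. (E n)\<^sup>2) = (\<Sum>n\<in>{..L} \<inter> {n. n < i}. (E n)\<^sup>2)"
          by (rule sum.mono_neutral_right) (auto simp: not_le[symmetric] intro: E(1) ccontr)
        also have "\<dots> = (\<Sum>n\<le>L. if n < i then (E n)\<^sup>2 else 0)" by (subst sum.inter_restrict) auto
        finally show ?thesis by (auto simp: sum_distrib_left mult.commute intro!: sum.cong)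
      qed
      then have "g i * (1 / 2 * (\<Sum>n<i. (E n)\<^sup>2)) = 1 / 2 * (\<Sum>n\<le>L. (if n < i then g i else 0) * (E n)\<^sup>2)" for i
        by (simp only: mult_ac) (simp add: mult.commute)
      then show ?thesis by (simp only: sum_distrib_left)
    qed
    also have "(\<Sum>i=3..N. \<Sum>n\<le>L. (if n < i then g i else 0) * (E n)\<^sup>2) = (\<Sum>n\<le>L. (\<Sum>i=3..N. if n < i then g i else 0) * (E n)\<^sup>2)"
      by (subst sum.swap) (simp add: sum_distrib_right)
    also have "\<dots> = (\<Sum>n\<le>L. (g_partial \<alpha> N - g_partial \<alpha> (max 2 n)) * (E n)\<^sup>2)"
    proof (rule sum.cong[OF refl])
      fix n assume "n \<in> {..L}"
      then have n: "max 2 n \<le> N" by (auto simp: N_def)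
      have "(\<Sum>i=3..N. if n < i then g i else 0) = (\<Sum>i\<in>{3..N} \<inter> {i. n < i}. g i)" by (subst sum.inter_restrict) auto
      also have "{3..N} \<inter> {i. n < i} = {max 2 n<..N}" by auto
      also have "(\<Sum>i\<in>{max 2 n<..N}. g i) = g_partial \<alpha> N - g_partial \<alpha> (max 2 n)"
      proof -
        have "{..N} = {..max 2 n} \<union> {max 2 n<..N}" using n by auto
        moreover have "sum g ({..max 2 n} \<union> {max 2 n<..N}) = sum g {..max 2 n} + sum g {max 2 n<..N}"
          by (rule sum.union_disjoint) auto
        ultimately show ?thesis by (simp add: g_partial_def g_def)
      qed
      finally show "(\<Sum>i=3..N. if n < i then g i else 0) * (E n)\<^sup>2 = (g_partial \<alpha> N - g_partial \<alpha> (max 2 n)) * (E n)\<^sup>2" by simp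
    qed
    finally show ?thesis .
  qed
  have C0': "C 0 = (\<Sum>n\<le>L. (E n)\<^sup>2)" by (simp add: C_def power2_eq_square)
  have "g_partial \<alpha> N * C 0 \<ge> 0" unfolding C0' using g_partial_nonneg[OF a, of N]
    by (intro mult_nonneg_nonneg sum_nonneg) (auto simp: N_def)
  moreover have "(\<Sum>n\<le>L. (g_partial \<alpha> N - g_partial \<alpha> (max 2 n)) * (E n)\<^sup>2) = g_partial \<alpha> N * C 0 - (\<Sum>n\<le>L. g_partial \<alpha> (max 2 n) * (E n)\<^sup>2)"
    unfolding C0' by (simp add: sum_distrib_left left_diff_distrib sum_subtractf)
  ultimately show ?thesis using F s1 s2 unfolding g_def by linarith
qed

definition g_form :: "real \<Rightarrow> (nat \<Rightarrow> real) \<Rightarrow> nat \<Rightarrow> real" where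
  "g_form \<alpha> e K = (\<Sum>n=1..K. e n * (\<Sum>k=1..n. g_coeff \<alpha> (n - k) * e k))"

text \<open>The entries start at index \<open>1\<close>, so one further shift provides the two vanishing entries. The shift is also
the reason why partial sums up to \<open>Suc n\<close> appear, which are never negative.\<close>
lemma g_form_lower_bound:
  assumes a: "0 \<le> \<alpha>" "\<alpha> \<le> 1"
  shows "g_form \<alpha> e K \<ge> 1 / 2 * (\<Sum>n=1..K. g_partial \<alpha> (Suc n) * (e n)\<^sup>2)"
proof -
  define E where "E = (\<lambda>n. if 2 \<le> n \<and> n \<le> Suc K then e (n - 1) else 0)"
  have sh: "(\<Sum>n\<le>Suc M. f n) = (\<Sum>n=1..M. f (Suc n))" if "f 0 = 0" "f 1 = 0" for M and f :: "nat \<Rightarrow> real"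
  proof -
    have "(\<Sum>n\<le>Suc M. f n) = (\<Sum>n=2..Suc M. f n)"
      by (rule sum.mono_neutral_right) (use that in \<open>auto simp: not_le less_Suc_eq numeral_2_eq_2\<close>)
    also have "\<dots> = (\<Sum>n=Suc 1..Suc M. f n)" by (simp add: numeral_2_eq_2)
    finally show ?thesis by (simp only: sum.shift_bounds_cl_Suc_ivl)
  qed
  have E01: "E 0 = 0" "E 1 = 0" by (auto simp: E_def)
  have "(\<Sum>n\<le>Suc K. E n * (\<Sum>k\<le>n. g_coeff \<alpha> (n - k) * E k)) = (\<Sum>n=1..K. E (Suc n) * (\<Sum>k\<le>Suc n. g_coeff \<alpha> (Suc n - k) * E k))"
    by (rule sh) (simp_all add: E01[simplified])
  also have "\<dots> = g_form \<alpha> e K" unfolding g_form_def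
  proof (rule sum.cong[OF refl])
    fix n assume n: "n \<in> {1..K}"
    have "(\<Sum>k\<le>Suc n. g_coeff \<alpha> (Suc n - k) * E k) = (\<Sum>k=1..n. g_coeff \<alpha> (Suc n - Suc k) * E (Suc k))"
      by (rule sh) (auto simp: E01[simplified])
    also have "\<dots> = (\<Sum>k=1..n. g_coeff \<alpha> (n - k) * e k)" using n by (intro sum.cong) (auto simp: E_def)
    finally show "E (Suc n) * (\<Sum>k\<le>Suc n. g_coeff \<alpha> (Suc n - k) * E k) = e n * (\<Sum>k=1..n. g_coeff \<alpha> (n - k) * e k)"
      using n by (simp add: E_def)
  qed
  moreover have "(\<Sum>n\<le>Suc K. g_partial \<alpha> (max 2 n) * (E n)\<^sup>2) = (\<Sum>n=1..K. g_partial \<alpha> (max 2 (Suc n)) * (E (Suc n))\<^sup>2)"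
    by (rule sh) (auto simp: E01[simplified])
  moreover have "\<dots> = (\<Sum>n=1..K. g_partial \<alpha> (Suc n) * (e n)\<^sup>2)"
    by (intro sum.cong) (auto simp: E_def max_def)
  moreover have "(\<Sum>n\<le>Suc K. E n * (\<Sum>k\<le>n. g_coeff \<alpha> (n - k) * E k)) \<ge> 1 / 2 * (\<Sum>n\<le>Suc K. g_partial \<alpha> (max 2 n) * (E n)\<^sup>2)"
    by (rule g_form_lower_bound_padded[OF a]) (auto simp: E_def)
  ultimately show ?thesis by simp
qed

lemma g_form_nonneg:
  assumes a: "0 \<le> \<alpha>" "\<alpha> \<le> 1" shows "g_form \<alpha> e K \<ge> 0"
proof -
  have "0 \<le> 1 / 2 * (\<Sum>n=1..K. g_partial \<alpha> (Suc n) * (e n)\<^sup>2)"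
    using g_partial_nonneg[OF a] by (intro mult_nonneg_nonneg sum_nonneg) auto
  also have "\<dots> \<le> g_form \<alpha> e K" by (rule g_form_lower_bound[OF a])
  finally show ?thesis .
qed

text \<open>All terms are positive and the quotient has a positive limit, so the reciprocals of the quotients are bounded.\<close>
lemma omega_coeff_lower:
  assumes "\<alpha> < 1"
  shows "\<exists>c>0. \<forall>n\<ge>1. omega_coeff (\<alpha> - 1) n \<ge> c * real n powr (- \<alpha>)"
proof -
  have G: "Gamma (1 - \<alpha>) > 0" using assms by (intro Gamma_real_pos) auto
  have "(\<lambda>n. omega_coeff (\<alpha> - 1) n * real n powr \<alpha>) \<longlonglongrightarrow> inverse (Gamma (1 - \<alpha>))"
    using omega_coeff_limit[of "\<alpha> - 1"] by simp
  then have "(\<lambda>n. inverse (omega_coeff (\<alpha> - 1) n * real n powr \<alpha>)) \<longlonglongrightarrow> inverse (inverse (Gamma (1 - \<alpha>)))"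
    using G by (intro tendsto_inverse) auto
  then have "Bseq (\<lambda>n. inverse (omega_coeff (\<alpha> - 1) n * real n powr \<alpha>))"
    by (intro convergent_imp_Bseq convergentI)
  then obtain B where B: "B > 0" "\<And>n. norm (inverse (omega_coeff (\<alpha> - 1) n * real n powr \<alpha>)) \<le> B"
    by (auto elim: BseqE)
  have "omega_coeff (\<alpha> - 1) n \<ge> inverse B * real n powr (- \<alpha>)" if n: "n \<ge> 1" for n
  proof -
    have p: "omega_coeff (\<alpha> - 1) n * real n powr \<alpha> > 0" using omega_coeff_pos[OF assms] n by simp
    then have "inverse (omega_coeff (\<alpha> - 1) n * real n powr \<alpha>) \<le> B" using B(2)[of n] by simp
    then have "inverse B \<le> inverse (inverse (omega_coeff (\<alpha> - 1) n * real n powr \<alpha>))"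
      using p by (intro le_imp_inverse_le) (simp_all only: positive_imp_inverse_positive)
    then have "inverse B \<le> omega_coeff (\<alpha> - 1) n * real n powr \<alpha>" by simp
    then have "inverse B * real n powr (- \<alpha>) \<le> omega_coeff (\<alpha> - 1) n * real n powr \<alpha> * real n powr (- \<alpha>)"
      by (intro mult_right_mono) auto
    also have "\<dots> = omega_coeff (\<alpha> - 1) n" using n by (simp add: powr_minus)
    finally show ?thesis .
  qed
  then show ?thesis using B(1) by (intro exI[of _ "inverse B"]) auto
qed

text \<open>The G-stability of BDF2: with \<open>x, y, z\<close> the last three values,
\<open>x * (3/2 * x - 2 * y + 1/2 * z)\<close> is the increment of \<open>(x\<^sup>2 + (2 * x - y)\<^sup>2) / 4\<close> plus the square
\<open>(x - 2 * y + z)\<^sup>2 / 4\<close>.\<close>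
lemma g_form_BDF2_lower: "g_form 1 e K \<ge> 1 / 4 * (e K)\<^sup>2" if "K \<ge> 1"
proof -
  have g0: "g_coeff 1 0 = 3/2" "g_coeff 1 (Suc 0) = -2" "g_coeff 1 (Suc (Suc 0)) = 1/2" "g_coeff 1 2 = 1/2"
    by (simp_all add: g_coeff_def omega_coeff_Suc numeral_2_eq_2)
  have o: "omega_coeff 1 (Suc (Suc k)) = 0" for k
    by (induction k) (simp_all add: omega_coeff_Suc)
  have g3: "g_coeff 1 (Suc (Suc (Suc k))) = 0" for k
    by (simp add: g_coeff_def o)
  define f where "f = (\<lambda>n. if n = 0 then 0 else e n)"
  have inner: "(\<Sum>k=1..Suc n. g_coeff 1 (Suc n - k) * e k) = 3/2 * f (Suc n) - 2 * f n + 1/2 * (if n = 0 then 0 else f (n - 1))" for n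
  proof (cases n)
    case 0 then show ?thesis by (simp add: f_def g0)
  next
    case (Suc i)
    show ?thesis
    proof (cases i)
      case 0 then show ?thesis by (simp add: Suc f_def g0)
    next
      case i: (Suc m)
      have "(\<Sum>k=1..m. g_coeff 1 (Suc (Suc (Suc m)) - k) * e k) = 0"
        by (rule sum.neutral) (auto simp: g3 Suc_diff_le)
      then show ?thesis by (simp add: Suc i f_def g0)
    qed
  qed
  have "g_form 1 e n \<ge> 1 / 4 * ((f n)\<^sup>2 + (2 * f n - (if n = 0 then 0 else f (n - 1)))\<^sup>2)" for n
  proof (induction n)
    case 0 show ?case by (simp add: g_form_def f_def)
  next
    case (Suc n)
    define x y z where "x = f (Suc n)" and "y = f n" and "z = (if n = 0 then 0 else f (n - 1))"
    have "g_form 1 e (Suc n) = g_form 1 e n + e (Suc n) * (\<Sum>k=1..Suc n. g_coeff 1 (Suc n - k) * e k)"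
      by (simp add: g_form_def)
    also have "\<dots> = g_form 1 e n + x * (3/2 * x - 2 * y + 1/2 * z)"
      unfolding inner x_def y_def z_def by (simp add: f_def)
    also have "\<dots> \<ge> 1 / 4 * (y\<^sup>2 + (2 * y - z)\<^sup>2) + x * (3/2 * x - 2 * y + 1/2 * z)"
      using Suc by (simp add: y_def z_def)
    also have "1 / 4 * (y\<^sup>2 + (2 * y - z)\<^sup>2) + x * (3/2 * x - 2 * y + 1/2 * z) = 1 / 4 * (x\<^sup>2 + (2 * x - y)\<^sup>2) + 1 / 4 * (x - 2 * y + z)\<^sup>2"
      by (simp add: power2_eq_square algebra_simps)
    finally have "g_form 1 e (Suc n) \<ge> 1 / 4 * (x\<^sup>2 + (2 * x - y)\<^sup>2)"
      by (rule order.trans[rotated]) simp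
    then show ?case by (simp add: x_def y_def)
  qed
  from this[of K] show ?thesis using that by (simp add: f_def) (smt (verit) zero_le_power2)
qed

text \<open>For \<open>\<alpha> < 1\<close> the weight \<open>n powr (- \<alpha>)\<close> is available and is weakened to \<open>K powr (- \<alpha> / 2) * n powr (- \<alpha> / 2)\<close>. For
\<open>\<alpha> = 1\<close> only \<open>(e N)\<^sup>2 \<le> 4 * X\<close> is known for each \<open>N\<close>, which is why the premise ranges over all \<open>N \<le> K\<close>; summing these
bounds against \<open>n powr (- 1)\<close> would cost a logarithm of \<open>K\<close>, against \<open>n powr (- 1 / 2)\<close> it does not.\<close>
lemma g_form_coercive:
  assumes a: "0 < \<alpha>" "\<alpha> \<le> 1"
  shows "\<exists>c>0. \<forall>K e X. (\<forall>N\<le>K. g_form \<alpha> e N \<le> X) \<longrightarrow>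
           c * real K powr (- \<alpha> / 2) * (\<Sum>n=1..K. real n powr (- \<alpha> / 2) * (e n)\<^sup>2) \<le> X"
proof (cases "\<alpha> < 1")
  case True
  obtain c where c: "c > 0" "\<And>n. n \<ge> 1 \<Longrightarrow> omega_coeff (\<alpha> - 1) n \<ge> c * real n powr (- \<alpha>)"
    using omega_coeff_lower[OF True] by auto
  have "c / 8 * real K powr (- \<alpha> / 2) * (\<Sum>n=1..K. real n powr (- \<alpha> / 2) * (e n)\<^sup>2) \<le> X"
    if X: "\<forall>N\<le>K. g_form \<alpha> e N \<le> X" for K e X
  proof -
    have "c / 8 * real K powr (- \<alpha> / 2) * (\<Sum>n=1..K. real n powr (- \<alpha> / 2) * (e n)\<^sup>2)
        = 1 / 2 * (\<Sum>n=1..K. (1 / 4 * (c * (real K powr (- \<alpha> / 2) * real n powr (- \<alpha> / 2)))) * (e n)\<^sup>2)"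
      by (simp add: sum_distrib_left mult_ac)
    also have "\<dots> \<le> 1 / 2 * (\<Sum>n=1..K. g_partial \<alpha> (Suc n) * (e n)\<^sup>2)"
    proof (intro mult_left_mono sum_mono mult_right_mono)
      fix n assume n: "n \<in> {1..K}"
      have "real K powr (- \<alpha> / 2) * real n powr (- \<alpha> / 2) \<le> real n powr (- \<alpha> / 2) * real n powr (- \<alpha> / 2)"
        using n a by (intro mult_right_mono powr_mono2') auto
      also have "\<dots> = real n powr (- \<alpha>)" by (simp flip: powr_add)
      finally have "c * (real K powr (- \<alpha> / 2) * real n powr (- \<alpha> / 2)) \<le> c * real n powr (- \<alpha>)"
        using c by (intro mult_left_mono) auto
      also have "\<dots> \<le> omega_coeff (\<alpha> - 1) n" using c(2) n by auto
      finally show "1 / 4 * (c * (real K powr (- \<alpha> / 2) * real n powr (- \<alpha> / 2))) \<le> g_partial \<alpha> (Suc n)"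
        using g_partial_lower[of \<alpha> n] a n by auto
    qed auto
    also have "\<dots> \<le> g_form \<alpha> e K" using a by (intro g_form_lower_bound) auto
    also have "\<dots> \<le> X" using X by simp
    finally show ?thesis .
  qed
  then show ?thesis using c(1) by (intro exI[of _ "c / 8"]) auto
next
  case False
  then have \<alpha>: "\<alpha> = 1" using a by simp
  obtain C where C: "C > 0" "\<And>K. (\<Sum>n=1..K. real n powr (- 1 / 2)) \<le> C * real K powr (1 / 2)"
    using sum_powr_bound[of "1/2" "- 1 / 2"] by auto
  have "1 / (4 * C) * real K powr (- \<alpha> / 2) * (\<Sum>n=1..K. real n powr (- \<alpha> / 2) * (e n)\<^sup>2) \<le> X"
    if X: "\<forall>N\<le>K. g_form \<alpha> e N \<le> X" for K e X
  proof -
    have X0: "X \<ge> 0" using X[rule_format, of 0] by (simp add: g_form_def)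
    have e: "(e n)\<^sup>2 \<le> 4 * X" if "n \<in> {1..K}" for n
      using g_form_BDF2_lower[of n e] X[rule_format, of n] that \<alpha> by auto
    have "(\<Sum>n=1..K. real n powr (- \<alpha> / 2) * (e n)\<^sup>2) \<le> (\<Sum>n=1..K. real n powr (- 1 / 2) * (4 * X))"
      unfolding \<alpha> by (intro sum_mono mult_left_mono e) auto
    also have "\<dots> = (\<Sum>n=1..K. real n powr (- 1 / 2)) * (4 * X)" by (simp add: sum_distrib_right)
    also have "\<dots> \<le> C * real K powr (1 / 2) * (4 * X)" using X0 by (intro mult_right_mono C) auto
    finally have "1 / (4 * C) * real K powr (- \<alpha> / 2) * (\<Sum>n=1..K. real n powr (- \<alpha> / 2) * (e n)\<^sup>2)
        \<le> 1 / (4 * C) * real K powr (- \<alpha> / 2) * (C * real K powr (1 / 2) * (4 * X))"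
      using C by (intro mult_left_mono) auto
    also have "\<dots> = (real K powr (- 1 / 2) * real K powr (1 / 2)) * X" using C by (simp add: \<alpha>)
    also have "\<dots> \<le> 1 * X" by (rule mult_right_mono) (auto simp: X0 simp flip: powr_add)
    finally show ?thesis by simp
  qed
  then show ?thesis using C(1) by (intro exI[of _ "1 / (4 * C)"]) auto
qed

section \<open>Generalized Vandermonde systems and the size of the starting weights\<close>

text \<open>Gaussian elimination with the pivot row \<open>i0\<close>. Stating it for arbitrary finite index sets makes the
induction immediate and avoids matrices of varying dimension.\<close>
lemma injective_square_system_solvable:
  fixes A :: "'i \<Rightarrow> 'j \<Rightarrow> 'a :: field"
  assumes "finite J" "finite I" "card I = card J"
    and "\<And>x. (\<And>i. i \<in> I \<Longrightarrow> (\<Sum>j\<in>J. A i j * x j) = 0) \<Longrightarrow> \<forall>j\<in>J. x j = 0"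
  shows "\<exists>x. \<forall>i\<in>I. (\<Sum>j\<in>J. A i j * x j) = b i"
  using assms
proof (induction J arbitrary: I A b rule: finite_induct)
  case empty
  then show ?case by simp
next
  case (insert j0 J)
  note inj = insert.prems(3)
  have "\<exists>i0\<in>I. A i0 j0 \<noteq> 0"
  proof (rule ccontr)
    assume "\<not> ?thesis"
    then have "(\<Sum>j\<in>insert j0 J. A i j * (if j = j0 then 1 else 0)) = 0" if "i \<in> I" for i
      using that by (intro sum.neutral) auto
    then have "\<forall>j\<in>insert j0 J. (if j = j0 then 1 else 0) = (0::'a)" by (rule inj)
    then show False by auto
  qed
  then obtain i0 where i0: "i0 \<in> I" "A i0 j0 \<noteq> 0" by blast
  define A' where "A' = (\<lambda>i j. A i j - A i j0 / A i0 j0 * A i0 j)"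
  have elim: "(\<Sum>j\<in>insert j0 J. A i j * (x(j0 := c)) j) = (\<Sum>j\<in>J. A i j * x j) + A i j0 * c" for i x c
  proof -
    have "(\<Sum>j\<in>J. A i j * (x(j0 := c)) j) = (\<Sum>j\<in>J. A i j * x j)"
      using insert.hyps by (intro sum.cong) auto
    then show ?thesis using insert.hyps by simp
  qed
  have A': "(\<Sum>j\<in>J. A' i j * x j) = (\<Sum>j\<in>J. A i j * x j) - A i j0 / A i0 j0 * (\<Sum>j\<in>J. A i0 j * x j)" for i x
    by (simp add: A'_def left_diff_distrib sum_subtractf sum_distrib_left mult.assoc)
  have "\<exists>x. \<forall>i\<in>I - {i0}. (\<Sum>j\<in>J. A' i j * x j) = b i - A i j0 / A i0 j0 * b i0"
  proof (rule insert.IH)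
    show "card (I - {i0}) = card J" using insert.prems insert.hyps i0 by simp
    fix x assume x: "\<And>i. i \<in> I - {i0} \<Longrightarrow> (\<Sum>j\<in>J. A' i j * x j) = 0"
    define c where "c = - (\<Sum>j\<in>J. A i0 j * x j) / A i0 j0"
    have "\<forall>j\<in>insert j0 J. (x(j0 := c)) j = 0"
    proof (rule inj)
      fix i assume i: "i \<in> I"
      show "(\<Sum>j\<in>insert j0 J. A i j * (x(j0 := c)) j) = 0"
      proof (cases "i = i0")
        case True
        then show ?thesis unfolding elim c_def using i0 by simp
      next
        case False
        then show ?thesis unfolding elim c_def using x[of i] i A'[of i x] by simp
      qed
    qed
    then show "\<forall>j\<in>J. x j = 0" using insert.hyps by (metis fun_upd_other insertI2)
  qed (use insert.prems in auto)
  then obtain x where x: "\<And>i. i \<in> I - {i0} \<Longrightarrow> (\<Sum>j\<in>J. A' i j * x j) = b i - A i j0 / A i0 j0 * b i0"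
    by blast
  define c where "c = (b i0 - (\<Sum>j\<in>J. A i0 j * x j)) / A i0 j0"
  show ?case
  proof (intro exI ballI)
    fix i assume i: "i \<in> I"
    show "(\<Sum>j\<in>insert j0 J. A i j * (x(j0 := c)) j) = b i"
    proof (cases "i = i0")
      case True
      then show ?thesis unfolding elim c_def using i0 by simp
    next
      case False
      then have "(\<Sum>j\<in>J. A i j * x j) - A i j0 / A i0 j0 * (\<Sum>j\<in>J. A i0 j * x j) = b i - A i j0 / A i0 j0 * b i0"
        using x[of i] i A'[of i x] by simp
      then show ?thesis unfolding elim c_def using i0 by (simp add: field_simps)
    qed
  qed
qed

text \<open>A combination of \<open>card I\<close> powers has fewer than \<open>card I\<close> positive zeros: divide by one of the powers and
differentiate; by Rolle one power and one zero disappear.\<close>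
lemma generalized_polynomial_zeros:
  fixes \<sigma> x :: "'s \<Rightarrow> real" and z :: "nat \<Rightarrow> real"
  assumes "finite I" "inj_on \<sigma> I"
    and "\<And>i. i < card I \<Longrightarrow> z i > 0"
    and "\<And>i. i < card I \<Longrightarrow> (\<Sum>s\<in>I. x s * z i powr \<sigma> s) = 0"
    and "\<And>i. Suc i < card I \<Longrightarrow> z i < z (Suc i)"
  shows "\<forall>s\<in>I. x s = 0"
  using assms
proof (induction I arbitrary: \<sigma> x z rule: finite_induct)
  case (insert s0 I)
  have card: "card (insert s0 I) = Suc (card I)" using insert.hyps by simp
  define f where "f = (\<lambda>t. \<Sum>s\<in>insert s0 I. x s * t powr (\<sigma> s - \<sigma> s0))"
  define f' where "f' = (\<lambda>t. \<Sum>s\<in>I. x s * (\<sigma> s - \<sigma> s0) * t powr (\<sigma> s - \<sigma> s0 - 1))"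
  have der: "(f has_real_derivative f' t) (at t)" if "t > 0" for t
  proof -
    have "(f has_real_derivative (\<Sum>s\<in>insert s0 I. x s * ((\<sigma> s - \<sigma> s0) * t powr (\<sigma> s - \<sigma> s0 - 1)))) (at t)"
      unfolding f_def using that by (intro DERIV_sum DERIV_cmult has_real_derivative_powr)
    then show ?thesis using insert.hyps by (simp add: f'_def mult.assoc)
  qed
  have fz: "f (z i) = 0" if i: "i < Suc (card I)" for i
  proof -
    have "f (z i) = (\<Sum>s\<in>insert s0 I. x s * z i powr \<sigma> s) * z i powr (- \<sigma> s0)"
      unfolding f_def sum_distrib_right by (simp only: mult.assoc powr_add[symmetric] add_uminus_conv_diff)
    also have "(\<Sum>s\<in>insert s0 I. x s * z i powr \<sigma> s) = 0"
      using i by (intro insert.prems(3)) (simp only: card)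
    finally show ?thesis by simp
  qed
  have "\<exists>\<xi>. z i < \<xi> \<and> \<xi> < z (Suc i) \<and> f' \<xi> = 0" if i: "i < card I" for i
  proof -
    have lt: "z i < z (Suc i)" using i by (intro insert.prems(4)) (simp only: card)
    have pos: "z i > 0" using i by (intro insert.prems(2)) (simp only: card)
    have "\<exists>\<xi>>z i. \<xi> < z (Suc i) \<and> f (z (Suc i)) - f (z i) = (z (Suc i) - z i) * f' \<xi>"
      using lt pos by (intro MVT2 der) auto
    then show ?thesis using fz i lt by auto
  qed
  then obtain \<xi> where \<xi>: "\<And>i. i < card I \<Longrightarrow> z i < \<xi> i \<and> \<xi> i < z (Suc i) \<and> f' (\<xi> i) = 0" by metis
  have "\<forall>s\<in>I. x s * (\<sigma> s - \<sigma> s0) = 0"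
  proof (rule insert.IH)
    show "inj_on (\<lambda>s. \<sigma> s - \<sigma> s0 - 1) I" using insert.prems(1) by (auto simp: inj_on_def)
    fix i assume i: "i < card I"
    have "z i > 0" using i by (intro insert.prems(2)) (simp only: card)
    then show "\<xi> i > 0" using \<xi>[OF i] by simp
    show "(\<Sum>s\<in>I. x s * (\<sigma> s - \<sigma> s0) * \<xi> i powr (\<sigma> s - \<sigma> s0 - 1)) = 0" using \<xi>[OF i] by (simp add: f'_def)
  next
    fix i assume "Suc i < card I"
    then show "\<xi> i < \<xi> (Suc i)" using \<xi>[of i] \<xi>[of "Suc i"] by simp
  qed
  then have xI: "\<forall>s\<in>I. x s = 0" using insert.prems(1) insert.hyps(2) by (auto simp: inj_on_def)
  have "(\<Sum>s\<in>insert s0 I. x s * z 0 powr \<sigma> s) = 0" by (rule insert.prems(3)) (simp only: card)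
  moreover have "(\<Sum>s\<in>I. x s * z 0 powr \<sigma> s) = 0" using xI by (intro sum.neutral) auto
  moreover have "z 0 > 0" by (rule insert.prems(2)) (simp only: card)
  ultimately have "x s0 = 0" using insert.hyps by simp
  with xI show ?case by simp
qed simp

lemma generalized_Vandermonde_interpolation:
  fixes \<sigma> :: "nat \<Rightarrow> real"
  assumes "inj_on \<sigma> {1..m}"
  shows "\<exists>x. \<forall>k\<in>{1..m}. (\<Sum>r=1..m. real k powr \<sigma> r * x r) = b k"
proof (rule injective_square_system_solvable)
  fix x assume x: "\<And>k. k \<in> {1..m} \<Longrightarrow> (\<Sum>r=1..m. real k powr \<sigma> r * x r) = 0"
  show "\<forall>r\<in>{1..m}. x r = 0"
    by (rule generalized_polynomial_zeros[where z = "\<lambda>i. real (Suc i)", OF _ assms])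
       (use x in \<open>auto simp: mult.commute simp del: of_nat_Suc\<close>)
qed auto

text \<open>Interpolation gives a combination of the powers that is \<open>1\<close> at \<open>k\<close> and \<open>0\<close> at the other nodes. Combining the
defining equations with its coefficients represents each weight as a fixed combination of power defects, of
which the one with the largest exponent has the weakest bound.\<close>
lemma starting_weights_bound:
  assumes a: "0 < \<alpha>" "\<alpha> \<le> 1" and \<sigma>: "\<And>r. r \<ge> 1 \<Longrightarrow> 0 < \<sigma> r \<and> \<sigma> r < \<sigma> (r + 1)"
    and w: "starting_weights \<alpha> \<sigma> m w"
  shows "\<exists>C>0. \<forall>n\<ge>1. \<forall>k\<in>{1..m}. \<bar>w n k\<bar> \<le> C * defect_rate \<alpha> (\<sigma> m) n"
proof -
  have mono: "\<sigma> r < \<sigma> s" if "1 \<le> r" "r < s" for r s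
    using that(2,1) by (induction rule: strict_inc_induct[of r s]) (use \<sigma> in \<open>force intro: less_trans\<close>)+
  have inj: "inj_on \<sigma> {1..m}"
    by (rule inj_onI) (metis atLeastAtMost_iff less_irrefl mono nat_neq_iff)
  have "\<forall>k0. \<exists>x. \<forall>k\<in>{1..m}. (\<Sum>r=1..m. real k powr \<sigma> r * x r) = (if k = k0 then 1 else 0)"
    by (intro allI generalized_Vandermonde_interpolation[OF inj])
  then obtain x where x: "\<And>k0 k. k \<in> {1..m} \<Longrightarrow> (\<Sum>r=1..m. real k powr \<sigma> r * x k0 r) = (if k = k0 then 1 else 0)"
    by metis
  have "\<forall>r\<in>{1..m}. \<exists>C>0. \<forall>n\<ge>1. \<bar>power_defect \<alpha> (\<sigma> r) n\<bar> \<le> C * defect_rate \<alpha> (\<sigma> r) n"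
    using power_defect_bound[OF a] \<sigma> by auto
  then obtain C where C: "\<And>r. r \<in> {1..m} \<Longrightarrow> C r > 0"
     "\<And>r n. r \<in> {1..m} \<Longrightarrow> n \<ge> 1 \<Longrightarrow> \<bar>power_defect \<alpha> (\<sigma> r) n\<bar> \<le> C r * defect_rate \<alpha> (\<sigma> r) n"
    by metis
  define D where "D = 1 + (\<Sum>k=1..m. \<Sum>r=1..m. \<bar>x k r\<bar> * C r)"
  have D0: "0 \<le> (\<Sum>r=1..m. \<bar>x k r\<bar> * C r)" for k
    using C(1) by (intro sum_nonneg mult_nonneg_nonneg) (auto intro: less_imp_le)
  have "\<bar>w n k\<bar> \<le> D * defect_rate \<alpha> (\<sigma> m) n" (is "_ \<le> D * ?X")
    if n: "n \<ge> 1" and k: "k \<in> {1..m}" for n k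
  proof -
    have "w n k = (\<Sum>i=1..m. w n i * (if i = k then 1 else 0))"
    proof -
      have "(\<Sum>i=1..m. w n i * (if i = k then 1 else 0)) = (\<Sum>i=1..m. if i = k then w n i else 0)"
        by (intro sum.cong) auto
      then show ?thesis using k by simp
    qed
    also have "\<dots> = (\<Sum>i=1..m. w n i * (\<Sum>r=1..m. real i powr \<sigma> r * x k r))"
      by (intro sum.cong refl) (simp only: x)
    also have "\<dots> = (\<Sum>r=1..m. x k r * (\<Sum>i=1..m. w n i * real i powr \<sigma> r))"
      by (simp add: sum_distrib_left mult_ac) (rule sum.swap)
    also have "\<dots> = (\<Sum>r=1..m. x k r * power_defect \<alpha> (\<sigma> r) n)"
      using w n by (intro sum.cong) (auto simp: starting_weights_def power_defect_def)
    finally have "\<bar>w n k\<bar> \<le> (\<Sum>r=1..m. \<bar>x k r\<bar> * \<bar>power_defect \<alpha> (\<sigma> r) n\<bar>)"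
      by (simp add: abs_mult order.trans[OF sum_abs])
    also have "\<dots> \<le> (\<Sum>r=1..m. \<bar>x k r\<bar> * (C r * ?X))"
    proof (intro sum_mono mult_left_mono)
      fix r assume r: "r \<in> {1..m}"
      have "\<sigma> r \<le> \<sigma> m" using mono[of r m] r by (cases "r = m") auto
      then have "real n powr (\<sigma> r - \<alpha> - 2) \<le> real n powr (\<sigma> m - \<alpha> - 2)" using n by (intro powr_mono) auto
      then show "\<bar>power_defect \<alpha> (\<sigma> r) n\<bar> \<le> C r * ?X"
        using C(1)[OF r] by (intro order.trans[OF C(2)[OF r n]] mult_left_mono) auto
    qed auto
    also have "\<dots> = (\<Sum>r=1..m. \<bar>x k r\<bar> * C r) * ?X" by (simp add: sum_distrib_right mult.assoc)
    also have "\<dots> \<le> D * ?X"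
    proof (rule mult_right_mono)
      have "(\<Sum>r=1..m. \<bar>x k r\<bar> * C r) \<le> (\<Sum>k=1..m. \<Sum>r=1..m. \<bar>x k r\<bar> * C r)"
        using k D0 by (intro member_le_sum) auto
      then show "(\<Sum>r=1..m. \<bar>x k r\<bar> * C r) \<le> D" by (simp add: D_def)
    qed auto
    finally show ?thesis .
  qed
  moreover have "D > 0" unfolding D_def by (intro add_pos_nonneg sum_nonneg D0) auto
  ultimately show ?thesis by blast
qed

section \<open>Fractional integrals\<close>

text \<open>Euler's Beta integral on \<open>{0..1}\<close>, transported by an affine substitution.\<close>
lemma Beta_integral_interval:
  fixes a b r t :: real
  assumes ab: "a > 0" "b > 0" and rt: "r < t"
  shows "((\<lambda>s. (t - s) powr (a - 1) * (s - r) powr (b - 1)) has_integral Beta a b * (t - r) powr (a + b - 1)) {r..t}"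
proof -
  define d where "d = t - r"
  have d: "d > 0" using rt by (simp add: d_def)
  have 1: "((\<lambda>x. x powr (b - 1) * (1 - x) powr (a - 1)) has_integral Beta b a) (cbox 0 1)"
    using has_integral_Beta_real[of b a] ab by simp
  have "((\<lambda>s. ((1 / d) *\<^sub>R s + (- r / d)) powr (b - 1) * (1 - ((1 / d) *\<^sub>R s + (- r / d))) powr (a - 1)) has_integral (Beta b a /\<^sub>R (1 / d) ^ DIM(real)))
     (cbox ((0 - (- r / d)) /\<^sub>R (1 / d)) ((1 - (- r / d)) /\<^sub>R (1 / d)))"
    using has_integral_affinity'[OF 1, of "1 / d" "- r / d"] d by simp
  moreover have "(0 - (- r / d)) /\<^sub>R (1 / d) = r" "(1 - (- r / d)) /\<^sub>R (1 / d) = t"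
    using d by (simp_all add: field_simps d_def)
  ultimately have "((\<lambda>s. ((1 / d) *\<^sub>R s + (- r / d)) powr (b - 1) * (1 - ((1 / d) *\<^sub>R s + (- r / d))) powr (a - 1)) has_integral (d * Beta a b)) {r..t}"
    using d by (simp add: Beta_commute[of b a])
  then have H: "((\<lambda>s. d powr (a + b - 2) * (((1 / d) *\<^sub>R s + (- r / d)) powr (b - 1) * (1 - ((1 / d) *\<^sub>R s + (- r / d))) powr (a - 1))) has_integral (d powr (a + b - 2) * (d * Beta a b))) {r..t}"
    by (rule has_integral_mult_right)
  moreover have E: "d powr (a + b - 2) * (((1 / d) *\<^sub>R s + (- r / d)) powr (b - 1) * (1 - ((1 / d) *\<^sub>R s + (- r / d))) powr (a - 1))
     = (t - s) powr (a - 1) * (s - r) powr (b - 1)" if "s \<in> {r..t}" for s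
  proof -
    have "(1 / d) *\<^sub>R s + (- r / d) = (s - r) / d" "1 - ((1 / d) *\<^sub>R s + (- r / d)) = (t - s) / d"
    proof -
      show 1: "(1 / d) *\<^sub>R s + (- r / d) = (s - r) / d" by (simp add: diff_divide_distrib)
      have "(t - s) / d = (d - (s - r)) / d" by (simp add: d_def)
      also have "\<dots> = 1 - (s - r) / d" using d by (simp only: diff_divide_distrib[of d]) simp
      finally show "1 - ((1 / d) *\<^sub>R s + (- r / d)) = (t - s) / d" unfolding 1 ..
    qed
    moreover have "d powr (a + b - 2) = d powr (a - 1) * d powr (b - 1)" by (simp flip: powr_add)
    ultimately show ?thesis using that d by (simp add: powr_divide)
  qed
  moreover have "d powr (a + b - 2) * (d * Beta a b) = Beta a b * (t - r) powr (a + b - 1)"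
  proof -
    have "d powr (a + b - 1) = d powr (a + b - 2) * d powr 1" by (simp only: powr_add[symmetric]) simp
    then show ?thesis using d by (simp add: d_def mult_ac)
  qed
  ultimately show ?thesis using has_integral_eq[OF E H] by (simp only:)
qed

text \<open>Interchange of the two integrations over the triangle \<open>r < s < t\<close>; the inner integral over \<open>s\<close> is the Beta
integral. Only the integrability of \<open>v\<close> against the final kernel is assumed, so the inner integral over \<open>r\<close>
may fail to exist for exceptional \<open>s\<close>; these form a null set by Fubini and do not affect the outer integral.\<close>
lemma fractional_kernel_Fubini:
  fixes a b t :: real and v :: "real \<Rightarrow> real"
  assumes ab: "a > 0" "b > 0" and t: "t > 0"
    and v: "(\<lambda>r. (t - r) powr (a + b - 1) * v r) absolutely_integrable_on {0..t}"
  defines "\<phi> \<equiv> \<lambda>s. (t - s) powr (a - 1) * integral {0..s} (\<lambda>r. (s - r) powr (b - 1) * v r)"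
  shows "\<phi> absolutely_integrable_on {0..t}"
    and "integral {0..t} \<phi> = Beta a b * integral {0..t} (\<lambda>r. (t - r) powr (a + b - 1) * v r)"
proof -
  \<comment> \<open>A Borel measurable version of the integrand, so that Fubini's theorem for Borel functions applies.\<close>
  define w where "w = (\<lambda>r. indicator {0..t} r * ((t - r) powr (a + b - 1) * v r))"
  have wint: "integrable lebesgue w" using v by (simp add: w_def set_integrable_def)
  obtain u where u: "u \<in> borel_measurable lborel" "AE r in lborel. w r = u r"
    using completion_ex_borel_measurable_real[OF borel_measurable_integrable[OF wint]] by auto
  have uint: "integrable lborel u"
  proof -
    have "AE r in lebesgue. w r = u r" using u(2) by (rule AE_completion)
    then have "integrable lebesgue u" using wint u(1)
      by (subst integrable_cong_AE[of _ _ w]) (auto intro: measurable_completion borel_measurable_integrable elim: AE_mp)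
    then show ?thesis using u(1) by (simp add: integrable_completion)
  qed
  \<comment> \<open>\<open>v'\<close> is a Borel measurable version of \<open>v\<close> itself; the exponent divides the kernel out again.\<close>
  define v' where "v' = (\<lambda>r. u r * (t - r) powr (1 - a - b))"
  have v'meas: "v' \<in> borel_measurable borel" using u(1) unfolding v'_def by simp
  have vv': "AE r in lborel. r \<in> {0..<t} \<longrightarrow> v r = v' r"
    using u(2)
  proof eventually_elim
    case (elim r)
    show ?case
    proof
      assume r: "r \<in> {0..<t}"
      have "(t - r) powr (a + b - 1) * (t - r) powr (1 - a - b) = 1" using r by (simp flip: powr_add)
      then show "v r = v' r" using r elim by (simp add: v'_def w_def flip: elim)
    qed
  qed
  define f where "f = (\<lambda>r s. indicator {0<..<t} r * indicator {r<..<t} s * (t - s) powr (a - 1) * (s - r) powr (b - 1) * v' r)"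
  have fmeas: "case_prod f \<in> borel_measurable (lborel \<Otimes>\<^sub>M lborel)"
  proof -
    have e: "case_prod f = (\<lambda>p. (if 0 < fst p \<and> fst p < t \<and> fst p < snd p \<and> snd p < t then 1 else 0) * (t - snd p) powr (a - 1) * (snd p - fst p) powr (b - 1) * v' (fst p))"
      by (auto simp: f_def fun_eq_iff indicator_def)
    show ?thesis unfolding e using v'meas by measurable
  qed
  have slice: "((\<lambda>s. \<bar>f r s\<bar>) has_integral Beta a b * (t - r) powr (a + b - 1) * \<bar>v' r\<bar>) UNIV"
       "((\<lambda>s. f r s) has_integral Beta a b * (t - r) powr (a + b - 1) * v' r) UNIV" if r: "r \<in> {0<..<t}" for r
  proof -
    have B: "((\<lambda>s. (t - s) powr (a - 1) * (s - r) powr (b - 1)) has_integral Beta a b * (t - r) powr (a + b - 1)) {r<..<t}"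
      using Beta_integral_interval[OF ab, of r t] r by (simp add: has_integral_Icc_iff_Ioo)
    have g: "((\<lambda>s. if s \<in> {r<..<t} then (t - s) powr (a - 1) * (s - r) powr (b - 1) * c else 0) has_integral Beta a b * (t - r) powr (a + b - 1) * c) UNIV" for c
      unfolding has_integral_restrict_UNIV by (rule has_integral_mult_left[OF B])
    show "((\<lambda>s. \<bar>f r s\<bar>) has_integral Beta a b * (t - r) powr (a + b - 1) * \<bar>v' r\<bar>) UNIV"
      by (rule has_integral_eq[OF _ g]) (use r in \<open>auto simp: f_def abs_mult indicator_def\<close>)
    show "((\<lambda>s. f r s) has_integral Beta a b * (t - r) powr (a + b - 1) * v' r) UNIV"
      by (rule has_integral_eq[OF _ g]) (use r in \<open>auto simp: f_def indicator_def\<close>)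
  qed
  have f0: "f r s = 0" if "r \<notin> {0<..<t}" for r s using that by (auto simp: f_def)
  have fr: "f r \<in> borel_measurable borel" for r
    unfolding f_def by measurable
  have sl_int: "integrable lborel (f r)" for r
  proof (cases "r \<in> {0<..<t}")
    case True
    have "f r absolutely_integrable_on UNIV" unfolding absolutely_integrable_on_def
      using slice[OF True] by (auto simp: integrable_on_def)
    then have "integrable lebesgue (f r)" by (simp add: set_integrable_def)
    then show ?thesis using fr by (simp add: integrable_completion)
  next
    case False
    then have "f r = (\<lambda>_. 0)" by (auto simp: f0)
    then show ?thesis by simp
  qed
  have sl_abs: "(\<integral>s. norm (f r s) \<partial>lborel) = indicator {0<..<t} r * (Beta a b * (t - r) powr (a + b - 1) * \<bar>v' r\<bar>)" for r
  proof (cases "r \<in> {0<..<t}")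
    case True
    have "((\<lambda>s. \<bar>f r s\<bar>) has_integral (\<integral>s. \<bar>f r s\<bar> \<partial>lborel)) UNIV"
      by (rule has_integral_integral_lborel) (use sl_int in simp)
    with slice(1)[OF True] True show ?thesis by (auto dest: has_integral_unique)
  next
    case False then show ?thesis by (simp add: f0)
  qed
  have sl_val: "(\<integral>s. f r s \<partial>lborel) = indicator {0<..<t} r * (Beta a b * (t - r) powr (a + b - 1) * v' r)" for r
  proof (cases "r \<in> {0<..<t}")
    case True
    have "((\<lambda>s. f r s) has_integral (\<integral>s. f r s \<partial>lborel)) UNIV"
      by (rule has_integral_integral_lborel) (use sl_int in simp)
    with slice(2)[OF True] True show ?thesis by (auto dest: has_integral_unique)
  next
    case False then show ?thesis by (simp add: f0)
  qed
  have v'u: "indicator {0<..<t} r * ((t - r) powr (a + b - 1) * v' r) = indicator {0<..<t} r * u r" for r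
  proof (cases "r \<in> {0<..<t}")
    case True
    have one: "(t - r) powr (a + b - 1) * (t - r) powr (1 - a - b) = 1" using True by (simp flip: powr_add)
    have "(t - r) powr (a + b - 1) * v' r = u r * ((t - r) powr (a + b - 1) * (t - r) powr (1 - a - b))"
      unfolding v'_def by (simp only: mult_ac)
    then show ?thesis unfolding one by simp
  qed auto
  have fint: "integrable (lborel \<Otimes>\<^sub>M lborel) (case_prod f)"
  proof (rule lborel_pair.Fubini_integrable[OF fmeas])
    have "integrable lborel (\<lambda>r. Beta a b * (indicator {0<..<t} r * \<bar>u r\<bar>))"
      using integrable_mult_indicator[OF _ integrable_abs[OF uint], of "{0<..<t}"] by simp
    moreover have "(\<lambda>r. Beta a b * (indicator {0<..<t} r * \<bar>u r\<bar>)) = (\<lambda>r. \<integral>s. norm (case_prod f (r, s)) \<partial>lborel)"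
    proof
      fix r
      have "indicator {0<..<t} r * \<bar>u r\<bar> = \<bar>indicator {0<..<t} r * u r\<bar>" by (simp add: abs_mult)
      also have "\<dots> = indicator {0<..<t} r * ((t - r) powr (a + b - 1) * \<bar>v' r\<bar>)"
        unfolding v'u[symmetric] by (simp add: abs_mult)
      finally show "Beta a b * (indicator {0<..<t} r * \<bar>u r\<bar>) = (\<integral>s. norm (case_prod f (r, s)) \<partial>lborel)"
        unfolding case_prod_conv sl_abs by simp
    qed
    ultimately show "integrable lborel (\<lambda>r. \<integral>s. norm (case_prod f (r, s)) \<partial>lborel)" by simp
    show "AE r in lborel. integrable lborel (\<lambda>s. case_prod f (r, s))" using sl_int by simp
  qed
  define \<Psi> where "\<Psi> = (\<lambda>s. \<integral>r. f r s \<partial>lborel)"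
  have \<Psi>int: "integrable lborel \<Psi>" unfolding \<Psi>_def by (rule lborel_pair.integrable_snd[OF fint])
  have \<Psi>val: "integral\<^sup>L lborel \<Psi> = Beta a b * (\<integral>r. indicator {0<..<t} r * u r \<partial>lborel)"
  proof -
    have "integral\<^sup>L lborel \<Psi> = (\<integral>r. (\<integral>s. f r s \<partial>lborel) \<partial>lborel)"
      unfolding \<Psi>_def by (rule lborel_pair.Fubini_integral[OF fint])
    also have "\<dots> = (\<integral>r. Beta a b * (indicator {0<..<t} r * u r) \<partial>lborel)"
    proof (rule Bochner_Integration.integral_cong[OF refl])
      fix r
      show "(\<integral>s. f r s \<partial>lborel) = Beta a b * (indicator {0<..<t} r * u r)"
        unfolding sl_val v'u[symmetric] by (simp only: mult_ac)
    qed
    also have "\<dots> = Beta a b * (\<integral>r. indicator {0<..<t} r * u r \<partial>lborel)"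
      by (rule integral_mult_right_zero)
    finally show ?thesis .
  qed
  have uval: "(\<integral>r. indicator {0<..<t} r * u r \<partial>lborel) = integral {0..t} (\<lambda>r. (t - r) powr (a + b - 1) * v r)"
  proof -
    have "((\<lambda>r. indicator {0<..<t} r * u r) has_integral (\<integral>r. indicator {0<..<t} r * u r \<partial>lborel)) UNIV"
      using integrable_mult_indicator[OF _ uint, of "{0<..<t}"] by (intro has_integral_integral_lborel) simp
    moreover have "AE r in lborel. r \<in> UNIV \<longrightarrow> indicator {0<..<t} r * u r = (if r \<in> {0<..<t} then (t - r) powr (a + b - 1) * v r else 0)"
      using u(2)
    proof eventually_elim
      case (elim r)
      show ?case
      proof (cases "r \<in> {0<..<t}")
        case True
        then have "w r = (t - r) powr (a + b - 1) * v r" by (simp add: w_def)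
        with elim True show ?thesis by (simp only: if_P indicator_simps mult_1 simp_thms)
      next
        case False
        then show ?thesis by (simp only: if_not_P indicator_simps mult_zero_left simp_thms)
      qed
    qed
    ultimately have "((\<lambda>r. if r \<in> {0<..<t} then (t - r) powr (a + b - 1) * v r else 0) has_integral (\<integral>r. indicator {0<..<t} r * u r \<partial>lborel)) UNIV"
      by (rule has_integral_AE[THEN iffD1, rotated])
    then have "((\<lambda>r. (t - r) powr (a + b - 1) * v r) has_integral (\<integral>r. indicator {0<..<t} r * u r \<partial>lborel)) {0..t}"
      unfolding has_integral_restrict_UNIV by (simp add: has_integral_Icc_iff_Ioo)
    then show ?thesis by (rule integral_unique[symmetric])
  qed
  have "AE s in lborel. integrable lborel (\<lambda>r. f r s)" by (rule lborel_pair.AE_integrable_snd[OF fint])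
  then have ae: "AE s in lborel. s \<in> {0<..<t} \<longrightarrow> \<Psi> s = \<phi> s"
  proof eventually_elim
    case (elim s)
    show ?case
    proof
      assume s: "s \<in> {0<..<t}"
      have "((\<lambda>r. f r s) has_integral \<Psi> s) UNIV" unfolding \<Psi>_def by (rule has_integral_integral_lborel[OF elim])
      then have "((\<lambda>r. (t - s) powr (1 - a) * f r s) has_integral (t - s) powr (1 - a) * \<Psi> s) UNIV"
        by (rule has_integral_mult_right)
      moreover have "AE r in lborel. r \<in> UNIV \<longrightarrow> (t - s) powr (1 - a) * f r s = (if r \<in> {0<..<s} then (s - r) powr (b - 1) * v r else 0)"
        using vv'
      proof eventually_elim
        case (elim r)
        have one: "(t - s) powr (1 - a) * (t - s) powr (a - 1) = 1" using s by (simp flip: powr_add)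
        show ?case
        proof (cases "r \<in> {0<..<s}")
          case True
          have v: "v r = v' r" using elim s True by auto
          have i: "indicator {0<..<t} r = (1::real)" "indicator {r<..<t} s = (1::real)" using s True by auto
          have "(t - s) powr (1 - a) * f r s = ((t - s) powr (1 - a) * (t - s) powr (a - 1)) * ((s - r) powr (b - 1) * v r)"
            unfolding f_def i v by (simp only: mult_1 mult.assoc)
          then show ?thesis unfolding one using True by (simp only: if_P mult_1 simp_thms)
        next
          case False
          then have "f r s = 0" by (auto simp: f_def indicator_def)
          then show ?thesis using False by (simp only: if_False mult_zero_right simp_thms)
        qed
      qed
      ultimately have "((\<lambda>r. if r \<in> {0<..<s} then (s - r) powr (b - 1) * v r else 0) has_integral (t - s) powr (1 - a) * \<Psi> s) UNIV"
        by (rule has_integral_AE[THEN iffD1, rotated])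
      then have "((\<lambda>r. (s - r) powr (b - 1) * v r) has_integral (t - s) powr (1 - a) * \<Psi> s) {0..s}"
        unfolding has_integral_restrict_UNIV by (simp add: has_integral_Icc_iff_Ioo)
      then have "integral {0..s} (\<lambda>r. (s - r) powr (b - 1) * v r) = (t - s) powr (1 - a) * \<Psi> s" by (rule integral_unique)
      moreover have "(t - s) powr (a - 1) * (t - s) powr (1 - a) = 1" using s by (simp flip: powr_add)
      ultimately show "\<Psi> s = \<phi> s" by (simp add: \<phi>_def flip: mult.assoc)
    qed
  qed
  obtain N where N: "N \<in> null_sets lborel" "{s. \<not> (s \<in> {0<..<t} \<longrightarrow> \<Psi> s = \<phi> s)} \<subseteq> N"
  proof -
    obtain N where "{s \<in> space lborel. \<not> (s \<in> {0<..<t} \<longrightarrow> \<Psi> s = \<phi> s)} \<subseteq> N" "emeasure lborel N = 0" "N \<in> sets lborel"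
      using ae by (rule AE_E)
    then show ?thesis by (intro that[of N]) (auto simp: null_sets_def)
  qed
  have negl: "negligible (N \<union> {0, t})"
  proof (rule negligible_Un)
    show "negligible N" unfolding negligible_iff_null_sets by (rule null_sets_completionI[OF N(1)])
  qed simp
  have \<Psi>0: "\<Psi> s = 0" if "s \<notin> {0..t}" for s
  proof -
    have "(\<lambda>r. f r s) = (\<lambda>r. 0)" using that by (auto simp: f_def indicator_def fun_eq_iff)
    then show ?thesis unfolding \<Psi>_def by (simp only: Bochner_Integration.integral_zero)
  qed
  have \<Psi>abs: "\<Psi> absolutely_integrable_on {0..t}"
  proof -
    have i: "integrable lborel (\<lambda>s. indicator {0..t} s *\<^sub>R \<Psi> s)"
    proof (rule integrable_mult_indicator[OF _ \<Psi>int])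
      show "{0..t} \<in> sets lborel" by simp
    qed
    show ?thesis unfolding set_integrable_def
      using integrable_completion[OF borel_measurable_integrable[OF i]] i by (rule iffD2)
  qed
  have eq: "\<phi> s = \<Psi> s" if "s \<in> {0..t} - (N \<union> {0, t})" for s
  proof -
    have "s \<in> {0<..<t}" "s \<notin> N" using that by auto
    show ?thesis
    proof (rule ccontr)
      assume "\<phi> s \<noteq> \<Psi> s"
      then have "\<not> (s \<in> {0<..<t} \<longrightarrow> \<Psi> s = \<phi> s)" using \<open>s \<in> {0<..<t}\<close> by metis
      then have "s \<in> N" by (intro subsetD[OF N(2)] CollectI)
      with \<open>s \<notin> N\<close> show False by contradiction
    qed
  qed
  show "\<phi> absolutely_integrable_on {0..t}" by (rule absolutely_integrable_spike[OF \<Psi>abs negl eq])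
  have "integral {0..t} \<phi> = integral {0..t} \<Psi>" by (rule integral_spike[OF negl]) (use eq in auto)
  also have "\<dots> = integral UNIV (\<lambda>s. if s \<in> {0..t} then \<Psi> s else 0)" by (rule integral_restrict_UNIV[symmetric])
  also have "(\<lambda>s. if s \<in> {0..t} then \<Psi> s else 0) = \<Psi>"
  proof
    fix s show "(if s \<in> {0..t} then \<Psi> s else 0) = \<Psi> s" by (cases "s \<in> {0..t}") (simp_all only: if_True if_False \<Psi>0 simp_thms)
  qed
  also have "integral UNIV \<Psi> = integral\<^sup>L lborel \<Psi>" by (rule integral_unique[OF has_integral_integral_lborel[OF \<Psi>int]])
  finally show "integral {0..t} \<phi> = Beta a b * integral {0..t} (\<lambda>r. (t - r) powr (a + b - 1) * v r)"
    unfolding \<Psi>val uval .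
qed

text \<open>The Riemann-Liouville fractional integral with base point \<open>0\<close>. At order \<open>0\<close>, where the integral formula
degenerates, the identity keeps the semigroup law true.\<close>
definition frac_int :: "real \<Rightarrow> (real \<Rightarrow> real) \<Rightarrow> real \<Rightarrow> real" where
  "frac_int \<beta> f t = (if \<beta> = 0 then f t else integral {0..t} (\<lambda>s. (t - s) powr (\<beta> - 1) * f s) / Gamma \<beta>)"

definition frac_integrable :: "real \<Rightarrow> (real \<Rightarrow> real) \<Rightarrow> real \<Rightarrow> bool" where
  "frac_integrable \<beta> f t \<longleftrightarrow> \<beta> = 0 \<or> (\<lambda>s. (t - s) powr (\<beta> - 1) * f s) absolutely_integrable_on {0..t}"

lemma frac_int_0 [simp]: "frac_int 0 f t = f t"
  by (simp add: frac_int_def)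

lemma Gamma_plus1_pos: "(z::real) > 0 \<Longrightarrow> Gamma (z + 1) = z * Gamma z"
  by (rule Gamma_plus1) (auto elim!: nonpos_Ints_cases)

lemma absolutely_integrable_imp_measurable_Icc:
  fixes f :: "real \<Rightarrow> real"
  shows "f absolutely_integrable_on {a..b} \<Longrightarrow> f \<in> borel_measurable (lebesgue_on {a..b})"
  using absolutely_integrable_measurable[of "{a..b}" f] by simp

lemma kernel_absolutely_integrable:
  assumes "c > 0" "t > (0::real)"
  shows "(\<lambda>r. (t - r) powr (c - 1)) absolutely_integrable_on {0..t}"
    and "integral {0..t} (\<lambda>r. (t - r) powr (c - 1)) = t powr c / c"
proof -
  have B: "((\<lambda>s. (t - s) powr (c - 1) * (s - 0) powr (1 - 1)) has_integral Beta c 1 * (t - 0) powr (c + 1 - 1)) {0..t}"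
    by (rule Beta_integral_interval) (use assms in auto)
  have "Beta c 1 = 1 / c"
    using assms less_imp_neq[OF Gamma_real_pos[of c]] by (simp add: Beta_def Gamma_plus1_pos)
  with B have "((\<lambda>s. (t - s) powr (c - 1) * (s - 0) powr (1 - 1)) has_integral t powr c / c) {0..t}" by simp
  then have B': "((\<lambda>s. (t - s) powr (c - 1)) has_integral t powr c / c) {0..t}"
    by (rule has_integral_spike[where S = "{0}", rotated 2]) auto
  then show "(\<lambda>r. (t - r) powr (c - 1)) absolutely_integrable_on {0..t}"
    by (intro nonnegative_absolutely_integrable_1) auto
  show "integral {0..t} (\<lambda>r. (t - r) powr (c - 1)) = t powr c / c"
    using B' by (rule integral_unique)
qed

lemma frac_integrable_bounded:
  assumes c: "c \<ge> 0" and t: "t > 0" and f: "f absolutely_integrable_on {0..t}" and B: "\<And>s. s \<in> {0..t} \<Longrightarrow> \<bar>f s\<bar> \<le> B"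
  shows "frac_integrable c f t"
proof (cases "c = 0")
  case False
  have m: "f \<in> borel_measurable (lebesgue_on {0..t})"
    by (rule absolutely_integrable_imp_measurable_Icc[OF f])
  have "(\<lambda>s. f s * (t - s) powr (c - 1)) absolutely_integrable_on {0..t}"
  proof (rule absolutely_integrable_bounded_measurable_product_real)
    show "bounded (f ` {0..t})" using B by (auto simp: bounded_iff intro!: exI[of _ B])
  qed (use m kernel_absolutely_integrable(1)[of c t] c t False in auto)
  then show ?thesis by (simp add: frac_integrable_def mult.commute)
qed (simp add: frac_integrable_def)

lemma frac_integrable_continuous:
  assumes "c \<ge> 0" "t > 0" "continuous_on {0..t} f"
  shows "frac_integrable c f t"
proof -
  have "bounded (f ` {0..t})" using assms(3) by (intro compact_imp_bounded compact_continuous_image) auto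
  then obtain B where "\<forall>s\<in>{0..t}. \<bar>f s\<bar> \<le> B" by (auto simp: bounded_iff)
  then show ?thesis using assms by (intro frac_integrable_bounded absolutely_integrable_continuous_real) auto
qed

lemma frac_integrable_L1:
  assumes c: "c \<ge> 1" and t: "t > 0" and f: "f absolutely_integrable_on {0..t}"
  shows "frac_integrable c f t"
proof -
  have "(\<lambda>s. (t - s) powr (c - 1) * f s) absolutely_integrable_on {0..t}"
  proof (rule absolutely_integrable_bounded_measurable_product_real)
    show "(\<lambda>s. (t - s) powr (c - 1)) \<in> borel_measurable (lebesgue_on {0..t})"
      by (rule absolutely_integrable_imp_measurable_Icc[OF kernel_absolutely_integrable(1)]) (use c t in auto)
    have "\<bar>(t - s) powr (c - 1)\<bar> \<le> t powr (c - 1)" if "s \<in> {0..t}" for s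
      using that c by (auto intro!: powr_mono2)
    then show "bounded ((\<lambda>s. (t - s) powr (c - 1)) ` {0..t})" by (auto simp: bounded_iff intro!: exI[of _ "t powr (c - 1)"])
  qed (use f in auto)
  then show ?thesis by (simp add: frac_integrable_def)
qed

lemma frac_int_semigroup:
  assumes a: "a \<ge> 0" and b: "b \<ge> 0" and t: "t > 0" and v: "frac_integrable (a + b) v t"
  shows "frac_int a (frac_int b v) t = frac_int (a + b) v t" "frac_integrable a (frac_int b v) t"
proof -
  have "frac_int a (frac_int b v) t = frac_int (a + b) v t \<and> frac_integrable a (frac_int b v) t"
  proof (cases "a = 0 \<or> b = 0")
    case True
    have e: "frac_int 0 v = v" by (simp add: fun_eq_iff)
    from True show ?thesis using v by (auto simp: e frac_integrable_def)
  next
    case False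
    with a b have ab: "a > 0" "b > 0" by auto
    have v': "(\<lambda>s. (t - s) powr (a + b - 1) * v s) absolutely_integrable_on {0..t}" using v ab by (simp add: frac_integrable_def)
    define \<phi> where "\<phi> = (\<lambda>s. (t - s) powr (a - 1) * integral {0..s} (\<lambda>r. (s - r) powr (b - 1) * v r))"
    have \<phi>: "\<phi> absolutely_integrable_on {0..t}" "integral {0..t} \<phi> = Beta a b * integral {0..t} (\<lambda>r. (t - r) powr (a + b - 1) * v r)"
      unfolding \<phi>_def by (rule fractional_kernel_Fubini[OF ab t v'])+
    have e: "(\<lambda>s. (t - s) powr (a - 1) * frac_int b v s) = (\<lambda>s. \<phi> s * (1 / Gamma b))"
      using ab by (simp add: \<phi>_def frac_int_def fun_eq_iff)
    have G: "Gamma a > 0" "Gamma b > 0" using ab by (auto intro: Gamma_real_pos)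
    have "frac_int a (frac_int b v) t = integral {0..t} \<phi> / Gamma b / Gamma a"
      using ab unfolding frac_int_def[of a] e by simp
    also have "\<dots> = frac_int (a + b) v t"
      unfolding \<phi>(2) using ab less_imp_neq[OF G(1)] less_imp_neq[OF G(2)] by (simp add: frac_int_def Beta_def)
    finally have "frac_int a (frac_int b v) t = frac_int (a + b) v t" .
    moreover have "frac_integrable a (frac_int b v) t"
      unfolding frac_integrable_def e using \<phi>(1) by (intro disjI2 set_integrable_mult_left) auto
    ultimately show ?thesis by blast
  qed
  then show "frac_int a (frac_int b v) t = frac_int (a + b) v t" "frac_integrable a (frac_int b v) t" by auto
qed

lemma frac_int_power:
  assumes "\<beta> \<ge> 0" "p > -1" "t > 0"
  shows "frac_int \<beta> (\<lambda>s. s powr p) t = Gamma (p + 1) / Gamma (p + 1 + \<beta>) * t powr (p + \<beta>)"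
    and "frac_integrable \<beta> (\<lambda>s. s powr p) t"
proof -
  have G: "Gamma (p + 1) > 0" using assms by (intro Gamma_real_pos) auto
  have "frac_int \<beta> (\<lambda>s. s powr p) t = Gamma (p + 1) / Gamma (p + 1 + \<beta>) * t powr (p + \<beta>) \<and> frac_integrable \<beta> (\<lambda>s. s powr p) t"
  proof (cases "\<beta> = 0")
    case True then show ?thesis using G by (simp add: frac_integrable_def)
  next
    case False
    with assms have b: "\<beta> > 0" by simp
    have B: "((\<lambda>s. (t - s) powr (\<beta> - 1) * (s - 0) powr (p + 1 - 1)) has_integral Beta \<beta> (p + 1) * (t - 0) powr (\<beta> + (p + 1) - 1)) {0..t}"
      by (rule Beta_integral_interval) (use assms b in auto)
    then have B': "((\<lambda>s. (t - s) powr (\<beta> - 1) * s powr p) has_integral Beta \<beta> (p + 1) * t powr (p + \<beta>)) {0..t}"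
      by (simp add: add_ac)
    have Gb: "Gamma \<beta> > 0" using b by (rule Gamma_real_pos)
    have "frac_int \<beta> (\<lambda>s. s powr p) t = Beta \<beta> (p + 1) * t powr (p + \<beta>) / Gamma \<beta>"
      using b integral_unique[OF B'] by (simp add: frac_int_def)
    also have "\<dots> = Gamma (p + 1) / Gamma (p + 1 + \<beta>) * t powr (p + \<beta>)"
      using Gb by (simp add: Beta_def add_ac)
    finally show ?thesis using B' unfolding frac_integrable_def
      by (intro conjI disjI2 nonnegative_absolutely_integrable_1) auto
  qed
  then show "frac_int \<beta> (\<lambda>s. s powr p) t = Gamma (p + 1) / Gamma (p + 1 + \<beta>) * t powr (p + \<beta>)"
    "frac_integrable \<beta> (\<lambda>s. s powr p) t" by auto
qed

lemma frac_int_add: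
  assumes "frac_integrable \<beta> f t" "frac_integrable \<beta> g t"
  shows "frac_int \<beta> (\<lambda>s. f s + g s) t = frac_int \<beta> f t + frac_int \<beta> g t" "frac_integrable \<beta> (\<lambda>s. f s + g s) t"
proof -
  have "frac_int \<beta> (\<lambda>s. f s + g s) t = frac_int \<beta> f t + frac_int \<beta> g t \<and> frac_integrable \<beta> (\<lambda>s. f s + g s) t"
  proof (cases "\<beta> = 0")
    case False
    then have fg: "(\<lambda>s. (t - s) powr (\<beta> - 1) * f s) absolutely_integrable_on {0..t}" "(\<lambda>s. (t - s) powr (\<beta> - 1) * g s) absolutely_integrable_on {0..t}"
      using assms by (auto simp: frac_integrable_def)
    have "integral {0..t} (\<lambda>s. (t - s) powr (\<beta> - 1) * f s + (t - s) powr (\<beta> - 1) * g s)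
        = integral {0..t} (\<lambda>s. (t - s) powr (\<beta> - 1) * f s) + integral {0..t} (\<lambda>s. (t - s) powr (\<beta> - 1) * g s)"
      using fg by (intro Henstock_Kurzweil_Integration.integral_add set_lebesgue_integral_eq_integral(1))
    then show ?thesis using False set_integral_add(1)[OF fg]
      by (simp add: frac_int_def frac_integrable_def distrib_left add_divide_distrib)
  qed (simp add: frac_integrable_def)
  then show "frac_int \<beta> (\<lambda>s. f s + g s) t = frac_int \<beta> f t + frac_int \<beta> g t" "frac_integrable \<beta> (\<lambda>s. f s + g s) t" by auto
qed

lemma frac_int_cmult:
  shows "frac_int \<beta> (\<lambda>s. c * f s) t = c * frac_int \<beta> f t"
    and "frac_integrable \<beta> f t \<Longrightarrow> frac_integrable \<beta> (\<lambda>s. c * f s) t"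
proof -
  have e: "(\<lambda>s. (t - s) powr (\<beta> - 1) * (c * f s)) = (\<lambda>s. c * ((t - s) powr (\<beta> - 1) * f s))" by (simp add: mult_ac)
  show "frac_int \<beta> (\<lambda>s. c * f s) t = c * frac_int \<beta> f t"
    unfolding frac_int_def e by simp
  show "frac_integrable \<beta> (\<lambda>s. c * f s) t" if "frac_integrable \<beta> f t"
    using that unfolding frac_integrable_def e by (auto intro!: set_integrable_mult_right)
qed

lemma frac_int_sum:
  assumes "finite I" "\<And>i. i \<in> I \<Longrightarrow> frac_integrable \<beta> (f i) t"
  shows "frac_int \<beta> (\<lambda>s. \<Sum>i\<in>I. f i s) t = (\<Sum>i\<in>I. frac_int \<beta> (f i) t) \<and> frac_integrable \<beta> (\<lambda>s. \<Sum>i\<in>I. f i s) t"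
  using assms
proof (induction I rule: finite_induct)
  case empty then show ?case by (simp add: frac_int_def frac_integrable_def set_integrable_def)
next
  case (insert i I)
  then have "frac_integrable \<beta> (\<lambda>s. \<Sum>i\<in>I. f i s) t" "frac_integrable \<beta> (f i) t" by auto
  from frac_int_add[OF this(2) this(1)] insert show ?case by simp
qed

lemma frac_int_cong:
  assumes "\<And>s. s \<in> {0<..t} \<Longrightarrow> f s = g s" "\<beta> \<noteq> 0 \<or> t > 0"
  shows "frac_int \<beta> f t = frac_int \<beta> g t"
proof (cases "\<beta> = 0")
  case False
  have "integral {0..t} (\<lambda>s. (t - s) powr (\<beta> - 1) * f s) = integral {0..t} (\<lambda>s. (t - s) powr (\<beta> - 1) * g s)"
    by (rule integral_spike[of "{0}"]) (use assms in auto)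
  then show ?thesis using False by (simp add: frac_int_def)
qed (use assms in auto)

text \<open>The value at \<open>0\<close> is left out of the hypothesis: it is irrelevant to the integral, while a bound there would
exclude functions that are only known away from the base point.\<close>
lemma frac_int_bound:
  assumes c: "\<beta> \<ge> 0" and t: "t > 0" and f: "frac_integrable \<beta> f t" and B: "\<And>s. s \<in> {0<..t} \<Longrightarrow> \<bar>f s\<bar> \<le> B"
  shows "\<bar>frac_int \<beta> f t\<bar> \<le> B * t powr \<beta> / Gamma (\<beta> + 1)"
proof (cases "\<beta> = 0")
  case True then show ?thesis using B[of t] t by simp
next
  case False
  with c have b: "\<beta> > 0" by simp
  have G: "Gamma \<beta> > 0" "Gamma (\<beta> + 1) = \<beta> * Gamma \<beta>"
    using b by (auto intro: Gamma_real_pos Gamma_plus1_pos)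
  have k: "(\<lambda>s. (t - s) powr (\<beta> - 1) * f s) absolutely_integrable_on {0..t}" using f False by (simp add: frac_integrable_def)
  have k2: "(\<lambda>s. B * (t - s) powr (\<beta> - 1)) integrable_on {0..t}"
    using kernel_absolutely_integrable(1)[OF b t] by (intro integrable_on_mult_right set_lebesgue_integral_eq_integral(1))
  have "norm (integral {0..t} (\<lambda>s. (t - s) powr (\<beta> - 1) * (if s = 0 then 0 else f s))) \<le> integral {0..t} (\<lambda>s. B * (t - s) powr (\<beta> - 1))"
  proof (rule integral_norm_bound_integral)
    show "(\<lambda>s. (t - s) powr (\<beta> - 1) * (if s = 0 then 0 else f s)) integrable_on {0..t}"
      by (rule integrable_spike[OF set_lebesgue_integral_eq_integral(1)[OF k], of "{0}"]) auto
    have B0: "B \<ge> 0" using B[of t] t by auto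
    show "norm ((t - s) powr (\<beta> - 1) * (if s = 0 then 0 else f s)) \<le> B * (t - s) powr (\<beta> - 1)" if "s \<in> {0..t}" for s
      using B[of s] that B0 by (auto simp: abs_mult mult.commute[of B] intro!: mult_left_mono)
  qed (rule k2)
  also have "integral {0..t} (\<lambda>s. (t - s) powr (\<beta> - 1) * (if s = 0 then 0 else f s)) = integral {0..t} (\<lambda>s. (t - s) powr (\<beta> - 1) * f s)"
    by (rule integral_spike[of "{0}"]) auto
  also have "integral {0..t} (\<lambda>s. B * (t - s) powr (\<beta> - 1)) = B * (t powr \<beta> / \<beta>)"
    using kernel_absolutely_integrable(2)[OF b t] by simp
  finally have "\<bar>integral {0..t} (\<lambda>s. (t - s) powr (\<beta> - 1) * f s)\<bar> / Gamma \<beta> \<le> B * (t powr \<beta> / \<beta>) / Gamma \<beta>"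
    using G by (intro divide_right_mono) auto
  then show ?thesis using False G by (simp add: frac_int_def)
qed

section \<open>Consistency on fourth-order integrals\<close>

text \<open>The mean value theorem twice. The constant is \<open>1 * 3 * 1 * 2\<close> for the factors times \<open>2\<close> for moving the
intermediate point back to \<open>N\<close>.\<close>
lemma power_Taylor_bound:
  fixes b N \<theta> :: real
  assumes b: "2 \<le> b" "b \<le> 3" and N: "N \<ge> 1" and \<theta>: "0 \<le> \<theta>" "\<theta> \<le> 1"
  shows "\<bar>(N + \<theta>) powr b - N powr b - b * \<theta> * N powr (b - 1)\<bar> \<le> 12 * N powr (b - 2)"
proof (cases "\<theta> = 0")
  case True then show ?thesis by simp
next
  case False
  with \<theta> have \<theta>0: "\<theta> > 0" by simp
  have "\<exists>\<xi>>N. \<xi> < N + \<theta> \<and> (N + \<theta>) powr b - N powr b = (N + \<theta> - N) * (b * \<xi> powr (b - 1))"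
    using \<theta>0 N by (intro MVT2 has_real_derivative_powr) auto
  then obtain \<xi> where \<xi>: "N < \<xi>" "\<xi> < N + \<theta>" "(N + \<theta>) powr b - N powr b = \<theta> * (b * \<xi> powr (b - 1))" by auto
  have "\<exists>\<eta>>N. \<eta> < \<xi> \<and> \<xi> powr (b - 1) - N powr (b - 1) = (\<xi> - N) * ((b - 1) * \<eta> powr (b - 1 - 1))"
    using \<xi> N by (intro MVT2 has_real_derivative_powr) auto
  then obtain \<eta> where \<eta>: "N < \<eta>" "\<eta> < \<xi>" "\<xi> powr (b - 1) - N powr (b - 1) = (\<xi> - N) * ((b - 1) * \<eta> powr (b - 2))" by auto
  have "(N + \<theta>) powr b - N powr b - b * \<theta> * N powr (b - 1) = \<theta> * b * (\<xi> powr (b - 1) - N powr (b - 1))"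
    unfolding \<xi>(3) by (simp add: algebra_simps)
  also have "\<dots> = (\<theta> * b) * ((\<xi> - N) * (b - 1)) * \<eta> powr (b - 2)" unfolding \<eta>(3) by simp
  finally have e: "(N + \<theta>) powr b - N powr b - b * \<theta> * N powr (b - 1) = (\<theta> * b) * ((\<xi> - N) * (b - 1)) * \<eta> powr (b - 2)" .
  have "\<eta> powr (b - 2) \<le> (2 * N) powr (b - 2)" using \<eta> \<xi> \<theta> N b by (intro powr_mono2) auto
  also have "\<dots> = 2 powr (b - 2) * N powr (b - 2)" using N by (simp add: powr_mult)
  also have "\<dots> \<le> 2 powr 1 * N powr (b - 2)" using b by (intro mult_right_mono powr_mono) auto
  finally have h: "\<eta> powr (b - 2) \<le> 2 * N powr (b - 2)" by simp
  have p: "0 \<le> (\<theta> * b) * ((\<xi> - N) * (b - 1))" using \<theta> b \<xi> by (intro mult_nonneg_nonneg) auto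
  have "(\<theta> * b) * ((\<xi> - N) * (b - 1)) \<le> (1 * 3) * (1 * 2)"
    using \<theta> b \<xi> by (intro mult_mono) (auto intro!: mult_nonneg_nonneg)
  then have "(\<theta> * b) * ((\<xi> - N) * (b - 1)) * \<eta> powr (b - 2) \<le> 6 * (2 * N powr (b - 2))"
    using h by (intro mult_mono) auto
  moreover have "0 \<le> (\<theta> * b) * ((\<xi> - N) * (b - 1)) * \<eta> powr (b - 2)" using p by (rule mult_nonneg_nonneg) simp
  ultimately show ?thesis unfolding e by simp
qed

text \<open>The defect of the formula on the truncated cube \<open>(x - i)_+ ^ 3\<close>, which is what the formula sees of the kernel of
a fourth-order integral. At integers it is a power defect; at \<open>x = N + \<theta>\<close> the binomial expansion of
\<open>(k + \<theta>) ^ 3\<close> reduces it to the defects of the exponents \<open>3\<close>, \<open>2\<close> and \<open>1\<close>.\<close>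
lemma cubic_kernel_defect_bound:
  assumes a: "0 < \<alpha>" "\<alpha> \<le> 1"
  shows "\<exists>C>0. \<forall>n x. 0 < x \<longrightarrow> x \<le> real n \<longrightarrow>
           \<bar>x powr (3 - \<alpha>) / Gamma (4 - \<alpha>) - (\<Sum>i\<le>n. g_coeff \<alpha> i * (max 0 (x - real i)) ^ 3) / 6\<bar> \<le> C * x powr (1 - \<alpha>)"
proof -
  obtain C3 where C3: "C3 > 0" "\<And>n. n \<ge> 1 \<Longrightarrow> \<bar>power_defect \<alpha> 3 n\<bar> \<le> C3 * defect_rate \<alpha> 3 n"
    using power_defect_bound[OF a, of 3] by auto
  obtain C2 where C2: "C2 > 0" "\<And>n. n \<ge> 1 \<Longrightarrow> \<bar>power_defect \<alpha> 2 n\<bar> \<le> C2 * defect_rate \<alpha> 2 n"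
    using power_defect_bound[OF a, of 2] by auto
  obtain C1 where C1: "C1 > 0" "\<And>n. n \<ge> 1 \<Longrightarrow> \<bar>power_defect \<alpha> 1 n\<bar> \<le> C1 * defect_rate \<alpha> 1 n"
    using power_defect_bound[OF a, of 1] by auto
  obtain g where g: "g > 0" "\<And>n. \<bar>g_coeff \<alpha> n\<bar> \<le> g * (real n + 1) powr (- \<alpha> - 1)"
    using g_coeff_bound[of \<alpha>] a by auto
  obtain Z where Z: "Z > 0" "\<And>K. (\<Sum>n=1..K. real n powr (- \<alpha> - 1)) \<le> Z"
    using sum_powr_bounded[of "- \<alpha> - 1"] a by auto
  have S0: "\<bar>\<Sum>k=0..N. g_coeff \<alpha> (N - k)\<bar> \<le> g * Z" for N
  proof -
    have "\<bar>\<Sum>k=0..N. g_coeff \<alpha> (N - k)\<bar> \<le> (\<Sum>k=0..N. \<bar>g_coeff \<alpha> (N - k)\<bar>)" by (rule sum_abs)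
    also have "\<dots> = (\<Sum>k=0..N. \<bar>g_coeff \<alpha> k\<bar>)"
      by (rule sum.reindex_bij_witness[of _ "\<lambda>i. N - i" "\<lambda>i. N - i"]) auto
    also have "\<dots> \<le> (\<Sum>k=0..N. g * (real k + 1) powr (- \<alpha> - 1))" by (intro sum_mono g)
    also have "\<dots> = g * (\<Sum>k=0..N. real (Suc k) powr (- \<alpha> - 1))" by (simp add: sum_distrib_left add.commute)
    also have "(\<Sum>k=0..N. real (Suc k) powr (- \<alpha> - 1)) = (\<Sum>k=1..Suc N. real k powr (- \<alpha> - 1))"
      using sum.shift_bounds_cl_Suc_ivl[of "\<lambda>k. real k powr (- \<alpha> - 1)" 0 N] by simp
    also have "g * \<dots> \<le> g * Z" using g(1) by (intro mult_left_mono Z(2)) auto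
    finally show ?thesis .
  qed
  have G4eq: "Gamma (4 - \<alpha>) = (3 - \<alpha>) * Gamma (3 - \<alpha>)"
    using Gamma_plus1_pos[of "3 - \<alpha>"] a by simp
  have G: "Gamma (4 - \<alpha>) > 0" "Gamma (3 - \<alpha>) > 0" "Gamma (2 - \<alpha>) > 0"
    using a by (auto intro!: Gamma_real_pos)
  have Gn: "Gamma 4 = (6::real)" "Gamma 3 = (2::real)" "Gamma 2 = (1::real)"
    using Gamma_fact[of 3, where 'a = real] Gamma_fact[of 2, where 'a = real] Gamma_fact[of 1, where 'a = real] by (simp_all add: fact_numeral)
  define D1 where "D1 = 1 / Gamma (2 - \<alpha>) + 2 * C1"
  define G4 where "G4 = 1 / Gamma (4 - \<alpha>)"
  define C where "C = G4 + \<bar>g_coeff \<alpha> 0\<bar> + 12 * G4 + 2 * C3 + 2 * C2 + D1 + g * Z"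
  have G4: "G4 > 0" using G by (simp add: G4_def)
  have gZ: "g * Z > 0" using g Z by simp
  have D1: "D1 > 0" using G C1 by (simp add: D1_def add_pos_pos)
  have Cpos: "C > 0" unfolding C_def using G4 C3(1) C2(1) D1 gZ by linarith
  have "\<bar>x powr (3 - \<alpha>) / Gamma (4 - \<alpha>) - (\<Sum>i\<le>n. g_coeff \<alpha> i * (max 0 (x - real i)) ^ 3) / 6\<bar> \<le> C * x powr (1 - \<alpha>)"
    if x: "0 < x" "x \<le> real n" for n x
  proof (cases "x < 1")
    case True
    have "(\<Sum>i\<le>n. g_coeff \<alpha> i * (max 0 (x - real i)) ^ 3) = (\<Sum>i\<in>{0}. g_coeff \<alpha> i * (max 0 (x - real i)) ^ 3)"
      by (rule sum.mono_neutral_right) (use True in \<open>auto simp: max_def\<close>)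
    then have e: "(\<Sum>i\<le>n. g_coeff \<alpha> i * (max 0 (x - real i)) ^ 3) = g_coeff \<alpha> 0 * x ^ 3" using x by (simp add: max_def)
    have 1: "x powr (3 - \<alpha>) \<le> x powr (1 - \<alpha>)" using x True by (intro powr_mono') auto
    have 2: "x ^ 3 \<le> x powr (1 - \<alpha>)"
    proof -
      have "x ^ 3 = x powr 3" using x by simp
      also have "\<dots> \<le> x powr (1 - \<alpha>)" using x True a by (intro powr_mono') auto
      finally show ?thesis .
    qed
    have "\<bar>x powr (3 - \<alpha>) / Gamma (4 - \<alpha>) - g_coeff \<alpha> 0 * x ^ 3 / 6\<bar> \<le> x powr (3 - \<alpha>) / Gamma (4 - \<alpha>) + \<bar>g_coeff \<alpha> 0\<bar> * x ^ 3 / 6"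
      using G x by (intro order.trans[OF abs_triangle_ineq4]) (simp add: abs_mult)
    also have "\<dots> \<le> x powr (1 - \<alpha>) / Gamma (4 - \<alpha>) + \<bar>g_coeff \<alpha> 0\<bar> * x powr (1 - \<alpha>)"
    proof (rule add_mono)
      show "x powr (3 - \<alpha>) / Gamma (4 - \<alpha>) \<le> x powr (1 - \<alpha>) / Gamma (4 - \<alpha>)" using 1 G by (intro divide_right_mono) auto
      have "\<bar>g_coeff \<alpha> 0\<bar> * x ^ 3 / 6 \<le> \<bar>g_coeff \<alpha> 0\<bar> * x ^ 3" using x by simp
      also have "\<dots> \<le> \<bar>g_coeff \<alpha> 0\<bar> * x powr (1 - \<alpha>)" using 2 by (intro mult_left_mono) auto
      finally show "\<bar>g_coeff \<alpha> 0\<bar> * x ^ 3 / 6 \<le> \<bar>g_coeff \<alpha> 0\<bar> * x powr (1 - \<alpha>)" .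
    qed
    also have "\<dots> = (G4 + \<bar>g_coeff \<alpha> 0\<bar>) * x powr (1 - \<alpha>)" by (simp add: G4_def algebra_simps)
    also have "\<dots> \<le> C * x powr (1 - \<alpha>)"
    proof (rule mult_right_mono)
      show "G4 + \<bar>g_coeff \<alpha> 0\<bar> \<le> C" unfolding C_def using G4 C3(1) C2(1) D1 gZ by linarith
    qed simp
    finally show ?thesis unfolding e .
  next
    case False
    define N where "N = nat \<lfloor>x\<rfloor>"
    define \<theta> where "\<theta> = x - real N"
    have N: "N \<ge> 1" "real N \<le> x" "x < real N + 1" using False by (auto simp: N_def le_nat_iff)
    have \<theta>: "0 \<le> \<theta>" "\<theta> \<le> 1" "x = real N + \<theta>" using N by (auto simp: \<theta>_def)
    have Nn: "N \<le> n" using N x by linarith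
    define X where "X = real N powr (1 - \<alpha>)"
    have X1: "X \<ge> 1" unfolding X_def using N a by (intro ge_one_powr_ge_zero) auto
    have Xle: "real N powr p \<le> X" if "p \<le> 1 - \<alpha>" for p unfolding X_def using N that by (intro powr_mono) auto
    define S where "S = (\<lambda>p. \<Sum>k=0..N. g_coeff \<alpha> (N - k) * real k powr p)"
    have "(\<Sum>i\<le>n. g_coeff \<alpha> i * (max 0 (x - real i)) ^ 3) = (\<Sum>i\<le>N. g_coeff \<alpha> i * (max 0 (x - real i)) ^ 3)"
      by (rule sum.mono_neutral_right) (use N Nn in \<open>auto simp: max_def\<close>)
    also have "\<dots> = (\<Sum>k=0..N. g_coeff \<alpha> (N - k) * (real k + \<theta>) ^ 3)"
      by (rule sum.reindex_bij_witness[of _ "\<lambda>i. N - i" "\<lambda>i. N - i"]) (use \<theta> in \<open>auto simp: of_nat_diff max_def algebra_simps\<close>)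
    also have "\<dots> = (\<Sum>k=0..N. g_coeff \<alpha> (N - k) * (real k powr 3 + 3 * \<theta> * real k powr 2 + 3 * \<theta>\<^sup>2 * real k powr 1 + \<theta> ^ 3))"
    proof (intro sum.cong refl arg_cong2[where f = "(*)"])
      fix k
      show "(real k + \<theta>) ^ 3 = real k powr 3 + 3 * \<theta> * real k powr 2 + 3 * \<theta>\<^sup>2 * real k powr 1 + \<theta> ^ 3"
        by (cases "k = 0") (auto simp: power2_eq_square power3_eq_cube algebra_simps)
    qed
    also have "\<dots> = S 3 + 3 * \<theta> * S 2 + 3 * \<theta>\<^sup>2 * S 1 + \<theta> ^ 3 * (\<Sum>k=0..N. g_coeff \<alpha> (N - k))"
      unfolding S_def by (simp add: sum.distrib sum_distrib_left algebra_simps)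
    finally have e: "(\<Sum>i\<le>n. g_coeff \<alpha> i * (max 0 (x - real i)) ^ 3) = S 3 + 3 * \<theta> * S 2 + 3 * \<theta>\<^sup>2 * S 1 + \<theta> ^ 3 * (\<Sum>k=0..N. g_coeff \<alpha> (N - k))" .
    have s3: "S 3 = 6 / Gamma (4 - \<alpha>) * real N powr (3 - \<alpha>) - power_defect \<alpha> 3 N"
      by (simp add: S_def power_defect_def Gn)
    have s2: "S 2 = 2 / Gamma (3 - \<alpha>) * real N powr (2 - \<alpha>) - power_defect \<alpha> 2 N"
      by (simp add: S_def power_defect_def Gn)
    have s1: "S 1 = 1 / Gamma (2 - \<alpha>) * real N powr (1 - \<alpha>) - power_defect \<alpha> 1 N"
      by (simp add: S_def power_defect_def Gn)
    have d3: "\<bar>power_defect \<alpha> 3 N\<bar> \<le> 2 * C3 * X"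
    proof -
      have "C3 * defect_rate \<alpha> 3 N \<le> C3 * (X + X)" using C3 a by (intro mult_left_mono add_mono Xle) auto
      then show ?thesis using C3(2)[OF N(1)] by simp
    qed
    have d2: "\<bar>power_defect \<alpha> 2 N\<bar> \<le> 2 * C2 * X"
    proof -
      have "C2 * defect_rate \<alpha> 2 N \<le> C2 * (X + X)" using C2 a by (intro mult_left_mono add_mono Xle) auto
      then show ?thesis using C2(2)[OF N(1)] by simp
    qed
    have d1: "\<bar>power_defect \<alpha> 1 N\<bar> \<le> 2 * C1 * X"
    proof -
      have "C1 * defect_rate \<alpha> 1 N \<le> C1 * (X + X)" using C1 a by (intro mult_left_mono add_mono Xle) auto
      then show ?thesis using C1(2)[OF N(1)] by simp
    qed
    have s1': "\<bar>S 1\<bar> \<le> D1 * X"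
    proof -
      have "\<bar>S 1\<bar> \<le> \<bar>1 / Gamma (2 - \<alpha>) * X\<bar> + \<bar>power_defect \<alpha> 1 N\<bar>" unfolding s1 X_def by (rule abs_triangle_ineq4)
      also have "\<bar>1 / Gamma (2 - \<alpha>) * X\<bar> = 1 / Gamma (2 - \<alpha>) * X" using G X1 by simp
      finally show ?thesis using d1 by (simp add: D1_def algebra_simps)
    qed
    have t: "\<bar>x powr (3 - \<alpha>) - real N powr (3 - \<alpha>) - (3 - \<alpha>) * \<theta> * real N powr (2 - \<alpha>)\<bar> \<le> 12 * X"
      using power_Taylor_bound[of "3 - \<alpha>" "real N" \<theta>] a N \<theta> by (simp add: X_def)
    define R where "R = x powr (3 - \<alpha>) - real N powr (3 - \<alpha>) - (3 - \<alpha>) * \<theta> * real N powr (2 - \<alpha>)"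
    define S0v where "S0v = (\<Sum>k=0..N. g_coeff \<alpha> (N - k))"
    have "x powr (3 - \<alpha>) / Gamma (4 - \<alpha>) - (S 3 + 3 * \<theta> * S 2 + 3 * \<theta>\<^sup>2 * S 1 + \<theta> ^ 3 * S0v) / 6
       = R / Gamma (4 - \<alpha>) + power_defect \<alpha> 3 N / 6 + \<theta> / 2 * power_defect \<alpha> 2 N - \<theta>\<^sup>2 / 2 * S 1 - \<theta> ^ 3 / 6 * S0v"
    proof -
      have "(3 - \<alpha>) / Gamma (4 - \<alpha>) = 1 / Gamma (3 - \<alpha>)" unfolding G4eq using a by simp
      then have "(3 - \<alpha>) * \<theta> * real N powr (2 - \<alpha>) / Gamma (4 - \<alpha>) = \<theta> * real N powr (2 - \<alpha>) / Gamma (3 - \<alpha>)"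
        by (metis (no_types, opaque_lifting) mult.assoc mult.commute mult_1 times_divide_eq_left)
      moreover have "x powr (3 - \<alpha>) / Gamma (4 - \<alpha>) = R / Gamma (4 - \<alpha>) + real N powr (3 - \<alpha>) / Gamma (4 - \<alpha>) + (3 - \<alpha>) * \<theta> * real N powr (2 - \<alpha>) / Gamma (4 - \<alpha>)"
        by (simp add: R_def add_divide_distrib[symmetric])
      ultimately show ?thesis unfolding s3 s2 by (simp add: field_simps)
    qed
    also have "\<bar>\<dots>\<bar> \<le> \<bar>R / Gamma (4 - \<alpha>)\<bar> + \<bar>power_defect \<alpha> 3 N / 6\<bar> + \<bar>\<theta> / 2 * power_defect \<alpha> 2 N\<bar> + \<bar>\<theta>\<^sup>2 / 2 * S 1\<bar> + \<bar>\<theta> ^ 3 / 6 * S0v\<bar>"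
      by linarith
    also have "\<dots> \<le> 12 / Gamma (4 - \<alpha>) * X + 2 * C3 * X + 2 * C2 * X + D1 * X + g * Z * X"
    proof (intro add_mono)
      show "\<bar>R / Gamma (4 - \<alpha>)\<bar> \<le> 12 / Gamma (4 - \<alpha>) * X"
        using t G unfolding R_def[symmetric] by (simp add: abs_divide divide_right_mono)
      show "\<bar>power_defect \<alpha> 3 N / 6\<bar> \<le> 2 * C3 * X" using d3 by simp
      have "\<bar>\<theta> / 2 * power_defect \<alpha> 2 N\<bar> \<le> 1 * \<bar>power_defect \<alpha> 2 N\<bar>"
        unfolding abs_mult using \<theta> by (intro mult_right_mono) auto
      then show "\<bar>\<theta> / 2 * power_defect \<alpha> 2 N\<bar> \<le> 2 * C2 * X" using d2 by simp
      have "\<theta>\<^sup>2 \<le> 1" "\<theta> ^ 3 \<le> 1" using \<theta> by (auto intro: power_le_one)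
      then have "\<bar>\<theta>\<^sup>2 / 2\<bar> \<le> 1" "\<bar>\<theta> ^ 3 / 6\<bar> \<le> 1" using \<theta> by auto
      have "\<bar>\<theta>\<^sup>2 / 2 * S 1\<bar> \<le> 1 * \<bar>S 1\<bar>"
        unfolding abs_mult by (rule mult_right_mono[OF \<open>\<bar>\<theta>\<^sup>2 / 2\<bar> \<le> 1\<close>]) simp
      moreover have "\<bar>\<theta> ^ 3 / 6 * S0v\<bar> \<le> 1 * \<bar>S0v\<bar>"
        unfolding abs_mult by (rule mult_right_mono[OF \<open>\<bar>\<theta> ^ 3 / 6\<bar> \<le> 1\<close>]) simp
      moreover have "\<bar>S0v\<bar> \<le> g * Z * X"
      proof -
        have "g * Z * 1 \<le> g * Z * X" using X1 g Z by (intro mult_left_mono) auto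
        then show ?thesis using S0[of N] by (simp add: S0v_def)
      qed
      ultimately show "\<bar>\<theta>\<^sup>2 / 2 * S 1\<bar> \<le> D1 * X" "\<bar>\<theta> ^ 3 / 6 * S0v\<bar> \<le> g * Z * X" using s1' by auto
    qed
    also have "\<dots> = (12 * G4 + 2 * C3 + 2 * C2 + D1 + g * Z) * X" by (simp add: G4_def algebra_simps)
    also have "\<dots> \<le> C * X"
    proof (rule mult_right_mono)
      show "12 * G4 + 2 * C3 + 2 * C2 + D1 + g * Z \<le> C" unfolding C_def using G4 by linarith
    qed (use X1 in simp)
    also have "\<dots> \<le> C * x powr (1 - \<alpha>)" unfolding X_def using Cpos N a by (intro mult_left_mono powr_mono2) auto
    finally show ?thesis unfolding e S0v_def .
  qed
  with Cpos show ?thesis by blast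
qed

lemma absolutely_integrable_continuous_mult:
  fixes h V :: "real \<Rightarrow> real"
  assumes "continuous_on {a..b} h" "V absolutely_integrable_on {a..b}"
  shows "(\<lambda>s. h s * V s) absolutely_integrable_on {a..b}"
proof (rule absolutely_integrable_bounded_measurable_product_real)
  show "h \<in> borel_measurable (lebesgue_on {a..b})"
    by (rule absolutely_integrable_imp_measurable_Icc[OF absolutely_integrable_continuous_real[OF assms(1)]])
  show "bounded (h ` {a..b})" using assms(1) by (intro compact_imp_bounded compact_continuous_image) auto
qed (use assms in auto)

text \<open>Both fractional integrals are integrals of \<open>V\<close> over \<open>{0..t}\<close>, so the error is one integral of \<open>V\<close> against the
difference of the kernels. With \<open>x = (t - s) / \<tau>\<close> this difference is \<open>\<tau> powr (3 - \<alpha>)\<close> times the cubic kernel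
defect, hence \<open>O(\<tau>\<^sup>2 * (t - s) powr (1 - \<alpha>))\<close>, which is integrable.\<close>
lemma smooth_truncation_bound:
  assumes a: "0 < \<alpha>" "\<alpha> \<le> 1" and T: "T > 0"
    and V: "V absolutely_integrable_on {0..T}" and B: "\<And>s. s \<in> {0..T} \<Longrightarrow> \<bar>V s\<bar> \<le> B"
  shows "\<exists>C>0. \<forall>\<tau>>0. \<forall>n\<ge>1. real n * \<tau> \<le> T \<longrightarrow>
     \<bar>frac_int (4 - \<alpha>) V (real n * \<tau>) - 1 / \<tau> powr \<alpha> * (\<Sum>k=0..n. g_coeff \<alpha> (n - k) * frac_int 4 V (real k * \<tau>))\<bar> \<le> C * \<tau>\<^sup>2"
proof -
  obtain C0 where C0': "C0 > 0 \<and> (\<forall>n x. 0 < x \<longrightarrow> x \<le> real n \<longrightarrow>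
           \<bar>x powr (3 - \<alpha>) / Gamma (4 - \<alpha>) - (\<Sum>i\<le>n. g_coeff \<alpha> i * (max 0 (x - real i)) ^ 3) / 6\<bar> \<le> C0 * x powr (1 - \<alpha>))"
    using cubic_kernel_defect_bound[OF a] by (rule exE)
  note C0 = C0'[THEN conjunct1] C0'[THEN conjunct2, rule_format]
  have B0: "B \<ge> 0" using B[of 0] T by auto
  define C where "C = B * C0 * (T powr (2 - \<alpha>) / (2 - \<alpha>)) + 1"
  have Cpos: "C > 0" unfolding C_def using B0 C0(1) a by (intro add_nonneg_pos mult_nonneg_nonneg divide_nonneg_nonneg) simp_all
  have "\<bar>frac_int (4 - \<alpha>) V (real n * \<tau>) - 1 / \<tau> powr \<alpha> * (\<Sum>k=0..n. g_coeff \<alpha> (n - k) * frac_int 4 V (real k * \<tau>))\<bar> \<le> C * \<tau>\<^sup>2"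
    if \<tau>: "\<tau> > 0" and n: "n \<ge> 1" and nT: "real n * \<tau> \<le> T" for \<tau> n
  proof -
    define t where "t = real n * \<tau>"
    have t: "t > 0" "t \<le> T" using \<tau> n nT by (auto simp: t_def)
    have Vt: "V absolutely_integrable_on {0..t}"
      by (rule absolutely_integrable_on_subinterval[OF V]) (use t in simp)
    \<comment> \<open>The kernel of the fourth-order integral up to the grid point \<open>k\<close>, extended by zero to the whole of \<open>{0..t}\<close>.\<close>
    define h where "h = (\<lambda>k s. (max 0 (real k * \<tau> - s)) ^ 3)"
    have hint: "(\<lambda>s. h k s * V s) absolutely_integrable_on {0..t}" for k
    proof (rule absolutely_integrable_continuous_mult[OF _ Vt])
      show "continuous_on {0..t} (h k)" unfolding h_def by (intro continuous_intros)
    qed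
    have G4: "Gamma 4 = (6::real)" using Gamma_fact[of 3, where 'a = real] by (simp add: fact_numeral)
    have f4: "frac_int 4 V (real k * \<tau>) = integral {0..t} (\<lambda>s. h k s * V s) / 6" if k: "k \<le> n" for k
    proof -
      have kt: "real k * \<tau> \<le> t" using k \<tau> by (simp add: t_def)
      have "integral {0..t} (\<lambda>s. h k s * V s) = integral {0..t} (\<lambda>s. if s \<in> {0..real k * \<tau>} then (real k * \<tau> - s) powr (4 - 1) * V s else 0)"
      proof (rule Henstock_Kurzweil_Integration.integral_cong)
        fix s assume s: "s \<in> {0..t}"
        show "h k s * V s = (if s \<in> {0..real k * \<tau>} then (real k * \<tau> - s) powr (4 - 1) * V s else 0)"
        proof (cases "s < real k * \<tau>")
          case True
          define d where "d = real k * \<tau> - s"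
          have d: "d > 0" using True by (simp add: d_def)
          have "h k s = d ^ 3" using d by (simp only: h_def d_def[symmetric] max_absorb2 less_imp_le)
          moreover have "d powr (4 - 1) = d ^ 3" using d by simp
          moreover have "s \<in> {0..real k * \<tau>}" using s True by simp
          ultimately show ?thesis by (simp only: d_def[symmetric] if_True)
        next
          case False
          then have "max 0 (real k * \<tau> - s) = 0" by simp
          then have "h k s = 0" unfolding h_def by simp
          moreover have "(real k * \<tau> - s) powr (4 - 1) = 0" if "s \<in> {0..real k * \<tau>}"
          proof -
            have "real k * \<tau> - s = 0" using that False by simp
            then show ?thesis by (simp only: powr_zero_eq_one powr_eq_0_iff)
          qed
          ultimately show ?thesis by simp
        qed
      qed
      also have "\<dots> = integral {0..real k * \<tau>} (\<lambda>s. (real k * \<tau> - s) powr (4 - 1) * V s)"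
      proof -
        have "{0..real k * \<tau>} \<inter> {0..t} = {0..real k * \<tau>}" using kt by auto
        then show ?thesis by (simp only: Henstock_Kurzweil_Integration.integral_restrict_Int)
      qed
      finally show ?thesis by (simp add: frac_int_def G4)
    qed
    have k4: "(\<lambda>s. (t - s) powr (4 - \<alpha> - 1) * V s) absolutely_integrable_on {0..t}"
      using frac_integrable_L1[OF _ t(1) Vt, of "4 - \<alpha>"] a by (auto simp: frac_integrable_def)
    define F where "F = (\<lambda>s. (t - s) powr (4 - \<alpha> - 1) * V s / Gamma (4 - \<alpha>) - 1 / \<tau> powr \<alpha> * (\<Sum>k=0..n. g_coeff \<alpha> (n - k) * (h k s * V s / 6)))"
    have F1: "integral {0..t} F = frac_int (4 - \<alpha>) V t - 1 / \<tau> powr \<alpha> * (\<Sum>k=0..n. g_coeff \<alpha> (n - k) * frac_int 4 V (real k * \<tau>))"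
       and F2: "F integrable_on {0..t}"
    proof -
      have i1: "((\<lambda>s. (t - s) powr (4 - \<alpha> - 1) * V s / Gamma (4 - \<alpha>)) has_integral integral {0..t} (\<lambda>s. (t - s) powr (4 - \<alpha> - 1) * V s) / Gamma (4 - \<alpha>)) {0..t}"
        using k4 by (intro has_integral_divide integrable_integral set_lebesgue_integral_eq_integral(1))
      have i2: "((\<lambda>s. h k s * V s / 6) has_integral integral {0..t} (\<lambda>s. h k s * V s) / 6) {0..t}" for k
        using hint by (intro has_integral_divide integrable_integral set_lebesgue_integral_eq_integral(1))
      have i3: "((\<lambda>s. 1 / \<tau> powr \<alpha> * (\<Sum>k=0..n. g_coeff \<alpha> (n - k) * (h k s * V s / 6))) has_integral
           1 / \<tau> powr \<alpha> * (\<Sum>k=0..n. g_coeff \<alpha> (n - k) * (integral {0..t} (\<lambda>s. h k s * V s) / 6))) {0..t}"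
        by (intro has_integral_mult_right has_integral_sum i2) auto
      have "(F has_integral integral {0..t} (\<lambda>s. (t - s) powr (4 - \<alpha> - 1) * V s) / Gamma (4 - \<alpha>) - 1 / \<tau> powr \<alpha> * (\<Sum>k=0..n. g_coeff \<alpha> (n - k) * (integral {0..t} (\<lambda>s. h k s * V s) / 6))) {0..t}"
        unfolding F_def by (rule has_integral_diff[OF i1 i3])
      moreover have "(\<Sum>k=0..n. g_coeff \<alpha> (n - k) * (integral {0..t} (\<lambda>s. h k s * V s) / 6)) = (\<Sum>k=0..n. g_coeff \<alpha> (n - k) * frac_int 4 V (real k * \<tau>))"
        by (intro sum.cong refl) (simp add: f4)
      moreover have "integral {0..t} (\<lambda>s. (t - s) powr (4 - \<alpha> - 1) * V s) / Gamma (4 - \<alpha>) = frac_int (4 - \<alpha>) V t"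
        using a by (simp add: frac_int_def)
      ultimately have F: "(F has_integral (frac_int (4 - \<alpha>) V t - 1 / \<tau> powr \<alpha> * (\<Sum>k=0..n. g_coeff \<alpha> (n - k) * frac_int 4 V (real k * \<tau>)))) {0..t}" by simp
      show "integral {0..t} F = frac_int (4 - \<alpha>) V t - 1 / \<tau> powr \<alpha> * (\<Sum>k=0..n. g_coeff \<alpha> (n - k) * frac_int 4 V (real k * \<tau>))"
        using F by (rule integral_unique)
      show "F integrable_on {0..t}" using F by (rule has_integral_integrable)
    qed
    have pt: "norm (F s) \<le> B * C0 * \<tau>\<^sup>2 * (t - s) powr (2 - \<alpha> - 1)" if s: "s \<in> {0..t}" for s
    proof (cases "s = t")
      case True
      have "h k t = 0" if "k \<le> n" for k using that \<tau> by (auto simp: h_def t_def max_def)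
      then have "(\<Sum>k=0..n. g_coeff \<alpha> (n - k) * (h k t * V t / 6)) = 0" by (intro sum.neutral) auto
      then have "F s = 0" unfolding F_def True by simp
      then show ?thesis using B0 C0(1) by simp
    next
      case False
      with s have st: "s < t" by simp
      define x where "x = (t - s) / \<tau>"
      have x: "0 < x" "x \<le> real n" using st s \<tau> by (auto simp: x_def t_def field_simps)
      have ts: "t - s = \<tau> * x" using \<tau> by (simp add: x_def)
      have hk: "h k s = \<tau> ^ 3 * (max 0 (x - real (n - k))) ^ 3" if "k \<le> n" for k
      proof -
        have "real k * \<tau> - s = \<tau> * (x - real (n - k))"
          using that ts by (simp add: of_nat_diff t_def algebra_simps)
        then have "max 0 (real k * \<tau> - s) = \<tau> * max 0 (x - real (n - k))" using \<tau>
          by (simp add: max_mult_distrib_left)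
        then show ?thesis by (simp add: h_def power_mult_distrib)
      qed
      have "(\<Sum>k=0..n. g_coeff \<alpha> (n - k) * (h k s * V s / 6)) = \<tau> ^ 3 * V s * ((\<Sum>k=0..n. g_coeff \<alpha> (n - k) * (max 0 (x - real (n - k))) ^ 3) / 6)"
        unfolding sum_distrib_left sum_divide_distrib by (intro sum.cong refl) (simp add: hk)
      also have "(\<Sum>k=0..n. g_coeff \<alpha> (n - k) * (max 0 (x - real (n - k))) ^ 3) = (\<Sum>i\<le>n. g_coeff \<alpha> i * (max 0 (x - real i)) ^ 3)"
        by (rule sum.reindex_bij_witness[of _ "\<lambda>i. n - i" "\<lambda>i. n - i"]) auto
      finally have sm: "(\<Sum>k=0..n. g_coeff \<alpha> (n - k) * (h k s * V s / 6)) = \<tau> ^ 3 * V s * ((\<Sum>i\<le>n. g_coeff \<alpha> i * (max 0 (x - real i)) ^ 3) / 6)" .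
      have p3: "1 / \<tau> powr \<alpha> * \<tau> ^ 3 = \<tau> powr (3 - \<alpha>)" using \<tau> by (simp add: powr_diff)
      have "F s = \<tau> powr (3 - \<alpha>) * V s * (x powr (3 - \<alpha>) / Gamma (4 - \<alpha>) - (\<Sum>i\<le>n. g_coeff \<alpha> i * (max 0 (x - real i)) ^ 3) / 6)"
      proof -
        have "(t - s) powr (4 - \<alpha> - 1) = \<tau> powr (3 - \<alpha>) * x powr (3 - \<alpha>)" unfolding ts using \<tau> x by (simp add: powr_mult)
        moreover have "1 / \<tau> powr \<alpha> * (\<tau> ^ 3 * V s * ((\<Sum>i\<le>n. g_coeff \<alpha> i * (max 0 (x - real i)) ^ 3) / 6))
            = \<tau> powr (3 - \<alpha>) * V s * ((\<Sum>i\<le>n. g_coeff \<alpha> i * (max 0 (x - real i)) ^ 3) / 6)"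
          by (simp only: mult.assoc[symmetric] p3)
        ultimately show ?thesis unfolding F_def sm by (simp only: right_diff_distrib) (simp add: mult_ac)
      qed
      then have "norm (F s) = \<tau> powr (3 - \<alpha>) * \<bar>V s\<bar> * \<bar>x powr (3 - \<alpha>) / Gamma (4 - \<alpha>) - (\<Sum>i\<le>n. g_coeff \<alpha> i * (max 0 (x - real i)) ^ 3) / 6\<bar>"
        by (simp add: abs_mult)
      also have "\<dots> \<le> \<tau> powr (3 - \<alpha>) * B * (C0 * x powr (1 - \<alpha>))"
        using B[of s] s t B0 C0(1) C0(2)[OF x] by (intro mult_mono) auto
      also have "\<tau> powr (3 - \<alpha>) * B * (C0 * x powr (1 - \<alpha>)) = B * C0 * \<tau>\<^sup>2 * (t - s) powr (2 - \<alpha> - 1)"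
      proof -
        have "\<tau> powr (3 - \<alpha>) = \<tau>\<^sup>2 * \<tau> powr (1 - \<alpha>)" using \<tau> powr_add[of \<tau> 2 "1 - \<alpha>"] by simp
        then show ?thesis unfolding ts using \<tau> x by (simp add: powr_mult)
      qed
      finally show ?thesis .
    qed
    have "norm (integral {0..t} F) \<le> integral {0..t} (\<lambda>s. B * C0 * \<tau>\<^sup>2 * (t - s) powr (2 - \<alpha> - 1))"
    proof (rule integral_norm_bound_integral[OF F2 _ pt])
      show "(\<lambda>s. B * C0 * \<tau>\<^sup>2 * (t - s) powr (2 - \<alpha> - 1)) integrable_on {0..t}"
        using a t by (intro integrable_on_mult_right set_lebesgue_integral_eq_integral(1) kernel_absolutely_integrable) auto
    qed
    also have "\<dots> = B * C0 * \<tau>\<^sup>2 * (t powr (2 - \<alpha>) / (2 - \<alpha>))"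
      using kernel_absolutely_integrable(2)[of "2 - \<alpha>" t] a t by simp
    also have "\<dots> \<le> B * C0 * \<tau>\<^sup>2 * (T powr (2 - \<alpha>) / (2 - \<alpha>))"
      using B0 C0(1) a t by (intro mult_left_mono divide_right_mono powr_mono2) auto
    also have "\<dots> \<le> C * \<tau>\<^sup>2" by (simp add: C_def algebra_simps)
    finally show ?thesis using F1 by (simp add: t_def)
  qed
  with Cpos show ?thesis by blast
qed

section \<open>Decomposition of the solution\<close>

text \<open>Values at the two endpoints are immaterial; in particular nothing is needed at \<open>t\<close>, where a derivative may not exist.\<close>
lemma frac_int_cong_open:
  assumes "\<beta> > 0" "\<And>s. s \<in> {0<..<t} \<Longrightarrow> f s = g s"
  shows "frac_int \<beta> f t = frac_int \<beta> g t"
proof -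
  have "integral {0..t} (\<lambda>s. (t - s) powr (\<beta> - 1) * f s) = integral {0..t} (\<lambda>s. (t - s) powr (\<beta> - 1) * g s)"
  proof (rule integral_spike[of "{0, t}"])
    fix s assume "s \<in> {0..t} - {0, t}"
    then have "s \<in> {0<..<t}" by auto
    then show "(t - s) powr (\<beta> - 1) * g s = (t - s) powr (\<beta> - 1) * f s" using assms(2) by simp
  qed simp
  then show ?thesis using assms(1) by (simp add: frac_int_def)
qed

lemma frac_int_1: "frac_int 1 f t = integral {0..t} f"
proof -
  have "integral {0..t} (\<lambda>s. (t - s) powr (1 - 1) * f s) = integral {0..t} f"
    by (rule integral_spike[of "{t}"]) auto
  then show ?thesis by (simp add: frac_int_def)
qed

lemma frac_integrable_1_iff: "frac_integrable 1 f t \<longleftrightarrow> f absolutely_integrable_on {0..t}"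
proof -
  have "(\<lambda>s. (t - s) powr (1 - 1) * f s) absolutely_integrable_on {0..t} \<longleftrightarrow> f absolutely_integrable_on {0..t}"
    by (rule absolutely_integrable_spike_eq[of "{t}"]) auto
  then show ?thesis by (simp add: frac_integrable_def)
qed

lemma absolutely_integrable_initial:
  fixes v :: "real \<Rightarrow> real"
  assumes "v absolutely_integrable_on {0..T}" "t \<le> T"
  shows "v absolutely_integrable_on {0..t}"
  by (rule absolutely_integrable_on_subinterval[OF assms(1)]) (use assms(2) in auto)

lemma Caputo_derivative_as_frac_int:
  assumes "has_caputo_derivative T \<alpha> Y D t" and a: "0 < \<alpha>" "\<alpha> \<le> 1" and t: "t \<in> {0<..<T}"
    and v: "\<And>s. s \<in> {0<..<T} \<Longrightarrow> (Y has_real_derivative v s) (at s)"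
  shows "D = frac_int (1 - \<alpha>) v t"
proof (cases "\<alpha> = 1")
  case True
  have "at t within {0..T} = at t" using t by (intro at_within_interior) simp
  then have "(Y has_real_derivative D) (at t)" using assms(1) True by (simp add: has_caputo_derivative_def)
  then show ?thesis using v[OF t] DERIV_unique True by simp
next
  case False
  then obtain U' where U': "\<forall>s\<in>{0<..<t}. (Y has_real_derivative U' s) (at s)"
      "D = 1 / Gamma (1 - \<alpha>) * integral {0..t} (\<lambda>s. (t - s) powr (-\<alpha>) * U' s)"
    using assms(1) by (auto simp: has_caputo_derivative_def)
  have "U' s = v s" if "s \<in> {0<..<t}" for s
    by (rule DERIV_unique[of Y _ s]) (use U'(1) v that t in auto)
  then have "frac_int (1 - \<alpha>) U' t = frac_int (1 - \<alpha>) v t"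
    using False a by (intro frac_int_cong_open) auto
  moreover have "frac_int (1 - \<alpha>) U' t = D" using False U'(2) by (simp add: frac_int_def)
  ultimately show ?thesis by simp
qed

text \<open>The Caputo derivatives presuppose a derivative of \<open>Y\<close> that may depend on the point and on the order; all of them are
restrictions of one integrable \<open>v\<close>. If some order is below \<open>1\<close>, the Caputo derivative at the endpoint \<open>T\<close> supplies
\<open>v\<close> on the whole interval, and multiplying by the bounded inverse of the kernel shows that it is integrable. If all
orders are \<open>1\<close>, the equation itself expresses the derivative by the continuous \<open>Y\<close>.\<close>
lemma multiterm_solution_derivative:
  fixes \<nu> \<alpha> :: "nat \<Rightarrow> real"
  assumes T: "T > 0" and \<nu>: "(\<Sum>j=1..Q. \<nu> j) > 0"
    and a: "\<And>j. j \<in> {1..Q} \<Longrightarrow> 0 < \<alpha> j \<and> \<alpha> j \<le> 1"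
    and sol: "multiterm_solution T Q \<nu> \<alpha> Y0 Y"
  shows "\<exists>v. v absolutely_integrable_on {0..T} \<and> (\<forall>s\<in>{0<..<T}. (Y has_real_derivative v s) (at s))
     \<and> (\<forall>t\<in>{0<..<T}. (\<Sum>j=1..Q. \<nu> j * frac_int (1 - \<alpha> j) v t) = - Y t)"
proof -
  have cont: "continuous_on {0..T} Y" using sol by (simp add: multiterm_solution_def)
  have ex: "\<exists>D. (\<forall>j\<in>{1..Q}. has_caputo_derivative T (\<alpha> j) Y (D j) t) \<and> (\<Sum>j=1..Q. \<nu> j * D j) = - Y t" if "t \<in> {0<..T}" for t
    using sol that by (simp add: multiterm_solution_def)
  have "\<exists>v. v absolutely_integrable_on {0..T} \<and> (\<forall>s\<in>{0<..<T}. (Y has_real_derivative v s) (at s))"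
  proof (cases "\<exists>j\<in>{1..Q}. \<alpha> j < 1")
    case True
    then obtain j where j: "j \<in> {1..Q}" "\<alpha> j < 1" by blast
    obtain D where "\<forall>j\<in>{1..Q}. has_caputo_derivative T (\<alpha> j) Y (D j) T" using ex[of T] T by auto
    then have "has_caputo_derivative T (\<alpha> j) Y (D j) T" using j(1) by (rule bspec)
    then obtain v where v: "\<forall>s\<in>{0<..<T}. (Y has_real_derivative v s) (at s)"
        "(\<lambda>s. (T - s) powr (- \<alpha> j) * v s) absolutely_integrable_on {0..T}"
      using j by (auto simp: has_caputo_derivative_def)
    have "(\<lambda>s. (T - s) powr (\<alpha> j) * ((T - s) powr (- \<alpha> j) * v s)) absolutely_integrable_on {0..T}"
    proof (rule absolutely_integrable_bounded_measurable_product_real)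
      have "continuous_on {0..T} (\<lambda>s. (T - s) powr (\<alpha> j))"
        using a[OF j(1)] by (intro continuous_on_powr' continuous_intros) auto
      then show "(\<lambda>s. (T - s) powr (\<alpha> j)) \<in> borel_measurable (lebesgue_on {0..T})" "bounded ((\<lambda>s. (T - s) powr (\<alpha> j)) ` {0..T})"
        by (auto intro!: absolutely_integrable_imp_measurable_Icc absolutely_integrable_continuous_real compact_imp_bounded compact_continuous_image)
    qed (use v(2) in auto)
    then have "v absolutely_integrable_on {0..T}"
    proof (rule absolutely_integrable_spike[of _ _ "{T}"])
      fix s assume "s \<in> {0..T} - {T}"
      then have "(T - s) powr (\<alpha> j) * (T - s) powr (- \<alpha> j) = 1" by (simp flip: powr_add)
      then show "v s = (T - s) powr (\<alpha> j) * ((T - s) powr (- \<alpha> j) * v s)" by (simp flip: mult.assoc)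
    qed simp
    with v(1) show ?thesis by (intro exI[of _ v] conjI)
  next
    case False
    with a have a1: "\<alpha> j = 1" if "j \<in> {1..Q}" for j using that by (meson linorder_not_le order_antisym)
    define v where "v = (\<lambda>t. - Y t / (\<Sum>j=1..Q. \<nu> j))"
    have "(Y has_real_derivative v s) (at s)" if s: "s \<in> {0<..<T}" for s
    proof -
      obtain D where D: "\<forall>j\<in>{1..Q}. has_caputo_derivative T (\<alpha> j) Y (D j) s" "(\<Sum>j=1..Q. \<nu> j * D j) = - Y s"
        using ex[of s] s by auto
      have w: "at s within {0..T} = at s" using s by (intro at_within_interior) simp
      have "Q \<noteq> 0" using \<nu> by (intro notI) simp
      then have q1: "1 \<in> {1..Q}" by simp
      have d: "(Y has_real_derivative D j) (at s)" if "j \<in> {1..Q}" for j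
        using D(1)[rule_format, OF that] a1[OF that] by (simp add: has_caputo_derivative_def w)
      have "D j = D 1" if "j \<in> {1..Q}" for j using DERIV_unique[OF d[OF that] d[OF q1]] .
      then have "(\<Sum>j=1..Q. \<nu> j * D j) = (\<Sum>j=1..Q. \<nu> j * D 1)" by (intro sum.cong refl arg_cong2[where f = "(*)"])
      also have "\<dots> = (\<Sum>j=1..Q. \<nu> j) * D 1" by (simp only: sum_distrib_right)
      finally have "D 1 = v s" using D(2) \<nu> by (simp add: v_def field_simps)
      with d[OF q1] show ?thesis by simp
    qed
    moreover have "v absolutely_integrable_on {0..T}"
      unfolding v_def using \<nu> by (intro absolutely_integrable_continuous_real continuous_intros cont) auto
    ultimately show ?thesis by (intro exI[of _ v] conjI ballI)
  qed
  then obtain v where v': "v absolutely_integrable_on {0..T} \<and> (\<forall>s\<in>{0<..<T}. (Y has_real_derivative v s) (at s))"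
    by (rule exE)
  note v = v'[THEN conjunct1] v'[THEN conjunct2, rule_format]
  have "(\<Sum>j=1..Q. \<nu> j * frac_int (1 - \<alpha> j) v t) = - Y t" if t: "t \<in> {0<..<T}" for t
  proof -
    obtain D where D: "\<forall>j\<in>{1..Q}. has_caputo_derivative T (\<alpha> j) Y (D j) t" "(\<Sum>j=1..Q. \<nu> j * D j) = - Y t"
      using ex[of t] t by auto
    have "D j = frac_int (1 - \<alpha> j) v t" if "j \<in> {1..Q}" for j
      by (rule Caputo_derivative_as_frac_int[OF D(1)[rule_format, OF that] a[OF that, THEN conjunct1] a[OF that, THEN conjunct2] t v(2)])
    then have "(\<Sum>j=1..Q. \<nu> j * frac_int (1 - \<alpha> j) v t) = (\<Sum>j=1..Q. \<nu> j * D j)" by (intro sum.cong refl) simp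
    also note D(2)
    finally show ?thesis .
  qed
  then have "\<forall>t\<in>{0<..<T}. (\<Sum>j=1..Q. \<nu> j * frac_int (1 - \<alpha> j) v t) = - Y t" by (rule ballI)
  then show ?thesis
    by (intro exI[of _ v] conjI[OF v'[THEN conjunct1] conjI[OF v'[THEN conjunct2]]])
qed

text \<open>Integrate the equation to the largest order \<open>\<alpha> 1\<close>: by the semigroup law
\<open>I^(\<alpha> 1) I^(1 - \<alpha> j) v = I^(\<alpha> 1 - \<alpha> j) I^1 v\<close>, and \<open>I^1 v = Y - Y0\<close>.\<close>
lemma multiterm_Volterra_equation:
  fixes \<nu> \<alpha> :: "nat \<Rightarrow> real"
  assumes T: "T > 0" and \<nu>: "(\<Sum>j=1..Q. \<nu> j) > 0"
    and a: "\<And>j. j \<in> {1..Q} \<Longrightarrow> 0 < \<alpha> j \<and> \<alpha> j \<le> \<alpha> 1 \<and> \<alpha> 1 \<le> 1"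
    and sol: "multiterm_solution T Q \<nu> \<alpha> Y0 Y" and t: "t \<in> {0<..T}"
  shows "(\<Sum>j=1..Q. \<nu> j * frac_int (\<alpha> 1 - \<alpha> j) (\<lambda>s. Y s - Y0) t) = - frac_int (\<alpha> 1) Y t"
proof -
  have cont: "continuous_on {0..T} Y" and Y0: "Y 0 = Y0" using sol by (auto simp: multiterm_solution_def)
  have "0 < \<alpha> j \<and> \<alpha> j \<le> 1" if "j \<in> {1..Q}" for j using a[OF that] by simp
  from multiterm_solution_derivative[OF T \<nu> this sol]
  obtain v where v': "v absolutely_integrable_on {0..T} \<and> (\<forall>s\<in>{0<..<T}. (Y has_real_derivative v s) (at s))
     \<and> (\<forall>t\<in>{0<..<T}. (\<Sum>j=1..Q. \<nu> j * frac_int (1 - \<alpha> j) v t) = - Y t)" by (rule exE)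
  note v = v'[THEN conjunct1] v'[THEN conjunct2, THEN conjunct1, rule_format] v'[THEN conjunct2, THEN conjunct2, rule_format]
  have Q: "1 \<in> {1..Q}" using \<nu> by (cases Q) auto
  have a1: "0 < \<alpha> 1" using a[OF Q] by simp
  define U where "U = (\<lambda>s. Y s - Y0)"
  have U: "frac_int 1 v s = U s" if s: "s \<in> {0<..T}" for s
  proof -
    have "(v has_integral (Y s - Y 0)) {0..s}"
    proof (rule fundamental_theorem_of_calculus_interior)
      show "continuous_on {0..s} Y" by (rule continuous_on_subset[OF cont]) (use s in auto)
      show "(Y has_vector_derivative v x) (at x)" if "x \<in> {0<..<s}" for x
        using v(2)[of x] that s by (simp add: has_real_derivative_iff_has_vector_derivative)
    qed (use s in auto)
    then show ?thesis unfolding frac_int_1 U_def Y0[symmetric] by (rule integral_unique)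
  qed
  have vt: "v absolutely_integrable_on {0..t}" using v(1) t by (intro absolutely_integrable_initial[OF v(1)]) auto
  have J: "frac_int (\<alpha> 1) (frac_int (1 - \<alpha> j) v) t = frac_int (\<alpha> 1 - \<alpha> j) U t" "frac_integrable (\<alpha> 1) (frac_int (1 - \<alpha> j) v) t"
    if j: "j \<in> {1..Q}" for j
  proof -
    have 1: "frac_integrable (\<alpha> 1 + (1 - \<alpha> j)) v t" using a[OF j] t by (intro frac_integrable_L1 vt) auto
    show "frac_integrable (\<alpha> 1) (frac_int (1 - \<alpha> j) v) t"
      using a[OF j] t 1 by (intro frac_int_semigroup(2)) auto
    have "frac_int (\<alpha> 1) (frac_int (1 - \<alpha> j) v) t = frac_int (\<alpha> 1 + (1 - \<alpha> j)) v t"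
      using a[OF j] t 1 by (intro frac_int_semigroup(1)) auto
    also have "\<alpha> 1 + (1 - \<alpha> j) = (\<alpha> 1 - \<alpha> j) + 1" by simp
    also have "frac_int ((\<alpha> 1 - \<alpha> j) + 1) v t = frac_int (\<alpha> 1 - \<alpha> j) (frac_int 1 v) t"
      using a[OF j] t 1 by (intro frac_int_semigroup(1)[symmetric]) (auto simp: algebra_simps)
    also have "\<dots> = frac_int (\<alpha> 1 - \<alpha> j) U t"
      using t U by (intro frac_int_cong) auto
    finally show "frac_int (\<alpha> 1) (frac_int (1 - \<alpha> j) v) t = frac_int (\<alpha> 1 - \<alpha> j) U t" .
  qed
  have "(\<Sum>j=1..Q. \<nu> j * frac_int (\<alpha> 1 - \<alpha> j) U t) = (\<Sum>j=1..Q. frac_int (\<alpha> 1) (\<lambda>s. \<nu> j * frac_int (1 - \<alpha> j) v s) t)"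
    by (intro sum.cong refl) (simp only: J(1) frac_int_cmult)
  also have "\<dots> = frac_int (\<alpha> 1) (\<lambda>s. \<Sum>j=1..Q. \<nu> j * frac_int (1 - \<alpha> j) v s) t"
    using frac_int_sum[of "{1..Q}" "\<alpha> 1" "\<lambda>j s. \<nu> j * frac_int (1 - \<alpha> j) v s" t] J(2) frac_int_cmult(2) by simp
  also have "\<dots> = frac_int (\<alpha> 1) (\<lambda>s. (- 1) * Y s) t"
    using a1 v(3) t by (intro frac_int_cong_open) auto
  also have "\<dots> = - frac_int (\<alpha> 1) Y t" by (simp add: frac_int_cmult(1)[of _ "- 1", simplified])
  finally show ?thesis by (simp add: U_def)
qed

text \<open>The terms with \<open>\<alpha> j = \<alpha> 1\<close> are not integrated at all; they add up to \<open>N * (Y - Y0)\<close> with \<open>N > 0\<close>, and dividing by \<open>N\<close> leaves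
an equation of the second kind in which every integral has positive order. Index \<open>0\<close> stands for the right-hand
side of the equation; the orders of the terms collected in \<open>N\<close> get coefficient \<open>0\<close> and the dummy value \<open>1\<close>.\<close>
lemma multiterm_second_kind_equation:
  fixes \<nu> \<alpha> :: "nat \<Rightarrow> real"
  assumes T: "T > 0" and Q: "Q \<ge> 1" and \<nu>1: "\<nu> 1 > 0" and \<nu>: "\<And>j. j \<in> {1..Q} \<Longrightarrow> \<nu> j \<ge> 0"
    and a: "\<And>j. j \<in> {1..Q} \<Longrightarrow> 0 < \<alpha> j \<and> \<alpha> j \<le> \<alpha> 1 \<and> \<alpha> 1 \<le> 1"
    and sol: "multiterm_solution T Q \<nu> \<alpha> Y0 Y"
  shows "\<exists>d \<kappa> b. (\<forall>i\<in>{0..Q}. b i > 0) \<and> (\<forall>t\<in>{0<..T}. Y t - Y0 = d * t powr (\<alpha> 1) + (\<Sum>i=0..Q. \<kappa> i * frac_int (b i) (\<lambda>s. Y s - Y0) t))"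
proof -
  have cont: "continuous_on {0..T} Y" using sol by (auto simp: multiterm_solution_def)
  define U where "U = (\<lambda>s. Y s - Y0)"
  define N where "N = (\<Sum>j=1..Q. if \<alpha> j = \<alpha> 1 then \<nu> j else 0)"
  have "N \<ge> (if \<alpha> 1 = \<alpha> 1 then \<nu> 1 else 0)" unfolding N_def using Q \<nu> by (intro member_le_sum) auto
  then have N: "N > 0" using \<nu>1 by simp
  have "(\<Sum>j=1..Q. \<nu> j) \<ge> \<nu> 1" using Q \<nu> by (intro member_le_sum) auto
  then have \<nu>s: "(\<Sum>j=1..Q. \<nu> j) > 0" using \<nu>1 by simp
  have a1: "0 < \<alpha> 1" "\<alpha> 1 \<le> 1" using a[of 1] Q by auto
  define b where "b = (\<lambda>i. if i = 0 then \<alpha> 1 else if \<alpha> i = \<alpha> 1 then 1 else \<alpha> 1 - \<alpha> i)"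
  define \<kappa> where "\<kappa> = (\<lambda>i. if i = 0 then - 1 / N else if \<alpha> i = \<alpha> 1 then 0 else - \<nu> i / N)"
  define d where "d = - Y0 / (N * Gamma (\<alpha> 1 + 1))"
  have bpos: "b i > 0" if "i \<in> {0..Q}" for i
  proof (cases "i = 0 \<or> \<alpha> i = \<alpha> 1")
    case True then show ?thesis using a1 by (auto simp: b_def)
  next
    case False
    then have "i \<in> {1..Q}" using that by auto
    then have "\<alpha> i \<le> \<alpha> 1" using a by blast
    then have "\<alpha> i < \<alpha> 1" using False by simp
    then show ?thesis using False by (simp add: b_def)
  qed
  have "U t = d * t powr (\<alpha> 1) + (\<Sum>i=0..Q. \<kappa> i * frac_int (b i) U t)" if t: "t \<in> {0<..T}" for t
  proof -
    have ct: "continuous_on {0..t} Y" using cont t by (intro continuous_on_subset[OF cont]) auto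
    have "frac_int (\<alpha> 1) Y t = frac_int (\<alpha> 1) (\<lambda>s. U s + Y0 * s powr 0) t"
      using t a1 by (intro frac_int_cong_open) (auto simp: U_def)
    also have "\<dots> = frac_int (\<alpha> 1) U t + frac_int (\<alpha> 1) (\<lambda>s. Y0 * s powr 0) t"
    proof (rule frac_int_add(1))
      show "frac_integrable (\<alpha> 1) U t" unfolding U_def using a1 t by (intro frac_integrable_continuous continuous_intros ct) auto
      show "frac_integrable (\<alpha> 1) (\<lambda>s. Y0 * s powr 0) t" using a1 t by (intro frac_int_cmult(2) frac_int_power(2)) auto
    qed
    also have "frac_int (\<alpha> 1) (\<lambda>s. Y0 * s powr 0) t = Y0 / Gamma (\<alpha> 1 + 1) * t powr (\<alpha> 1)"
      using frac_int_power(1)[of "\<alpha> 1" 0 t] a1 t by (simp add: frac_int_cmult add.commute)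
    finally have F: "frac_int (\<alpha> 1) Y t = frac_int (\<alpha> 1) U t + Y0 / Gamma (\<alpha> 1 + 1) * t powr (\<alpha> 1)" .
    have "(\<Sum>j=1..Q. \<nu> j * frac_int (\<alpha> 1 - \<alpha> j) U t) = - frac_int (\<alpha> 1) Y t"
      unfolding U_def by (rule multiterm_Volterra_equation[OF T \<nu>s a sol t])
    moreover have "\<nu> j * frac_int (\<alpha> 1 - \<alpha> j) U t = (if \<alpha> j = \<alpha> 1 then \<nu> j else 0) * U t - N * (\<kappa> j * frac_int (b j) U t)" if "j \<in> {1..Q}" for j
    proof (cases "\<alpha> j = \<alpha> 1")
      case True
      then have "\<kappa> j = 0" using that by (simp add: \<kappa>_def)
      then show ?thesis using True by simp
    next
      case False
      then have "\<kappa> j = - \<nu> j / N" "b j = \<alpha> 1 - \<alpha> j" using that by (simp_all add: \<kappa>_def b_def)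
      then show ?thesis using False N by simp
    qed
    then have "(\<Sum>j=1..Q. \<nu> j * frac_int (\<alpha> 1 - \<alpha> j) U t) = (\<Sum>j=1..Q. (if \<alpha> j = \<alpha> 1 then \<nu> j else 0) * U t - N * (\<kappa> j * frac_int (b j) U t))"
      by (intro sum.cong refl)
    then have "(\<Sum>j=1..Q. \<nu> j * frac_int (\<alpha> 1 - \<alpha> j) U t) = N * U t - N * (\<Sum>j=1..Q. \<kappa> j * frac_int (b j) U t)"
      by (simp only: sum_subtractf sum_distrib_right[symmetric] sum_distrib_left[symmetric] N_def[symmetric])
    ultimately have "N * U t = N * (\<Sum>j=1..Q. \<kappa> j * frac_int (b j) U t) - frac_int (\<alpha> 1) U t - Y0 / Gamma (\<alpha> 1 + 1) * t powr (\<alpha> 1)"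
      unfolding F by simp
    then have "U t = (\<Sum>j=1..Q. \<kappa> j * frac_int (b j) U t) - frac_int (\<alpha> 1) U t / N - Y0 / Gamma (\<alpha> 1 + 1) * t powr (\<alpha> 1) / N"
    proof -
      assume e: "N * U t = N * (\<Sum>j=1..Q. \<kappa> j * frac_int (b j) U t) - frac_int (\<alpha> 1) U t - Y0 / Gamma (\<alpha> 1 + 1) * t powr (\<alpha> 1)"
      have "U t = (N * U t) / N" using N by simp
      then show ?thesis unfolding e diff_divide_distrib using N by simp
    qed
    moreover have "(\<Sum>i=0..Q. \<kappa> i * frac_int (b i) U t) = - frac_int (\<alpha> 1) U t / N + (\<Sum>j=1..Q. \<kappa> j * frac_int (b j) U t)"
    proof -
      have "(\<Sum>i=0..Q. \<kappa> i * frac_int (b i) U t) = \<kappa> 0 * frac_int (b 0) U t + (\<Sum>j=Suc 0..Q. \<kappa> j * frac_int (b j) U t)"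
        by (rule sum.atLeast_Suc_atMost) simp
      moreover have "\<kappa> 0 = - 1 / N" "b 0 = \<alpha> 1" by (simp_all add: \<kappa>_def b_def)
      ultimately show ?thesis by simp
    qed
    moreover have "d * t powr (\<alpha> 1) = - (Y0 / Gamma (\<alpha> 1 + 1) * t powr (\<alpha> 1) / N)" by (simp add: d_def)
    ultimately show ?thesis by linarith
  qed
  with bpos show ?thesis unfolding U_def by (intro exI[of _ d] exI[of _ \<kappa>] exI[of _ b] conjI ballI)
qed

text \<open>Finite sums of positive powers and of fractional integrals of \<open>U\<close> of order at least \<open>M\<close>: the shape that is preserved
when the equation for \<open>U\<close> is substituted into itself.\<close>
inductive frac_span :: "(real \<Rightarrow> real) \<Rightarrow> real \<Rightarrow> (real \<Rightarrow> real) \<Rightarrow> bool" for U M where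
  power: "p > 0 \<Longrightarrow> frac_span U M (\<lambda>t. d * t powr p)"
| integral: "\<gamma> \<ge> M \<Longrightarrow> \<gamma> \<ge> 0 \<Longrightarrow> frac_span U M (\<lambda>t. \<kappa> * frac_int \<gamma> U t)"
| add: "frac_span U M f \<Longrightarrow> frac_span U M g \<Longrightarrow> frac_span U M (\<lambda>t. f t + g t)"

lemma frac_span_sum:
  assumes "finite I" "\<And>i. i \<in> I \<Longrightarrow> frac_span U M (f i)"
  shows "frac_span U M (\<lambda>t. \<Sum>i\<in>I. f i t)"
  using assms
proof (induction I rule: finite_induct)
  case empty
  have "frac_span U M (\<lambda>t. 0 * t powr 1)" by (rule frac_span.power) simp
  then show ?case by simp
next
  case (insert i I)
  then have "frac_span U M (\<lambda>t. f i t + (\<Sum>i\<in>I. f i t))" by (intro frac_span.add) auto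
  then show ?case using insert.hyps by simp
qed

text \<open>Substituting the equation under an integral of order \<open>\<gamma>\<close> produces a power and integrals of order \<open>\<gamma> + b i\<close>, so
each round raises the least order by \<open>b0\<close>.\<close>
lemma frac_span_step:
  assumes f: "frac_span U M f" and M: "M \<ge> 0" and U: "continuous_on {0..T} U" and p: "p > 0"
    and b: "\<And>i. i \<in> {0..Q::nat} \<Longrightarrow> b i \<ge> b0" "b0 > 0"
    and eq: "\<And>t. t \<in> {0<..T} \<Longrightarrow> U t = d * t powr p + (\<Sum>i=0..Q. \<kappa> i * frac_int (b i) U t)"
  shows "\<exists>g. frac_span U (M + b0) g \<and> (\<forall>t\<in>{0<..T}. f t = g t)"
  using f
proof (induction rule: frac_span.induct)
  case (power p d)
  then show ?case using frac_span.power[of p U "M + b0" d] by blast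
next
  case (integral \<gamma> k)
  define e where "e = Gamma (p + 1) / Gamma (p + 1 + \<gamma>)"
  define g where "g = (\<lambda>t. (k * d * e) * t powr (p + \<gamma>) + (\<Sum>i=0..Q. (k * \<kappa> i) * frac_int (\<gamma> + b i) U t))"
  have "k * frac_int \<gamma> U t = g t" if t: "t \<in> {0<..T}" for t
  proof -
    have Ut: "continuous_on {0..t} U" using t by (intro continuous_on_subset[OF U]) auto
    have i1: "frac_integrable \<gamma> (\<lambda>s. d * s powr p) t" using integral t p by (intro frac_int_cmult(2) frac_int_power(2)) auto
    have sg: "frac_int \<gamma> (frac_int (b i) U) t = frac_int (\<gamma> + b i) U t" "frac_integrable \<gamma> (frac_int (b i) U) t" if "i \<in> {0..Q}" for i
    proof -
      have bi: "b i \<ge> 0" using b(1)[OF that] b(2) by simp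
      have t0: "t > 0" using t by simp
      have "frac_integrable (\<gamma> + b i) U t" using bi integral t0 by (intro frac_integrable_continuous Ut) auto
      then show "frac_int \<gamma> (frac_int (b i) U) t = frac_int (\<gamma> + b i) U t" "frac_integrable \<gamma> (frac_int (b i) U) t"
        by (rule frac_int_semigroup[OF integral(2) bi t0])+
    qed
    have i2: "frac_int \<gamma> (\<lambda>s. \<Sum>i=0..Q. \<kappa> i * frac_int (b i) U s) t = (\<Sum>i=0..Q. frac_int \<gamma> (\<lambda>s. \<kappa> i * frac_int (b i) U s) t) \<and> frac_integrable \<gamma> (\<lambda>s. \<Sum>i=0..Q. \<kappa> i * frac_int (b i) U s) t"
      using sg(2) by (intro frac_int_sum frac_int_cmult(2)) auto
    have "frac_int \<gamma> U t = frac_int \<gamma> (\<lambda>s. d * s powr p + (\<Sum>i=0..Q. \<kappa> i * frac_int (b i) U s)) t"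
      using t eq by (intro frac_int_cong) auto
    also have "\<dots> = frac_int \<gamma> (\<lambda>s. d * s powr p) t + frac_int \<gamma> (\<lambda>s. \<Sum>i=0..Q. \<kappa> i * frac_int (b i) U s) t"
      using i1 i2 by (intro frac_int_add) auto
    also have "frac_int \<gamma> (\<lambda>s. d * s powr p) t = d * (e * t powr (p + \<gamma>))"
      using integral t p by (simp add: frac_int_cmult frac_int_power e_def)
    also have "frac_int \<gamma> (\<lambda>s. \<Sum>i=0..Q. \<kappa> i * frac_int (b i) U s) t = (\<Sum>i=0..Q. \<kappa> i * frac_int (\<gamma> + b i) U t)"
      using i2 sg(1) by (simp add: frac_int_cmult)
    finally show ?thesis by (simp add: g_def sum_distrib_left algebra_simps)
  qed
  moreover have "frac_span U (M + b0) g" unfolding g_def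
  proof (intro frac_span.add frac_span.power frac_span_sum frac_span.integral)
    fix i assume "i \<in> {0..Q}"
    then show "\<gamma> + b i \<ge> M + b0" "\<gamma> + b i \<ge> 0" using integral b(1)[of i] b(2) by auto
  qed (use p integral in auto)
  ultimately show ?case by blast
next
  case (add f g)
  then obtain f' g' where "frac_span U (M + b0) f'" "\<forall>t\<in>{0<..T}. f t = f' t" "frac_span U (M + b0) g'" "\<forall>t\<in>{0<..T}. g t = g' t" by blast
  then show ?case by (intro exI[of _ "\<lambda>t. f' t + g' t"]) (auto intro: frac_span.add)
qed

text \<open>Of every integral of order \<open>\<gamma> \<ge> 4\<close> the part \<open>I^(\<gamma> - 4) U\<close> is bounded, because \<open>U\<close> is continuous on a compact interval;
what remains is \<open>I^4\<close>.\<close>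
lemma frac_span_decompose:
  assumes f: "frac_span U 4 f" and U: "continuous_on {0..T} U" and T: "T > 0"
  shows "\<exists>S d V B. finite S \<and> (\<forall>p\<in>S. p > 0) \<and> V absolutely_integrable_on {0..T} \<and> (\<forall>t\<in>{0..T}. \<bar>V t\<bar> \<le> B)
      \<and> (\<forall>t\<in>{0<..T}. f t = (\<Sum>p\<in>S. d p * t powr p) + frac_int 4 V t)"
  using f
proof (induction rule: frac_span.induct)
  case (power p d)
  show ?case
    by (rule exI[of _ "{p}"], rule exI[of _ "\<lambda>_. d"], rule exI[of _ "\<lambda>_. 0"], rule exI[of _ 0])
       (use power in \<open>auto simp: frac_int_def intro: absolutely_integrable_continuous_real\<close>)
next
  case (integral \<gamma> \<kappa>)
  define V where "V = (\<lambda>t. \<kappa> * frac_int (\<gamma> - 4) U t)"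
  have g: "\<gamma> - 4 \<ge> 0" using integral by simp
  have ci: "frac_integrable c U t" if "c \<ge> 0" "t \<in> {0<..T}" for c t
    using that by (intro frac_integrable_continuous continuous_on_subset[OF U]) auto
  have sg: "frac_int 4 (frac_int (\<gamma> - 4) U) t = frac_int \<gamma> U t" if t: "t \<in> {0<..T}" for t
    using frac_int_semigroup(1)[of 4 "\<gamma> - 4" t U] g t ci[of \<gamma> t] integral by simp
  have "frac_integrable 1 (frac_int (\<gamma> - 4) U) T"
    using frac_int_semigroup(2)[of 1 "\<gamma> - 4" T U] g T ci[of "1 + (\<gamma> - 4)" T] by simp
  then have V1: "V absolutely_integrable_on {0..T}"
    unfolding V_def frac_integrable_1_iff by (intro set_integrable_mult_right) auto
  have "bounded (U ` {0..T})" using U by (intro compact_imp_bounded compact_continuous_image) auto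
  then obtain BU where BU: "\<forall>s\<in>{0..T}. \<bar>U s\<bar> \<le> BU" by (auto simp: bounded_iff)
  have "\<bar>U 0\<bar> \<le> BU" using BU T by simp
  then have BU0: "BU \<ge> 0" by linarith
  have G: "Gamma (\<gamma> - 4 + 1) > 0" using g by (intro Gamma_real_pos) auto
  define B where "B = \<bar>\<kappa>\<bar> * (BU + BU * T powr (\<gamma> - 4) / Gamma (\<gamma> - 4 + 1))"
  have "\<bar>frac_int (\<gamma> - 4) U t\<bar> \<le> BU + BU * T powr (\<gamma> - 4) / Gamma (\<gamma> - 4 + 1)" if t: "t \<in> {0..T}" for t
  proof (cases "t = 0")
    case True
    have "\<bar>frac_int (\<gamma> - 4) U t\<bar> \<le> BU" using True BU BU0 T by (auto simp: frac_int_def)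
    moreover have "0 \<le> BU * T powr (\<gamma> - 4) / Gamma (\<gamma> - 4 + 1)" using BU0 G by simp
    ultimately show ?thesis by linarith
  next
    case False
    with t have t: "t \<in> {0<..T}" by auto
    have "\<bar>frac_int (\<gamma> - 4) U t\<bar> \<le> BU * t powr (\<gamma> - 4) / Gamma (\<gamma> - 4 + 1)"
      by (rule frac_int_bound) (use g t ci BU in auto)
    also have "\<dots> \<le> BU * T powr (\<gamma> - 4) / Gamma (\<gamma> - 4 + 1)"
      using BU0 G g t by (intro divide_right_mono mult_left_mono powr_mono2) auto
    finally show ?thesis using BU0 by linarith
  qed
  then have VB: "\<forall>t\<in>{0..T}. \<bar>V t\<bar> \<le> B" unfolding V_def B_def abs_mult by (intro ballI mult_left_mono) auto
  have "\<kappa> * frac_int \<gamma> U t = (\<Sum>p\<in>{}. (0::real) * t powr p) + frac_int 4 V t" if "t \<in> {0<..T}" for t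
    unfolding V_def by (simp add: frac_int_cmult sg[OF that])
  with V1 VB show ?case by (intro exI[of _ "{}"] exI[of _ "\<lambda>_. 0"] exI[of _ V] exI[of _ B]) auto
next
  case (add f g)
  then obtain S1 d1 V1 B1 S2 d2 V2 B2 where
    1: "finite S1" "\<forall>p\<in>S1. p > 0" "V1 absolutely_integrable_on {0..T}" "\<forall>t\<in>{0..T}. \<bar>V1 t\<bar> \<le> B1"
      "\<forall>t\<in>{0<..T}. f t = (\<Sum>p\<in>S1. d1 p * t powr p) + frac_int 4 V1 t" and
    2: "finite S2" "\<forall>p\<in>S2. p > 0" "V2 absolutely_integrable_on {0..T}" "\<forall>t\<in>{0..T}. \<bar>V2 t\<bar> \<le> B2"
      "\<forall>t\<in>{0<..T}. g t = (\<Sum>p\<in>S2. d2 p * t powr p) + frac_int 4 V2 t" by (elim exE conjE) (rule that)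
  define d where "d = (\<lambda>p. (if p \<in> S1 then d1 p else 0) + (if p \<in> S2 then d2 p else 0))"
  have s: "(\<Sum>p\<in>S1 \<union> S2. d p * t powr p) = (\<Sum>p\<in>S1. d1 p * t powr p) + (\<Sum>p\<in>S2. d2 p * t powr p)" for t
  proof -
    have "(\<Sum>p\<in>S1 \<union> S2. (if p \<in> S1 then d1 p else 0) * t powr p) = (\<Sum>p\<in>S1. d1 p * t powr p)"
      by (rule sum.mono_neutral_cong_right) (use 1 2 in auto)
    moreover have "(\<Sum>p\<in>S1 \<union> S2. (if p \<in> S2 then d2 p else 0) * t powr p) = (\<Sum>p\<in>S2. d2 p * t powr p)"
      by (rule sum.mono_neutral_cong_right) (use 1 2 in auto)
    ultimately show ?thesis by (simp add: d_def distrib_right sum.distrib)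
  qed
  have "f t + g t = (\<Sum>p\<in>S1 \<union> S2. d p * t powr p) + frac_int 4 (\<lambda>s. V1 s + V2 s) t" if t: "t \<in> {0<..T}" for t
  proof -
    have "frac_int 4 (\<lambda>s. V1 s + V2 s) t = frac_int 4 V1 t + frac_int 4 V2 t"
      by (rule frac_int_add(1); rule frac_integrable_L1) (use t absolutely_integrable_initial[OF 1(3)] absolutely_integrable_initial[OF 2(3)] in auto)
    then show ?thesis using 1(5) 2(5) t unfolding s by simp
  qed
  moreover have "(\<lambda>s. V1 s + V2 s) absolutely_integrable_on {0..T}" using set_integral_add(1)[OF 1(3) 2(3)] .
  moreover have "\<forall>t\<in>{0..T}. \<bar>V1 t + V2 t\<bar> \<le> B1 + B2" using 1(4) 2(4) by (meson abs_triangle_ineq add_mono order.trans)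
  moreover have "finite (S1 \<union> S2)" "\<forall>p\<in>S1 \<union> S2. p > 0" using 1 2 by auto
  ultimately show ?case
    by (intro exI[of _ "S1 \<union> S2"] exI[of _ d] exI[of _ "\<lambda>s. V1 s + V2 s"] exI[of _ "B1 + B2"]) blast
qed

text \<open>Order \<open>4\<close> is enough for second-order consistency, since the powers \<open>t powr p\<close> with \<open>p \<ge> 4\<close> are already as
harmless as the smooth part.\<close>
lemma multiterm_solution_decomposition:
  fixes \<nu> \<alpha> :: "nat \<Rightarrow> real"
  assumes T: "T > 0" and Q: "Q \<ge> 1" and \<nu>1: "\<nu> 1 > 0" and \<nu>: "\<And>j. j \<in> {1..Q} \<Longrightarrow> \<nu> j \<ge> 0"
    and a: "\<And>j. j \<in> {1..Q} \<Longrightarrow> 0 < \<alpha> j \<and> \<alpha> j \<le> \<alpha> 1 \<and> \<alpha> 1 \<le> 1"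
    and sol: "multiterm_solution T Q \<nu> \<alpha> Y0 Y"
  shows "\<exists>S d V B. finite S \<and> (\<forall>p\<in>S. p > 0) \<and> V absolutely_integrable_on {0..T} \<and> (\<forall>t\<in>{0..T}. \<bar>V t\<bar> \<le> B)
      \<and> (\<forall>t\<in>{0<..T}. Y t - Y0 = (\<Sum>p\<in>S. d p * t powr p) + frac_int 4 V t)"
proof -
  define U where "U = (\<lambda>s. Y s - Y0)"
  have U: "continuous_on {0..T} U" unfolding U_def using sol by (intro continuous_intros) (simp add: multiterm_solution_def)
  obtain d \<kappa> b where b: "\<And>i. i \<in> {0..Q} \<Longrightarrow> b i > 0" and
     eq: "\<And>t. t \<in> {0<..T} \<Longrightarrow> U t = d * t powr (\<alpha> 1) + (\<Sum>i=0..Q. \<kappa> i * frac_int (b i) U t)"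
    using multiterm_second_kind_equation[OF T Q \<nu>1 \<nu> a sol] unfolding U_def by blast
  define b0 where "b0 = Min (b ` {0..Q})"
  have b0: "b0 > 0" unfolding b0_def using b by (subst Min_gr_iff) auto
  have bi: "b i \<ge> b0" if "i \<in> {0..Q}" for i unfolding b0_def using that by (intro Min_le) auto
  have a1: "\<alpha> 1 > 0" using a[of 1] Q by auto
  have it: "\<exists>f. frac_span U (real n * b0) f \<and> (\<forall>t\<in>{0<..T}. U t = f t)" for n
  proof (induction n)
    case 0
    have "frac_span U 0 (\<lambda>t. 1 * frac_int 0 U t)" by (rule frac_span.integral) auto
    then show ?case by (intro exI[of _ "\<lambda>t. 1 * frac_int 0 U t"]) simp
  next
    case (Suc n)
    then obtain f where f: "frac_span U (real n * b0) f" "\<forall>t\<in>{0<..T}. U t = f t" by blast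
    have "\<exists>g. frac_span U (real n * b0 + b0) g \<and> (\<forall>t\<in>{0<..T}. f t = g t)"
      using b0 by (intro frac_span_step[OF f(1) _ U a1 bi b0 eq]) auto
    then show ?case using f(2) by (auto simp: algebra_simps)
  qed
  \<comment> \<open>Enough substitutions to raise the least order from \<open>0\<close> to \<open>4\<close>.\<close>
  obtain n where "real n * b0 \<ge> 4" using reals_Archimedean3[OF b0, THEN spec, of 4] by (auto intro: less_imp_le)
  with it[of n] obtain f where f: "frac_span U (real n * b0) f" "\<forall>t\<in>{0<..T}. U t = f t" by blast
  have mono: "frac_span U M f \<Longrightarrow> 4 \<le> M \<Longrightarrow> frac_span U 4 f" for M f
    by (induction rule: frac_span.induct) (auto intro: frac_span.intros)
  have "frac_span U 4 f" using mono[OF f(1)] \<open>real n * b0 \<ge> 4\<close> by simp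
  from frac_span_decompose[OF this U T] show ?thesis using f(2) unfolding U_def by auto
qed

section \<open>Comparison with the given expansion\<close>

lemma Abel_partial_sum_bound:
  fixes a y :: "nat \<Rightarrow> real"
  assumes B: "\<And>n. \<bar>\<Sum>k<n. a k\<bar> \<le> B" and y: "\<And>k. y (Suc k) \<le> y k" "\<And>k. y k \<ge> 0"
  shows "\<bar>\<Sum>k<n. a k * y k\<bar> \<le> B * y 0"
proof -
  define A where "A = (\<lambda>n. \<Sum>k<n. a k)"
  have id: "(\<Sum>k<n. a k * y k) = (\<Sum>k<n. A (Suc k) * (y k - y (Suc k))) + A n * y n"
    by (induction n) (simp_all add: A_def algebra_simps)
  have "\<bar>\<Sum>k<n. A (Suc k) * (y k - y (Suc k))\<bar> \<le> (\<Sum>k<n. \<bar>A (Suc k) * (y k - y (Suc k))\<bar>)" by (rule sum_abs)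
  also have "\<dots> \<le> (\<Sum>k<n. B * (y k - y (Suc k)))"
  proof (rule sum_mono)
    fix k
    show "\<bar>A (Suc k) * (y k - y (Suc k))\<bar> \<le> B * (y k - y (Suc k))"
      unfolding abs_mult using B[of "Suc k"] y(1)[of k] by (auto simp: A_def intro!: mult_mono)
  qed
  also have "\<dots> = B * (y 0 - y n)" by (simp only: sum_distrib_left[symmetric] sum_lessThan_telescope')
  finally have "\<bar>\<Sum>k<n. A (Suc k) * (y k - y (Suc k))\<bar> \<le> B * (y 0 - y n)" .
  moreover have "\<bar>A n * y n\<bar> \<le> B * y n"
    unfolding abs_mult using B[of n] y(2)[of n] by (auto simp: A_def intro!: mult_right_mono)
  ultimately show ?thesis unfolding id by (simp add: right_diff_distrib)
qed

text \<open>The series is only assumed to converge at each point, possibly not absolutely at \<open>T\<close>. For \<open>t < T\<close> its terms are those at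
\<open>T\<close> times \<open>(t / T) powr \<sigma> k\<close>, which decrease in \<open>k\<close>, so Abel summation bounds the tail by its first factor.\<close>
lemma expansion_remainder_bound:
  fixes c \<sigma> :: "nat \<Rightarrow> real"
  assumes T: "T > 0" and \<sigma>: "\<And>k. k \<ge> 1 \<Longrightarrow> 0 < \<sigma> k \<and> \<sigma> k < \<sigma> (k + 1)"
    and Y: "\<And>t. t \<in> {0..T} \<Longrightarrow> (\<lambda>k. c (k + 1) * t powr \<sigma> (k + 1)) sums (Y t - Y 0)"
  shows "\<exists>C\<ge>0. \<forall>t\<in>{0<..T}. \<bar>Y t - Y 0 - (\<Sum>k=1..m. c k * t powr \<sigma> k)\<bar> \<le> C * t powr \<sigma> (m + 1)"
proof -
  define a where "a = (\<lambda>k. c (k + m + 1) * T powr \<sigma> (k + m + 1))"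
  have shift: "(\<lambda>k. c (k + m + 1) * t powr \<sigma> (k + m + 1)) sums (Y t - Y 0 - (\<Sum>k=1..m. c k * t powr \<sigma> k))" if "t \<in> {0..T}" for t
    using sums_split_initial_segment[OF Y[OF that], of m] by (simp add: sum.atLeast1_atMost_eq)
  have "convergent (\<lambda>n. \<Sum>k<n. a k)"
    using shift[of T] T unfolding a_def sums_def by (intro convergentI) auto
  then have "Bseq (\<lambda>n. \<Sum>k<n. a k)" by (rule convergent_imp_Bseq)
  then obtain B where B: "B > 0" "\<And>n. norm (\<Sum>k<n. a k) \<le> B" by (auto elim: BseqE)
  have "\<bar>Y t - Y 0 - (\<Sum>k=1..m. c k * t powr \<sigma> k)\<bar> \<le> B * T powr (- \<sigma> (m + 1)) * t powr \<sigma> (m + 1)" if t: "t \<in> {0<..T}" for t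
  proof -
    define x where "x = t / T"
    have x: "0 < x" "x \<le> 1" "t = T * x" using t T by (auto simp: x_def)
    define y where "y = (\<lambda>k. x powr \<sigma> (k + m + 1))"
    have y: "y (Suc k) \<le> y k" "y k \<ge> 0" for k
    proof -
      have "\<sigma> (k + m + 1) \<le> \<sigma> (Suc k + m + 1)" using \<sigma>[of "k + m + 1"] by simp
      then show "y (Suc k) \<le> y k" unfolding y_def using x by (intro powr_mono') auto
    qed (simp add: y_def)
    have "(\<lambda>k. a k * y k) sums (Y t - Y 0 - (\<Sum>k=1..m. c k * t powr \<sigma> k))"
    proof -
      have "a k * y k = c (k + m + 1) * t powr \<sigma> (k + m + 1)" for k
        unfolding a_def y_def x(3) using T x by (simp add: powr_mult)
      then show ?thesis using shift[of t] t by simp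
    qed
    then have lim: "(\<lambda>n. \<bar>\<Sum>k<n. a k * y k\<bar>) \<longlonglongrightarrow> \<bar>Y t - Y 0 - (\<Sum>k=1..m. c k * t powr \<sigma> k)\<bar>"
      unfolding sums_def by (rule tendsto_rabs)
    have "\<bar>\<Sum>k<n. a k * y k\<bar> \<le> B * y 0" for n
      by (rule Abel_partial_sum_bound) (use B(2) y in auto)
    then have "\<bar>Y t - Y 0 - (\<Sum>k=1..m. c k * t powr \<sigma> k)\<bar> \<le> B * y 0"
      by (intro LIMSEQ_le_const2[OF lim]) auto
    also have "y 0 = T powr (- \<sigma> (m + 1)) * t powr \<sigma> (m + 1)"
      unfolding y_def x_def using T t by (simp add: powr_divide powr_minus field_simps)
    finally show ?thesis by (simp add: mult.assoc)
  qed
  then show ?thesis using B(1) by (intro exI[of _ "B * T powr (- \<sigma> (m + 1))"]) auto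
qed

text \<open>Divide by the power with the smallest exponent that has a nonzero coefficient and let \<open>t\<close> tend to \<open>0\<close>.\<close>
lemma power_sum_coeffs_vanish:
  fixes d :: "real \<Rightarrow> real"
  assumes S: "finite S" and T: "T > 0"
    and bound: "\<And>t. t \<in> {0<..T} \<Longrightarrow> \<bar>\<Sum>p\<in>S. d p * t powr p\<bar> \<le> C * t powr M"
  shows "\<forall>p\<in>S. p < M \<longrightarrow> d p = 0"
proof (rule ccontr)
  assume "\<not> ?thesis"
  then obtain p1 where p1: "p1 \<in> S" "p1 < M" "d p1 \<noteq> 0" by blast
  define R where "R = {p \<in> S. d p \<noteq> 0}"
  have R: "finite R" "R \<noteq> {}" "p1 \<in> R" using S p1 by (auto simp: R_def)
  define q where "q = Min R"
  have qR: "q \<in> R" unfolding q_def using R by (intro Min_in) auto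
  have q: "q \<in> S" "d q \<noteq> 0" "q < M" "\<And>p. p \<in> S \<Longrightarrow> d p \<noteq> 0 \<Longrightarrow> q \<le> p"
  proof -
    show "q \<in> S" "d q \<noteq> 0" using qR by (auto simp: R_def)
    have "q \<le> p1" unfolding q_def using R by (intro Min_le) auto
    then show "q < M" using p1 by simp
    show "q \<le> p" if "p \<in> S" "d p \<noteq> 0" for p unfolding q_def using R that by (intro Min_le) (auto simp: R_def)
  qed
  have pw: "((\<lambda>t::real. t powr b) \<longlongrightarrow> 0) (at_right 0)" if "b > 0" for b
  proof (rule tendsto_zero_powrI[OF _ tendsto_const _ that])
    show "((\<lambda>t::real. t) \<longlongrightarrow> 0) (at_right 0)" by (intro tendsto_ident_at)
    show "\<forall>\<^sub>F t::real in at_right 0. 0 \<le> t" by (auto simp: eventually_at_right_less intro: eventually_mono[OF eventually_at_right_less])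
  qed
  have "((\<lambda>t. \<Sum>p\<in>S. d p * t powr (p - q)) \<longlongrightarrow> (\<Sum>p\<in>S. if p = q then d q else 0)) (at_right 0)"
  proof (rule tendsto_sum)
    fix p assume p: "p \<in> S"
    show "((\<lambda>t. d p * t powr (p - q)) \<longlongrightarrow> (if p = q then d q else 0)) (at_right 0)"
    proof (cases "p = q")
      case True
      have "\<forall>\<^sub>F t in at_right (0::real). d p * t powr (p - q) = d q"
        using eventually_at_right_less[of "0::real"] by eventually_elim (simp add: True)
      then show ?thesis using True by (simp add: tendsto_eventually)
    next
      case False
      show ?thesis
      proof (cases "d p = 0")
        case True then show ?thesis using False by simp
      next
        case dp: False
        have "p - q > 0" using q(4)[OF p dp] False by simp
        from tendsto_mult[OF tendsto_const pw[OF this], of "d p"] show ?thesis using False by simp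
      qed
    qed
  qed
  then have lim: "((\<lambda>t. \<bar>\<Sum>p\<in>S. d p * t powr (p - q)\<bar>) \<longlongrightarrow> \<bar>d q\<bar>) (at_right 0)"
    using S q(1) by (intro tendsto_rabs) (simp add: sum.delta)
  have lim2: "((\<lambda>t. C * t powr (M - q)) \<longlongrightarrow> 0) (at_right 0)"
    using tendsto_mult[OF tendsto_const pw[of "M - q"], of C] q(3) by simp
  have "\<forall>\<^sub>F t in at_right 0. \<bar>\<Sum>p\<in>S. d p * t powr (p - q)\<bar> \<le> C * t powr (M - q)"
  proof -
    have "\<forall>\<^sub>F t in at_right 0. t \<in> {0<..<T}" using T by (rule eventually_at_right_real)
    then show ?thesis
    proof eventually_elim
      case (elim t)
      have "(\<Sum>p\<in>S. d p * t powr (p - q)) = (\<Sum>p\<in>S. d p * t powr p) * t powr (- q)"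
        unfolding sum_distrib_right by (simp only: mult.assoc powr_add[symmetric] add_uminus_conv_diff)
      then have "\<bar>\<Sum>p\<in>S. d p * t powr (p - q)\<bar> = \<bar>\<Sum>p\<in>S. d p * t powr p\<bar> * t powr (- q)" by (simp add: abs_mult)
      also have "\<dots> \<le> C * t powr M * t powr (- q)" using bound[of t] elim by (intro mult_right_mono) auto
      also have "\<dots> = C * t powr (M - q)" by (simp only: mult.assoc powr_add[symmetric] add_uminus_conv_diff)
      finally show ?case .
    qed
  qed
  then have "\<bar>d q\<bar> \<le> 0" by (intro tendsto_le[OF _ lim2 lim]) auto
  with q(2) show False by simp
qed

lemma frac_int_4_bound:
  assumes V: "V absolutely_integrable_on {0..T}" and B: "\<forall>s\<in>{0..T}. \<bar>V s\<bar> \<le> B" and t: "t \<in> {0<..T}"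
  shows "\<bar>frac_int 4 V t\<bar> \<le> B * t powr 4"
proof -
  have B0: "B \<ge> 0"
  proof -
    have "\<bar>V t\<bar> \<le> B" using B t by simp
    then show ?thesis by linarith
  qed
  have "frac_integrable 4 V t" by (rule frac_integrable_L1) (use t absolutely_integrable_initial[OF V] in auto)
  then have "\<bar>frac_int 4 V t\<bar> \<le> B * t powr 4 / Gamma (4 + 1)"
    by (intro frac_int_bound) (use t B in auto)
  also have "\<dots> \<le> B * t powr 4"
  proof -
    have "Gamma (4 + 1) = (24::real)" using Gamma_fact[of 4, where 'a = real] by (simp add: fact_numeral)
    then show ?thesis using B0 by simp
  qed
  finally show ?thesis .
qed

text \<open>Subtract the first \<open>m\<close> terms of the expansion from the decomposition. The remaining combination of powers is
\<open>O(t powr M)\<close> with \<open>M = min 4 (\<sigma> (m + 1))\<close>, since this holds for the tail of the expansion and for \<open>I^4 V\<close>;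
hence all powers below \<open>M\<close> have cancelled.\<close>
lemma decomposition_matches_expansion:
  fixes c \<sigma> :: "nat \<Rightarrow> real"
  assumes T: "T > 0" and \<sigma>: "\<And>k. k \<ge> 1 \<Longrightarrow> 0 < \<sigma> k \<and> \<sigma> k < \<sigma> (k + 1)"
    and Y: "\<And>t. t \<in> {0..T} \<Longrightarrow> (\<lambda>k. c (k + 1) * t powr \<sigma> (k + 1)) sums (Y t - Y 0)"
    and S: "finite S" "\<forall>p\<in>S. p > 0" and V: "V absolutely_integrable_on {0..T}" and B: "\<forall>t\<in>{0..T}. \<bar>V t\<bar> \<le> B"
    and dec: "\<forall>t\<in>{0<..T}. Y t - Y 0 = (\<Sum>p\<in>S. d p * t powr p) + frac_int 4 V t"
  shows "\<exists>S' d'. finite S' \<and> (\<forall>p\<in>S'. p \<ge> min 4 (\<sigma> (m + 1))) \<and>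
     (\<forall>t\<in>{0<..T}. Y t - Y 0 = (\<Sum>k=1..m. c k * t powr \<sigma> k) + (\<Sum>p\<in>S'. d' p * t powr p) + frac_int 4 V t)"
proof -
  define M where "M = min 4 (\<sigma> (m + 1))"
  define S2 where "S2 = S \<union> \<sigma> ` {1..m}"
  define d' where "d' = (\<lambda>p. (if p \<in> S then d p else 0) - (\<Sum>k=1..m. if \<sigma> k = p then c k else 0))"
  have S2: "finite S2" using S by (simp add: S2_def)
  have s: "(\<Sum>p\<in>S2. d' p * t powr p) = (\<Sum>p\<in>S. d p * t powr p) - (\<Sum>k=1..m. c k * t powr \<sigma> k)" for t
  proof -
    have "(\<Sum>p\<in>S2. (if p \<in> S then d p else 0) * t powr p) = (\<Sum>p\<in>S. d p * t powr p)"
      by (rule sum.mono_neutral_cong_right) (use S2 in \<open>auto simp: S2_def\<close>)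
    moreover have "(\<Sum>p\<in>S2. (\<Sum>k=1..m. if \<sigma> k = p then c k else 0) * t powr p) = (\<Sum>k=1..m. c k * t powr \<sigma> k)"
    proof -
      have "(\<Sum>p\<in>S2. (\<Sum>k=1..m. if \<sigma> k = p then c k else 0) * t powr p) = (\<Sum>p\<in>S2. \<Sum>k=1..m. if \<sigma> k = p then c k * t powr \<sigma> k else 0)"
        unfolding sum_distrib_right by (intro sum.cong refl) auto
      also have "\<dots> = (\<Sum>k=1..m. \<Sum>p\<in>S2. if \<sigma> k = p then c k * t powr \<sigma> k else 0)" by (rule sum.swap)
      also have "\<dots> = (\<Sum>k=1..m. c k * t powr \<sigma> k)"
        by (intro sum.cong refl) (use S2 in \<open>auto simp: sum.delta S2_def\<close>)
      finally show ?thesis .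
    qed
    ultimately show ?thesis by (simp add: d'_def left_diff_distrib sum_subtractf)
  qed
  have "\<exists>C\<ge>0. \<forall>t\<in>{0<..T}. \<bar>Y t - Y 0 - (\<Sum>k=1..m. c k * t powr \<sigma> k)\<bar> \<le> C * t powr \<sigma> (m + 1)"
    by (rule expansion_remainder_bound[OF T]) (rule \<sigma>, assumption, rule Y, assumption)
  then obtain C where C: "C \<ge> 0" "\<forall>t\<in>{0<..T}. \<bar>Y t - Y 0 - (\<Sum>k=1..m. c k * t powr \<sigma> k)\<bar> \<le> C * t powr \<sigma> (m + 1)"
    by (elim exE conjE) (rule that)
  have B0: "B \<ge> 0"
  proof -
    have "\<bar>V T\<bar> \<le> B" using B T by simp
    then show ?thesis by linarith
  qed
  have pwM: "t powr p \<le> T powr (p - M) * t powr M" if "t \<in> {0<..T}" "p \<ge> M" for t p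
  proof -
    have "t powr p = t powr (p - M) * t powr M" by (simp flip: powr_add)
    also have "\<dots> \<le> T powr (p - M) * t powr M" using that by (intro mult_right_mono powr_mono2) auto
    finally show ?thesis .
  qed
  have van: "\<forall>p\<in>S2. p < M \<longrightarrow> d' p = 0"
  proof (rule power_sum_coeffs_vanish[OF S2 T])
    fix t assume t: "t \<in> {0<..T}"
    have "(\<Sum>p\<in>S2. d' p * t powr p) = (Y t - Y 0 - (\<Sum>k=1..m. c k * t powr \<sigma> k)) - frac_int 4 V t"
      unfolding s using dec t by simp
    then have "\<bar>\<Sum>p\<in>S2. d' p * t powr p\<bar> \<le> \<bar>Y t - Y 0 - (\<Sum>k=1..m. c k * t powr \<sigma> k)\<bar> + \<bar>frac_int 4 V t\<bar>" by linarith
    also have "\<dots> \<le> C * t powr \<sigma> (m + 1) + B * t powr 4" using C(2) frac_int_4_bound[OF V B t] t by (intro add_mono) auto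
    also have "\<dots> \<le> C * (T powr (\<sigma> (m + 1) - M) * t powr M) + B * (T powr (4 - M) * t powr M)"
      by (intro add_mono mult_left_mono pwM[OF t] C(1) B0) (simp_all add: M_def)
    also have "\<dots> = (C * T powr (\<sigma> (m + 1) - M) + B * T powr (4 - M)) * t powr M" by (simp add: algebra_simps)
    finally show "\<bar>\<Sum>p\<in>S2. d' p * t powr p\<bar> \<le> (C * T powr (\<sigma> (m + 1) - M) + B * T powr (4 - M)) * t powr M" .
  qed
  define S' where "S' = {p \<in> S2. p \<ge> M}"
  have "Y t - Y 0 = (\<Sum>k=1..m. c k * t powr \<sigma> k) + (\<Sum>p\<in>S'. d' p * t powr p) + frac_int 4 V t" if t: "t \<in> {0<..T}" for t
  proof -
    have "(\<Sum>p\<in>S'. d' p * t powr p) = (\<Sum>p\<in>S2. d' p * t powr p)"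
      by (rule sum.mono_neutral_left) (use S2 van in \<open>auto simp: S'_def not_le\<close>)
    then show ?thesis unfolding s using dec t by simp
  qed
  then show ?thesis using S2 unfolding M_def[symmetric] by (intro exI[of _ S'] exI[of _ d']) (auto simp: S'_def)
qed

text \<open>Fourth order leaves enough room to stay within continuous functions: \<open>I^3 V\<close> is an indefinite integral
of the integrable \<open>I^2 V\<close>.\<close>
lemma frac_int_4_derivative:
  assumes T: "T > 0" and V: "V absolutely_integrable_on {0..T}" and t: "t \<in> {0<..T}"
  shows "(frac_int 4 V has_real_derivative frac_int 3 V t) (at t within {0..T})"
proof -
  have ii: "frac_int (c + 1) V s = integral {0..s} (frac_int c V)" if "c \<ge> 0" "s \<in> {0..T}" for c s
  proof (cases "s = 0")
    case True then show ?thesis using that by (simp add: frac_int_def)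
  next
    case False
    then have s: "s > 0" using that by simp
    have "frac_integrable (1 + c) V s"
      by (rule frac_integrable_L1) (use that s absolutely_integrable_initial[OF V] in auto)
    then have "frac_int 1 (frac_int c V) s = frac_int (1 + c) V s" by (intro frac_int_semigroup(1)) (use that s in auto)
    then show ?thesis by (simp add: frac_int_1 add.commute)
  qed
  have "frac_integrable 1 (frac_int 2 V) T"
    by (rule frac_int_semigroup(2); (rule frac_integrable_L1)?) (use T V in auto)
  then have i2: "frac_int 2 V integrable_on {0..T}"
    unfolding frac_integrable_1_iff by (rule set_lebesgue_integral_eq_integral(1))
  have "continuous_on {0..T} (\<lambda>s. integral {0..s} (frac_int 2 V))" by (rule indefinite_integral_continuous_1[OF i2])
  then have c3: "continuous_on {0..T} (frac_int 3 V)"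
    by (rule continuous_on_eq) (use ii[of 2] in auto)
  have "((\<lambda>s. integral {0..s} (frac_int 3 V)) has_real_derivative frac_int 3 V t) (at t within {0..T})"
    by (rule integral_has_real_derivative[OF c3]) (use t in auto)
  then show ?thesis
    by (rule has_field_derivative_transform_within[where d = 1]) (use ii[of 3] t in auto)
qed

text \<open>The value of a Caputo derivative is determined by any derivative of \<open>Y\<close> on the open interval, so it can be computed
termwise from the decomposition.\<close>
lemma Caputo_derivative_of_decomposition:
  fixes e p :: "'i \<Rightarrow> real"
  assumes T: "T > 0" and V: "V absolutely_integrable_on {0..T}" and I: "finite I" "\<And>i. i \<in> I \<Longrightarrow> p i > 0"
    and Y: "\<forall>t\<in>{0<..T}. Y t - Y0 = (\<Sum>i\<in>I. e i * t powr p i) + frac_int 4 V t"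
    and D: "has_caputo_derivative T \<alpha> Y D t" and a: "0 < \<alpha>" "\<alpha> \<le> 1" and t: "t \<in> {0<..T}"
  shows "D = (\<Sum>i\<in>I. e i * (Gamma (p i + 1) / Gamma (p i + 1 - \<alpha>) * t powr (p i - \<alpha>))) + frac_int (4 - \<alpha>) V t"
proof -
  define W where "W = (\<lambda>s. (\<Sum>i\<in>I. (e i * p i) * s powr (p i - 1)) + frac_int 3 V s)"
  have der: "(Y has_real_derivative W s) (at s within {0..T})" if s: "s \<in> {0<..T}" for s
  proof -
    have "((\<lambda>s. Y0 + ((\<Sum>i\<in>I. e i * s powr p i) + frac_int 4 V s)) has_real_derivative 0 + ((\<Sum>i\<in>I. e i * (p i * s powr (p i - 1))) + frac_int 3 V s)) (at s within {0..T})"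
      using s by (intro DERIV_add DERIV_const DERIV_sum DERIV_cmult has_field_derivative_at_within[OF has_real_derivative_powr] frac_int_4_derivative[OF T V]) auto
    then have d: "((\<lambda>s. Y0 + ((\<Sum>i\<in>I. e i * s powr p i) + frac_int 4 V s)) has_real_derivative W s) (at s within {0..T})"
      by (simp add: W_def mult.assoc)
    show ?thesis
    proof (rule has_field_derivative_transform_within[OF d])
      show "0 < s" "s \<in> {0..T}" using s by auto
      fix x assume "x \<in> {0..T}" "dist x s < s"
      then have "x \<in> {0<..T}" by (auto simp: dist_real_def)
      with Y show "Y0 + ((\<Sum>i\<in>I. e i * x powr p i) + frac_int 4 V x) = Y x" by (simp add: algebra_simps)
    qed
  qed
  have G: "p i * Gamma (p i) = Gamma (p i + 1)" if "i \<in> I" for i using Gamma_plus1_pos[OF I(2)[OF that]] by simp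
  have Vt: "V absolutely_integrable_on {0..t}" by (rule absolutely_integrable_initial[OF V]) (use t in auto)
  have t0: "t > 0" using t by simp
  have fi: "frac_int (1 - \<alpha>) W t = (\<Sum>i\<in>I. e i * (Gamma (p i + 1) / Gamma (p i + 1 - \<alpha>) * t powr (p i - \<alpha>))) + frac_int (4 - \<alpha>) V t"
  proof -
    have f3: "frac_integrable (1 - \<alpha> + 3) V t" by (rule frac_integrable_L1[OF _ t0 Vt]) (use a in auto)
    have sg: "frac_int (1 - \<alpha>) (frac_int 3 V) t = frac_int (1 - \<alpha> + 3) V t" "frac_integrable (1 - \<alpha>) (frac_int 3 V) t"
      by (rule frac_int_semigroup[OF _ _ t0 f3]; use a in simp)+
    have pi: "frac_integrable (1 - \<alpha>) (\<lambda>s. (e i * p i) * s powr (p i - 1)) t" if "i \<in> I" for i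
      by (intro frac_int_cmult(2) frac_int_power(2)) (use a t0 I(2)[OF that] in auto)
    have ps: "frac_int (1 - \<alpha>) (\<lambda>s. \<Sum>i\<in>I. (e i * p i) * s powr (p i - 1)) t = (\<Sum>i\<in>I. frac_int (1 - \<alpha>) (\<lambda>s. (e i * p i) * s powr (p i - 1)) t)
        \<and> frac_integrable (1 - \<alpha>) (\<lambda>s. \<Sum>i\<in>I. (e i * p i) * s powr (p i - 1)) t"
      by (rule frac_int_sum[OF I(1) pi])
    have "frac_int (1 - \<alpha>) W t = frac_int (1 - \<alpha>) (\<lambda>s. \<Sum>i\<in>I. (e i * p i) * s powr (p i - 1)) t + frac_int (1 - \<alpha>) (frac_int 3 V) t"
      unfolding W_def by (rule frac_int_add(1)[OF ps[THEN conjunct2] sg(2)])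
    also have "frac_int (1 - \<alpha>) (\<lambda>s. \<Sum>i\<in>I. (e i * p i) * s powr (p i - 1)) t = (\<Sum>i\<in>I. frac_int (1 - \<alpha>) (\<lambda>s. (e i * p i) * s powr (p i - 1)) t)"
      by (rule ps[THEN conjunct1])
    also have "\<dots> = (\<Sum>i\<in>I. e i * (Gamma (p i + 1) / Gamma (p i + 1 - \<alpha>) * t powr (p i - \<alpha>)))"
    proof (rule sum.cong[OF refl])
      fix i assume i: "i \<in> I"
      have "frac_int (1 - \<alpha>) (\<lambda>s. s powr (p i - 1)) t = Gamma (p i - 1 + 1) / Gamma (p i - 1 + 1 + (1 - \<alpha>)) * t powr (p i - 1 + (1 - \<alpha>))"
        by (rule frac_int_power(1)) (use a t0 I(2)[OF i] in auto)
      moreover have "p i - 1 + 1 = p i" "p i - 1 + (1 - \<alpha>) = p i - \<alpha>" "p i + (1 - \<alpha>) = p i + 1 - \<alpha>" by simp_all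
      ultimately have "frac_int (1 - \<alpha>) (\<lambda>s. s powr (p i - 1)) t = Gamma (p i) / Gamma (p i + 1 - \<alpha>) * t powr (p i - \<alpha>)"
        by (simp only:)
      then show "frac_int (1 - \<alpha>) (\<lambda>s. (e i * p i) * s powr (p i - 1)) t = e i * (Gamma (p i + 1) / Gamma (p i + 1 - \<alpha>) * t powr (p i - \<alpha>))"
        unfolding frac_int_cmult G[OF i, symmetric] by simp
    qed
    also have "frac_int (1 - \<alpha>) (frac_int 3 V) t = frac_int (4 - \<alpha>) V t" unfolding sg(1) by (simp add: add.commute)
    finally show ?thesis .
  qed
  have "D = frac_int (1 - \<alpha>) W t"
  proof (cases "\<alpha> = 1")
    case True
    have "(Y has_real_derivative D) (at t within {0..T})" using D True by (simp add: has_caputo_derivative_def)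
    moreover have "at t within {0..T} \<noteq> bot" using t T by (simp add: trivial_limit_within islimpt_Icc)
    ultimately have "D = W t"
      using vector_derivative_unique_within[of t "{0..T}" Y D "W t"] der[OF t]
      by (simp add: has_real_derivative_iff_has_vector_derivative)
    then show ?thesis using True by simp
  next
    case False
    then obtain U' where U': "\<forall>s\<in>{0<..<t}. (Y has_real_derivative U' s) (at s)"
        "D = 1 / Gamma (1 - \<alpha>) * integral {0..t} (\<lambda>s. (t - s) powr (-\<alpha>) * U' s)"
      using D by (auto simp: has_caputo_derivative_def)
    have "U' s = W s" if s: "s \<in> {0<..<t}" for s
    proof -
      have "at s within {0..T} = at s" using s t by (intro at_within_interior) simp
      then have "(Y has_real_derivative W s) (at s)" using der[of s] s t by simp
      with U'(1) s show ?thesis using DERIV_unique by blast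
    qed
    then have "frac_int (1 - \<alpha>) U' t = frac_int (1 - \<alpha>) W t"
      using False a by (intro frac_int_cong_open) auto
    moreover have "frac_int (1 - \<alpha>) U' t = D" using False U'(2) by (simp add: frac_int_def)
    ultimately show ?thesis by simp
  qed
  with fi show ?thesis by simp
qed

section \<open>Truncation error of the corrected formula\<close>

text \<open>Exchanges surplus powers of a small quantity for a constant.\<close>
lemma power_split_bound:
  fixes T p \<theta> x :: real
  assumes "0 < x" "x \<le> T" "\<theta> \<le> p"
  shows "x powr p \<le> T powr (p - \<theta>) * x powr \<theta>"
proof -
  have "x powr p = x powr (p - \<theta>) * x powr \<theta>" by (simp flip: powr_add)
  also have "\<dots> \<le> T powr (p - \<theta>) * x powr \<theta>" using assms by (intro mult_right_mono powr_mono2) auto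
  finally show ?thesis .
qed

text \<open>The formula is homogeneous in the step, so on powers everything reduces to step \<open>1\<close>.\<close>
lemma A_op_power:
  assumes \<tau>: "\<tau> > 0"
  shows "Gamma (p + 1) / Gamma (p + 1 - \<alpha>) * (real n * \<tau>) powr (p - \<alpha>) - A_op \<tau> w \<alpha> n m (\<lambda>k. (real k * \<tau>) powr p)
     = \<tau> powr (p - \<alpha>) * (power_defect \<alpha> p n - (\<Sum>k=1..m. w n k * real k powr p))"
proof -
  have k: "(real k * \<tau>) powr q = \<tau> powr q * real k powr q" for k q using \<tau> by (simp add: powr_mult mult.commute)
  have t: "1 / \<tau> powr \<alpha> * \<tau> powr p = \<tau> powr (p - \<alpha>)" by (simp add: powr_diff)
  define G where "G = (\<Sum>k=0..n. g_coeff \<alpha> (n - k) * real k powr p)"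
  define H where "H = (\<Sum>k=1..m. w n k * real k powr p)"
  have "(\<Sum>k=0..n. g_coeff \<alpha> (n - k) * (real k * \<tau>) powr p) = \<tau> powr p * G"
    unfolding G_def sum_distrib_left k by (intro sum.cong refl) (simp only: mult.left_commute)
  moreover have "(\<Sum>k=1..m. w n k * (real k * \<tau>) powr p) = \<tau> powr p * H"
    unfolding H_def sum_distrib_left k by (intro sum.cong refl) (simp only: mult.left_commute)
  ultimately have A: "A_op \<tau> w \<alpha> n m (\<lambda>k. (real k * \<tau>) powr p) = \<tau> powr (p - \<alpha>) * (G + H)"
    by (simp only: A_op_def mult.assoc[symmetric] t distrib_left)
  show ?thesis unfolding A k[of n "p - \<alpha>"] power_defect_def G_def[symmetric] H_def[symmetric]
    by (simp add: algebra_simps)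
qed

lemma A_op_add: "A_op \<tau> w \<alpha> n m (\<lambda>k. U k + V k) = A_op \<tau> w \<alpha> n m U + A_op \<tau> w \<alpha> n m V"
  unfolding A_op_def by (simp add: distrib_left sum.distrib)

lemma A_op_cmult: "A_op \<tau> w \<alpha> n m (\<lambda>k. c * U k) = c * A_op \<tau> w \<alpha> n m U"
proof -
  have s1: "(\<Sum>k=0..n. g_coeff \<alpha> (n - k) * (c * U k)) = c * (\<Sum>k=0..n. g_coeff \<alpha> (n - k) * U k)"
    by (simp add: sum_distrib_left mult_ac)
  have s2: "(\<Sum>k=1..m. w n k * (c * U k)) = c * (\<Sum>k=1..m. w n k * U k)"
    by (simp add: sum_distrib_left mult_ac)
  show ?thesis unfolding A_op_def s1 s2 by (simp add: algebra_simps)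
qed

lemma A_op_sum: "finite I \<Longrightarrow> A_op \<tau> w \<alpha> n m (\<lambda>k. \<Sum>i\<in>I. U i k) = (\<Sum>i\<in>I. A_op \<tau> w \<alpha> n m (U i))"
  by (induction I rule: finite_induct) (simp_all add: A_op_add, simp add: A_op_def)

lemma A_op_cong:
  assumes "\<And>k. k \<le> max n m \<Longrightarrow> U k = V k"
  shows "A_op \<tau> w \<alpha> n m U = A_op \<tau> w \<alpha> n m V"
proof -
  have "(\<Sum>k=0..n. g_coeff \<alpha> (n - k) * U k) = (\<Sum>k=0..n. g_coeff \<alpha> (n - k) * V k)"
    by (intro sum.cong refl) (simp add: assms)
  moreover have "(\<Sum>k=1..m. w n k * U k) = (\<Sum>k=1..m. w n k * V k)"
  proof (intro sum.cong refl)
    fix k assume "k \<in> {1..m}"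
    then have "k \<le> max n m" by (simp add: le_max_iff_disj)
    then have "U k = V k" by (rule assms)
    then show "w n k * U k = w n k * V k" by simp
  qed
  ultimately show ?thesis by (simp add: A_op_def)
qed

text \<open>The three parts of the decomposition: the first \<open>m\<close> powers are reproduced exactly by the starting weights,
the other powers contribute the larger of their own defect and that of the starting weights applied to them,
and the smooth part contributes \<open>\<tau>\<^sup>2\<close> (its starting correction is of higher order, since \<open>I^4 V\<close> is
\<open>O(\<tau> ^ 4)\<close> at the first grid points).\<close>
lemma truncation_bound:
  fixes c \<sigma> :: "nat \<Rightarrow> real" and d :: "real \<Rightarrow> real"
  assumes T: "T > 0" and a: "0 < \<alpha>" "\<alpha> \<le> 1"
    and \<sigma>: "\<And>k. k \<ge> 1 \<Longrightarrow> 0 < \<sigma> k \<and> \<sigma> k < \<sigma> (k + 1)" and m: "m \<ge> 1" "\<sigma> m \<le> 2"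
    and w: "starting_weights \<alpha> \<sigma> m w"
    and S: "finite S" "\<And>p. p \<in> S \<Longrightarrow> p \<ge> min 4 (\<sigma> (m + 1))"
    and V: "V absolutely_integrable_on {0..T}" and B: "\<forall>t\<in>{0..T}. \<bar>V t\<bar> \<le> B"
    and Y0: "Y 0 = Y0"
    and dec: "\<forall>t\<in>{0<..T}. Y t - Y0 = (\<Sum>k=1..m. c k * t powr \<sigma> k) + (\<Sum>p\<in>S. d p * t powr p) + frac_int 4 V t"
  defines "\<theta> \<equiv> min 4 (\<sigma> (m + 1))"
  shows "\<exists>C>0. \<forall>nT n D. m \<le> nT \<longrightarrow> n \<in> {1..nT} \<longrightarrow> has_caputo_derivative T \<alpha> Y D (real n * (T / real nT)) \<longrightarrow>
     \<bar>D - A_op (T / real nT) w \<alpha> n m (\<lambda>k. Y (real k * (T / real nT)) - Y0)\<bar>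
      \<le> C * ((T / real nT) powr (\<theta> - \<alpha>) * defect_rate \<alpha> \<theta> n + (T / real nT)\<^sup>2)"
proof -
  have \<theta>: "\<theta> > 0" "\<sigma> m \<le> \<theta>" "\<theta> \<le> 4" using \<sigma>[of m] \<sigma>[of "m + 1"] m by (auto simp: \<theta>_def)
  have B0: "B \<ge> 0"
  proof -
    have "\<bar>V T\<bar> \<le> B" using B T by simp
    then show ?thesis by linarith
  qed
  obtain W where W: "W > 0" "\<And>n k. n \<ge> 1 \<Longrightarrow> k \<in> {1..m} \<Longrightarrow> \<bar>w n k\<bar> \<le> W * defect_rate \<alpha> (\<sigma> m) n"
  proof -
    have "\<exists>W>0. \<forall>n\<ge>1. \<forall>k\<in>{1..m}. \<bar>w n k\<bar> \<le> W * defect_rate \<alpha> (\<sigma> m) n"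
      by (rule starting_weights_bound[OF a _ w]) (rule \<sigma>)
    then obtain W where
      W': "W > 0 \<and> (\<forall>n\<ge>1. \<forall>k\<in>{1..m}. \<bar>w n k\<bar> \<le> W * defect_rate \<alpha> (\<sigma> m) n)"
      by (elim exE)
    show thesis by (rule that[of W]) (use W' in auto)
  qed
  have "\<forall>p\<in>S. \<exists>C>0. \<forall>n\<ge>1. \<bar>power_defect \<alpha> p n\<bar> \<le> C * defect_rate \<alpha> p n"
  proof
    fix p assume "p \<in> S"
    then have "p > 0" using S(2)[of p] \<theta>(1) by (simp add: \<theta>_def)
    then show "\<exists>C>0. \<forall>n\<ge>1. \<bar>power_defect \<alpha> p n\<bar> \<le> C * defect_rate \<alpha> p n"
      by (rule power_defect_bound[OF a])
  qed
  then obtain Cp where Cp: "\<And>p. p \<in> S \<Longrightarrow> Cp p > 0"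
     "\<And>p n. p \<in> S \<Longrightarrow> n \<ge> 1 \<Longrightarrow> \<bar>power_defect \<alpha> p n\<bar> \<le> Cp p * defect_rate \<alpha> p n"
    by metis
  have "\<exists>Cs>0. \<forall>\<tau>>0. \<forall>n\<ge>1. real n * \<tau> \<le> T \<longrightarrow>
     \<bar>frac_int (4 - \<alpha>) V (real n * \<tau>) - 1 / \<tau> powr \<alpha> * (\<Sum>k=0..n. g_coeff \<alpha> (n - k) * frac_int 4 V (real k * \<tau>))\<bar> \<le> Cs * \<tau>\<^sup>2"
    by (rule smooth_truncation_bound[OF a T V]) (rule bspec[OF B])
  then obtain Cs where Cs': "Cs > 0 \<and> (\<forall>\<tau>>0. \<forall>n\<ge>1. real n * \<tau> \<le> T \<longrightarrow>
     \<bar>frac_int (4 - \<alpha>) V (real n * \<tau>) - 1 / \<tau> powr \<alpha> * (\<Sum>k=0..n. g_coeff \<alpha> (n - k) * frac_int 4 V (real k * \<tau>))\<bar> \<le> Cs * \<tau>\<^sup>2)"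
    by (elim exE)
  note Cs = Cs'[THEN conjunct1] Cs'[THEN conjunct2, rule_format]
  define E where "E = (\<lambda>p. T powr (p - \<theta>) * (Cp p + W * (\<Sum>k=1..m. real k powr p)))"
  define C1 where "C1 = (\<Sum>p\<in>S. \<bar>d p\<bar> * E p)"
  define C2 where "C2 = 2 * W * B * (\<Sum>k=1..m. real k powr 4) * T powr (2 - \<alpha>)"
  define C where "C = C1 + Cs + C2"
  have E0: "E p \<ge> 0" if "p \<in> S" for p unfolding E_def using Cp(1)[OF that] W(1)
    by (intro mult_nonneg_nonneg add_nonneg_nonneg sum_nonneg) auto
  have C10: "C1 \<ge> 0" unfolding C1_def using E0 by (intro sum_nonneg mult_nonneg_nonneg) auto
  have C20: "C2 \<ge> 0" unfolding C2_def using W(1) B0 by (intro mult_nonneg_nonneg sum_nonneg) auto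
  have Cpos: "C > 0" unfolding C_def using C10 C20 Cs(1) by linarith
  have main: "\<bar>D - A_op \<tau> w \<alpha> n m (\<lambda>k. Y (real k * \<tau>) - Y0)\<bar>
      \<le> C * (\<tau> powr (\<theta> - \<alpha>) * defect_rate \<alpha> \<theta> n + \<tau>\<^sup>2)"
    if \<tau>def: "\<tau> = T / real nT" and nT: "m \<le> nT" "n \<in> {1..nT}" and D: "has_caputo_derivative T \<alpha> Y D (real n * \<tau>)" for \<tau> nT n D
  proof -
    have nT0: "real nT > 0" using nT by simp
    have \<tau>: "\<tau> > 0" "\<tau> \<le> T" "real nT * \<tau> = T" using T nT0 by (auto simp: \<tau>def field_simps)
    have n1: "n \<ge> 1" "real n \<ge> 1" using nT by auto
    have kt: "real k * \<tau> \<le> T" if "k \<le> nT" for k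
    proof -
      have "real k * \<tau> \<le> real nT * \<tau>" using that \<tau>(1) by (intro mult_right_mono) auto
      then show ?thesis using \<tau>(3) by simp
    qed
    have tn: "real n * \<tau> \<in> {0<..T}" using kt[of n] nT n1 \<tau>(1) by simp
    \<comment> \<open>A disjoint sum of index sets keeps the coefficients \<open>c\<close> and \<open>d\<close> of the two families of powers apart.\<close>
    define I where "I = {1..m} <+> S"
    define e where "e = case_sum c d"
    define p where "p = case_sum \<sigma> (\<lambda>x::real. x)"
    have I: "finite I" using S(1) by (simp add: I_def)
    have sumI: "(\<Sum>i\<in>I. f i) = (\<Sum>k=1..m. f (Inl k)) + (\<Sum>q\<in>S. f (Inr q))" for f :: "nat + real \<Rightarrow> real"
      unfolding I_def using S(1) by (simp add: sum.Plus o_def)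
    have ppos: "p i > 0" if "i \<in> I" for i
    proof -
      have "x > 0" if "x \<in> S" for x using S(2)[OF that] \<theta>(1) unfolding \<theta>_def by linarith
      then show ?thesis using that \<sigma> unfolding I_def p_def by (elim PlusE) auto
    qed
    have decI: "\<forall>t\<in>{0<..T}. Y t - Y0 = (\<Sum>i\<in>I. e i * t powr p i) + frac_int 4 V t"
      using dec unfolding sumI by (simp add: e_def p_def)
    have Dval: "D = (\<Sum>i\<in>I. e i * (Gamma (p i + 1) / Gamma (p i + 1 - \<alpha>) * (real n * \<tau>) powr (p i - \<alpha>))) + frac_int (4 - \<alpha>) V (real n * \<tau>)"
      by (rule Caputo_derivative_of_decomposition[OF T V I ppos decI D a tn])
    define F where "F = (\<lambda>k::nat. frac_int 4 V (real k * \<tau>))"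
    have Uk: "Y (real k * \<tau>) - Y0 = (\<Sum>i\<in>I. e i * (real k * \<tau>) powr p i) + F k" if k: "k \<le> max n m" for k
    proof (cases "k = 0")
      case True
      then show ?thesis using Y0 by (simp add: F_def frac_int_def)
    next
      case False
      then have "real k * \<tau> \<in> {0<..T}" using k nT \<tau>(1) kt[of k] by auto
      with decI show ?thesis by (simp add: F_def)
    qed
    have "A_op \<tau> w \<alpha> n m (\<lambda>k. Y (real k * \<tau>) - Y0) = A_op \<tau> w \<alpha> n m (\<lambda>k. (\<Sum>i\<in>I. e i * (real k * \<tau>) powr p i) + F k)"
      by (rule A_op_cong) (rule Uk)
    also have "\<dots> = (\<Sum>i\<in>I. e i * A_op \<tau> w \<alpha> n m (\<lambda>k. (real k * \<tau>) powr p i)) + A_op \<tau> w \<alpha> n m F"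
      unfolding A_op_add A_op_sum[OF I] A_op_cmult ..
    finally have Aval: "A_op \<tau> w \<alpha> n m (\<lambda>k. Y (real k * \<tau>) - Y0) = (\<Sum>i\<in>I. e i * A_op \<tau> w \<alpha> n m (\<lambda>k. (real k * \<tau>) powr p i)) + A_op \<tau> w \<alpha> n m F" .
    define \<delta> where "\<delta> = (\<lambda>q. \<tau> powr (q - \<alpha>) * (power_defect \<alpha> q n - (\<Sum>k=1..m. w n k * real k powr q)))"
    have "D - A_op \<tau> w \<alpha> n m (\<lambda>k. Y (real k * \<tau>) - Y0) = (\<Sum>i\<in>I. e i * \<delta> (p i)) + (frac_int (4 - \<alpha>) V (real n * \<tau>) - A_op \<tau> w \<alpha> n m F)"
      unfolding Dval Aval \<delta>_def A_op_power[OF \<tau>(1), symmetric] by (simp add: right_diff_distrib sum_subtractf)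
    also have "(\<Sum>i\<in>I. e i * \<delta> (p i)) = (\<Sum>q\<in>S. d q * \<delta> q)"
    proof -
      have "\<delta> (\<sigma> k) = 0" if "k \<in> {1..m}" for k
        using w that n1(1) by (simp add: \<delta>_def starting_weights_def power_defect_def)
      then have "(\<Sum>k=1..m. c k * \<delta> (\<sigma> k)) = 0" by (intro sum.neutral) auto
      then show ?thesis unfolding sumI by (simp add: e_def p_def)
    qed
    finally have diff: "D - A_op \<tau> w \<alpha> n m (\<lambda>k. Y (real k * \<tau>) - Y0) = (\<Sum>q\<in>S. d q * \<delta> q) + (frac_int (4 - \<alpha>) V (real n * \<tau>) - A_op \<tau> w \<alpha> n m F)" .
    define X where "X = \<tau> powr (\<theta> - \<alpha>) * defect_rate \<alpha> \<theta> n"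
    have wn: "\<bar>w n k\<bar> \<le> W * defect_rate \<alpha> \<theta> n" if "k \<in> {1..m}" for k
    proof -
      have "real n powr (\<sigma> m - \<alpha> - 2) \<le> real n powr (\<theta> - \<alpha> - 2)" using n1 \<theta> by (intro powr_mono) auto
      then show ?thesis using W(1) by (intro order.trans[OF W(2)[OF n1(1) that]] mult_left_mono) auto
    qed
    have \<delta>b: "\<bar>\<delta> q\<bar> \<le> E q * X" if q: "q \<in> S" for q
    proof -
      have q\<theta>: "\<theta> \<le> q" using S(2)[OF q] by (simp add: \<theta>_def)
      have t1: "\<tau> powr (q - \<alpha>) \<le> T powr (q - \<theta>) * \<tau> powr (\<theta> - \<alpha>)"
        using power_split_bound[of \<tau> T "\<theta> - \<alpha>" "q - \<alpha>"] \<tau> q\<theta> by simp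
      have t2: "\<tau> powr (q - \<alpha>) * real n powr (q - \<alpha> - 2) \<le> T powr (q - \<theta>) * (\<tau> powr (\<theta> - \<alpha>) * real n powr (\<theta> - \<alpha> - 2))"
      proof -
        have "\<tau> powr (q - \<alpha>) * real n powr (q - \<alpha> - 2) = (real n * \<tau>) powr (q - \<alpha>) * real n powr (- 2)"
        proof -
          have "real n powr (q - \<alpha> - 2) = real n powr (q - \<alpha>) * real n powr (- 2)" by (simp flip: powr_add)
          then show ?thesis using \<tau> n1 by (simp add: powr_mult mult_ac)
        qed
        also have "\<dots> \<le> (T powr (q - \<theta>) * (real n * \<tau>) powr (\<theta> - \<alpha>)) * real n powr (- 2)"
          using power_split_bound[of "real n * \<tau>" T "\<theta> - \<alpha>" "q - \<alpha>"] tn q\<theta> by (intro mult_right_mono) auto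
        also have "\<dots> = T powr (q - \<theta>) * (\<tau> powr (\<theta> - \<alpha>) * real n powr (\<theta> - \<alpha> - 2))"
        proof -
          have "real n powr (\<theta> - \<alpha> - 2) = real n powr (\<theta> - \<alpha>) * real n powr (- 2)" by (simp flip: powr_add)
          then show ?thesis using \<tau> n1 by (simp add: powr_mult mult_ac)
        qed
        finally show ?thesis .
      qed
      have p1: "\<tau> powr (q - \<alpha>) * \<bar>power_defect \<alpha> q n\<bar> \<le> Cp q * (T powr (q - \<theta>) * X)"
      proof -
        have "\<tau> powr (q - \<alpha>) * \<bar>power_defect \<alpha> q n\<bar> \<le> \<tau> powr (q - \<alpha>) * (Cp q * defect_rate \<alpha> q n)"
          by (intro mult_left_mono Cp(2)[OF q n1(1)]) simp
        also have "\<dots> = Cp q * (\<tau> powr (q - \<alpha>) * real n powr (q - \<alpha> - 2) + \<tau> powr (q - \<alpha>) * real n powr (- \<alpha> - 1))"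
          by (simp add: algebra_simps)
        also have "\<dots> \<le> Cp q * (T powr (q - \<theta>) * (\<tau> powr (\<theta> - \<alpha>) * real n powr (\<theta> - \<alpha> - 2)) + (T powr (q - \<theta>) * \<tau> powr (\<theta> - \<alpha>)) * real n powr (- \<alpha> - 1))"
          using less_imp_le[OF Cp(1)[OF q]] by (intro mult_left_mono add_mono t2 mult_right_mono t1) auto
        also have "\<dots> = Cp q * (T powr (q - \<theta>) * X)" by (simp add: X_def algebra_simps)
        finally show ?thesis .
      qed
      have p2: "\<tau> powr (q - \<alpha>) * \<bar>\<Sum>k=1..m. w n k * real k powr q\<bar> \<le> W * (\<Sum>k=1..m. real k powr q) * (T powr (q - \<theta>) * X)"
      proof -
        have "\<bar>\<Sum>k=1..m. w n k * real k powr q\<bar> \<le> (\<Sum>k=1..m. \<bar>w n k\<bar> * real k powr q)"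
          by (intro order.trans[OF sum_abs]) (simp add: abs_mult)
        also have "\<dots> \<le> (\<Sum>k=1..m. (W * defect_rate \<alpha> \<theta> n) * real k powr q)"
          by (intro sum_mono mult_right_mono wn) auto
        also have "\<dots> = W * (\<Sum>k=1..m. real k powr q) * defect_rate \<alpha> \<theta> n"
          by (simp only: sum_distrib_left[symmetric]) (simp add: mult_ac)
        finally have "\<tau> powr (q - \<alpha>) * \<bar>\<Sum>k=1..m. w n k * real k powr q\<bar> \<le> (T powr (q - \<theta>) * \<tau> powr (\<theta> - \<alpha>)) * (W * (\<Sum>k=1..m. real k powr q) * defect_rate \<alpha> \<theta> n)"
          by (intro mult_mono t1) auto
        also have "\<dots> = W * (\<Sum>k=1..m. real k powr q) * (T powr (q - \<theta>) * X)" by (simp add: X_def mult_ac)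
        finally show ?thesis .
      qed
      have "\<bar>\<delta> q\<bar> \<le> \<tau> powr (q - \<alpha>) * (\<bar>power_defect \<alpha> q n\<bar> + \<bar>\<Sum>k=1..m. w n k * real k powr q\<bar>)"
        unfolding \<delta>_def abs_mult by (intro mult_mono abs_triangle_ineq4) auto
      also have "\<dots> \<le> Cp q * (T powr (q - \<theta>) * X) + W * (\<Sum>k=1..m. real k powr q) * (T powr (q - \<theta>) * X)"
        unfolding distrib_left by (intro add_mono p1 p2)
      also have "\<dots> = E q * X" by (simp add: E_def algebra_simps)
      finally show ?thesis .
    qed
    have X0: "X \<ge> 0" by (simp add: X_def)
    have b1: "\<bar>\<Sum>q\<in>S. d q * \<delta> q\<bar> \<le> C1 * X"
    proof -
      have "\<bar>\<Sum>q\<in>S. d q * \<delta> q\<bar> \<le> (\<Sum>q\<in>S. \<bar>d q\<bar> * \<bar>\<delta> q\<bar>)" by (intro order.trans[OF sum_abs]) (simp add: abs_mult)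
      also have "\<dots> \<le> (\<Sum>q\<in>S. \<bar>d q\<bar> * (E q * X))" by (intro sum_mono mult_left_mono \<delta>b) auto
      also have "\<dots> = C1 * X" unfolding C1_def sum_distrib_right by (intro sum.cong refl) (simp only: mult.assoc)
      finally show ?thesis .
    qed
    have b2: "\<bar>frac_int (4 - \<alpha>) V (real n * \<tau>) - A_op \<tau> w \<alpha> n m F\<bar> \<le> (Cs + C2) * \<tau>\<^sup>2"
    proof -
      have c2: "\<bar>1 / \<tau> powr \<alpha> * (\<Sum>k=1..m. w n k * F k)\<bar> \<le> C2 * \<tau>\<^sup>2"
      proof -
        have "\<bar>w n k * F k\<bar> \<le> (2 * W) * (B * (real k * \<tau>) powr 4)" if k: "k \<in> {1..m}" for k
        proof -
          have "real n powr (\<sigma> m - \<alpha> - 2) \<le> real n powr 0" "real n powr (- \<alpha> - 1) \<le> real n powr 0"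
            using n1 m a by (intro powr_mono; simp)+
          then have "defect_rate \<alpha> (\<sigma> m) n \<le> 2" using n1 by simp
          then have "W * defect_rate \<alpha> (\<sigma> m) n \<le> W * 2" using W(1) by (intro mult_left_mono) auto
          then have "\<bar>w n k\<bar> \<le> 2 * W" using W(2)[OF n1(1) k] by simp
          moreover have "\<bar>F k\<bar> \<le> B * (real k * \<tau>) powr 4" unfolding F_def
            by (rule frac_int_4_bound[OF V B]) (use k kt[of k] nT \<tau>(1) in auto)
          ultimately show ?thesis unfolding abs_mult by (intro mult_mono) auto
        qed
        then have "(\<Sum>k=1..m. \<bar>w n k * F k\<bar>) \<le> (\<Sum>k=1..m. (2 * W) * (B * (real k * \<tau>) powr 4))" by (intro sum_mono)
        also have "\<dots> = 2 * W * B * (\<Sum>k=1..m. real k powr 4) * \<tau> powr 4"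
          using \<tau>(1) by (simp add: sum_distrib_left sum_distrib_right powr_mult mult_ac)
        finally have s: "\<bar>\<Sum>k=1..m. w n k * F k\<bar> \<le> 2 * W * B * (\<Sum>k=1..m. real k powr 4) * \<tau> powr 4"
          by (rule order.trans[OF sum_abs])
        have "\<bar>1 / \<tau> powr \<alpha> * (\<Sum>k=1..m. w n k * F k)\<bar> = 1 / \<tau> powr \<alpha> * \<bar>\<Sum>k=1..m. w n k * F k\<bar>" by (simp add: abs_mult)
        also have "\<dots> \<le> 1 / \<tau> powr \<alpha> * (2 * W * B * (\<Sum>k=1..m. real k powr 4) * \<tau> powr 4)" by (intro mult_left_mono s) simp
        also have "\<dots> = 2 * W * B * (\<Sum>k=1..m. real k powr 4) * \<tau> powr (4 - \<alpha>)" by (simp only: powr_diff) simp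
        also have "\<dots> \<le> 2 * W * B * (\<Sum>k=1..m. real k powr 4) * (T powr (2 - \<alpha>) * \<tau> powr 2)"
          using power_split_bound[of \<tau> T 2 "4 - \<alpha>"] \<tau> a W(1) B0 by (intro mult_left_mono mult_nonneg_nonneg sum_nonneg) auto
        also have "\<dots> = C2 * \<tau>\<^sup>2" using \<tau>(1) by (simp add: C2_def)
        finally show ?thesis .
      qed
      have c3: "\<bar>frac_int (4 - \<alpha>) V (real n * \<tau>) - 1 / \<tau> powr \<alpha> * (\<Sum>k=0..n. g_coeff \<alpha> (n - k) * F k)\<bar> \<le> Cs * \<tau>\<^sup>2"
        unfolding F_def by (rule Cs(2)) (use \<tau> n1 tn in auto)
      from c2 c3 show ?thesis unfolding A_op_def distrib_right by linarith
    qed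
    have "\<bar>D - A_op \<tau> w \<alpha> n m (\<lambda>k. Y (real k * \<tau>) - Y0)\<bar> \<le> C1 * X + (Cs + C2) * \<tau>\<^sup>2"
      unfolding diff using b1 b2 by linarith
    also have "\<dots> \<le> C * X + C * \<tau>\<^sup>2"
      using X0 C10 C20 Cs(1) by (intro add_mono mult_right_mono) (auto simp: C_def)
    finally show ?thesis by (simp add: X_def distrib_left)
  qed
  show ?thesis using Cpos by (intro exI[of _ C] conjI allI impI) (assumption, rule main[OF refl])
qed

section \<open>Energy estimate and scaling of the residual\<close>

text \<open>The weight \<open>n powr (\<alpha> / 2)\<close> is the price of absorbing a residual by \<open>g_form_coercive\<close>. The part \<open>n powr (- \<alpha> - 1)\<close> is
square summable against it; the lower bound \<open>\<alpha> / 2\<close> for the exponent of \<open>K\<close> absorbs the borderline case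
of the other part without a logarithm. Together with the factor \<open>K powr (\<alpha> / 2)\<close> it costs \<open>K powr \<alpha>\<close>, which the factor
\<open>\<tau> powr \<alpha>\<close> compensates.\<close>
lemma weighted_sum_bound:
  assumes a: "0 < \<alpha>"
  shows "\<exists>C>0. \<forall>K\<ge>1. (\<Sum>n=1..K. (real n powr \<beta> + real n powr (- \<alpha> - 1))\<^sup>2 * real n powr (\<alpha> / 2)) \<le> C * real K powr (max (\<alpha> / 2) (2 * \<beta> + \<alpha> / 2 + 1))"
proof -
  define r where "r = max (\<alpha> / 2) (2 * \<beta> + \<alpha> / 2 + 1)"
  have r: "r > 0" "r \<ge> 2 * \<beta> + \<alpha> / 2 + 1" using a by (auto simp: r_def)
  obtain C1 where C1: "C1 > 0" "\<And>K. (\<Sum>n=1..K. real n powr (2 * \<beta> + \<alpha> / 2)) \<le> C1 * real K powr r"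
    using sum_powr_bound[OF r] by auto
  obtain C2 where C2: "C2 > 0" "\<And>K. (\<Sum>n=1..K. real n powr (- 2 * \<alpha> - 2 + \<alpha> / 2)) \<le> C2 * real K powr r"
    using sum_powr_bound[of r "- 2 * \<alpha> - 2 + \<alpha> / 2"] r(1) a by auto
  have "(\<Sum>n=1..K. (real n powr \<beta> + real n powr (- \<alpha> - 1))\<^sup>2 * real n powr (\<alpha> / 2)) \<le> (2 * C1 + 2 * C2) * real K powr r" for K
  proof -
    have "(\<Sum>n=1..K. (real n powr \<beta> + real n powr (- \<alpha> - 1))\<^sup>2 * real n powr (\<alpha> / 2))
        \<le> (\<Sum>n=1..K. 2 * real n powr (2 * \<beta> + \<alpha> / 2) + 2 * real n powr (- 2 * \<alpha> - 2 + \<alpha> / 2))"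
    proof (rule sum_mono)
      fix n
      define x y z where "x = real n powr \<beta>" and "y = real n powr (- \<alpha> - 1)" and "z = real n powr (\<alpha> / 2)"
      have "(x + y)\<^sup>2 \<le> 2 * x\<^sup>2 + 2 * y\<^sup>2"
        using sum_squares_bound[of x y] by (simp add: power2_sum)
      then have "(x + y)\<^sup>2 * z \<le> (2 * x\<^sup>2 + 2 * y\<^sup>2) * z" by (intro mult_right_mono) (auto simp: z_def)
      also have "\<dots> = 2 * (x * x * z) + 2 * (y * y * z)" by (simp add: power2_eq_square algebra_simps)
      also have "x * x * z = real n powr (2 * \<beta> + \<alpha> / 2)" unfolding x_def z_def by (simp only: powr_add[symmetric]) simp
      also have "y * y * z = real n powr (- 2 * \<alpha> - 2 + \<alpha> / 2)" unfolding y_def z_def by (simp only: powr_add[symmetric]) simp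
      finally show "(real n powr \<beta> + real n powr (- \<alpha> - 1))\<^sup>2 * real n powr (\<alpha> / 2) \<le> 2 * real n powr (2 * \<beta> + \<alpha> / 2) + 2 * real n powr (- 2 * \<alpha> - 2 + \<alpha> / 2)"
        by (simp only: x_def y_def z_def)
    qed
    also have "\<dots> = 2 * (\<Sum>n=1..K. real n powr (2 * \<beta> + \<alpha> / 2)) + 2 * (\<Sum>n=1..K. real n powr (- 2 * \<alpha> - 2 + \<alpha> / 2))"
      by (simp only: sum.distrib sum_distrib_left)
    also have "\<dots> \<le> 2 * (C1 * real K powr r) + 2 * (C2 * real K powr r)" by (intro add_mono mult_left_mono C1 C2) auto
    finally show ?thesis by (simp add: algebra_simps)
  qed
  then show ?thesis using C1(1) C2(1) unfolding r_def by (intro exI[of _ "2 * C1 + 2 * C2"]) auto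
qed

text \<open>Test with \<open>e n\<close>. The uniform part \<open>R0\<close> of the residual is absorbed by \<open>(\<Sum>n=1..K. (e n)\<^sup>2)\<close>, the part \<open>R j\<close> by the form of
the same order. It is essential that the two factors \<open>\<nu> j\<close>, in the residual and in the form, are the same: the
form of order \<open>\<alpha> j\<close> disappears together with \<open>\<nu> j\<close>. The sum \<open>X\<close> of all \<open>\<bar>e n\<bar> * \<bar>\<rho> n\<bar>\<close> bounds the tested
equation up to every \<open>N \<le> K\<close>, which is what the coercivity needs.\<close>
lemma energy_estimate:
  fixes \<nu> \<alpha> c :: "nat \<Rightarrow> real"
  assumes Q: "Q \<ge> 1" and \<nu>: "\<And>j. j \<in> {1..Q} \<Longrightarrow> \<nu> j \<ge> 0"
    and a: "\<And>j. j \<in> {1..Q} \<Longrightarrow> 0 < \<alpha> j \<and> \<alpha> j \<le> 1"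
    and c: "\<And>j. j \<in> {1..Q} \<Longrightarrow> c j > 0"
    and coer: "\<And>j K e X. j \<in> {1..Q} \<Longrightarrow> (\<forall>N\<le>K. g_form (\<alpha> j) e N \<le> X) \<Longrightarrow>
           c j * real K powr (- \<alpha> j / 2) * (\<Sum>n=1..K. real n powr (- \<alpha> j / 2) * (e n)\<^sup>2) \<le> X"
    and \<tau>: "\<tau> > 0" and K: "K \<ge> 1"
    and eq: "\<And>n. n \<in> {1..K} \<Longrightarrow> e n + (\<Sum>j=1..Q. \<nu> j / \<tau> powr \<alpha> j * (\<Sum>k=1..n. g_coeff (\<alpha> j) (n - k) * e k)) = \<rho> n"
    and \<rho>: "\<And>n. n \<in> {1..K} \<Longrightarrow> \<bar>\<rho> n\<bar> \<le> R0 + (\<Sum>j=1..Q. \<nu> j * R j n)"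
  shows "(\<Sum>n=1..K. (e n)\<^sup>2) \<le> 2 * (real K * R0\<^sup>2) + 2 * (\<Sum>j=1..Q. \<nu> j * real Q / c j * (\<tau> powr \<alpha> j * real K powr (\<alpha> j / 2) * (\<Sum>n=1..K. (R j n)\<^sup>2 * real n powr (\<alpha> j / 2))))"
proof -
  define b where "b = (\<lambda>j. \<nu> j / \<tau> powr \<alpha> j)"
  have b0: "b j \<ge> 0" if "j \<in> {1..Q}" for j using \<nu>[OF that] by (simp add: b_def)
  define X where "X = (\<Sum>n=1..K. \<bar>e n\<bar> * \<bar>\<rho> n\<bar>)"
  have X0: "X \<ge> 0" unfolding X_def by (intro sum_nonneg) auto
  have en: "(\<Sum>n=1..N. (e n)\<^sup>2) + (\<Sum>j=1..Q. b j * g_form (\<alpha> j) e N) \<le> X" if N: "N \<le> K" for N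
  proof -
    have "(\<Sum>n=1..N. (e n)\<^sup>2) + (\<Sum>j=1..Q. b j * g_form (\<alpha> j) e N) = (\<Sum>n=1..N. e n * (e n + (\<Sum>j=1..Q. b j * (\<Sum>k=1..n. g_coeff (\<alpha> j) (n - k) * e k))))"
    proof -
      have "(\<Sum>j=1..Q. b j * g_form (\<alpha> j) e N) = (\<Sum>j=1..Q. \<Sum>n=1..N. e n * (b j * (\<Sum>k=1..n. g_coeff (\<alpha> j) (n - k) * e k)))"
        unfolding g_form_def sum_distrib_left[of "b _" _ "{1..N}"] by (intro sum.cong refl) (simp only: mult.left_commute)
      also have "\<dots> = (\<Sum>n=1..N. \<Sum>j=1..Q. e n * (b j * (\<Sum>k=1..n. g_coeff (\<alpha> j) (n - k) * e k)))" by (rule sum.swap)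
      finally show ?thesis by (simp only: distrib_left sum.distrib power2_eq_square sum_distrib_left[of "e _" _ "{1..Q}"])
    qed
    also have "\<dots> = (\<Sum>n=1..N. e n * \<rho> n)" using eq N by (intro sum.cong refl) (simp add: b_def)
    also have "\<dots> \<le> (\<Sum>n=1..N. \<bar>e n\<bar> * \<bar>\<rho> n\<bar>)" by (intro sum_mono) (simp flip: abs_mult)
    also have "\<dots> \<le> X" unfolding X_def using N by (intro sum_mono2) auto
    finally show ?thesis .
  qed
  have gf: "g_form (\<alpha> j) e N \<ge> 0" if "j \<in> {1..Q}" for j N using a[OF that] by (intro g_form_nonneg) auto
  have eK: "(\<Sum>n=1..K. (e n)\<^sup>2) \<le> X"
  proof -
    have "0 \<le> (\<Sum>j=1..Q. b j * g_form (\<alpha> j) e K)" using b0 gf by (intro sum_nonneg mult_nonneg_nonneg) auto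
    with en[of K] show ?thesis by linarith
  qed
  have H: "b j * (c j * real K powr (- \<alpha> j / 2) * (\<Sum>n=1..K. real n powr (- \<alpha> j / 2) * (e n)\<^sup>2)) \<le> X" if j: "j \<in> {1..Q}" for j
  proof (cases "b j = 0")
    case True then show ?thesis using X0 by simp
  next
    case False
    then have bj: "b j > 0" using b0[OF j] by simp
    have "g_form (\<alpha> j) e N \<le> X / b j" if N: "N \<le> K" for N
    proof -
      have "b j * g_form (\<alpha> j) e N \<le> (\<Sum>j=1..Q. b j * g_form (\<alpha> j) e N)"
        using j b0 gf by (intro member_le_sum mult_nonneg_nonneg) auto
      moreover have "0 \<le> (\<Sum>n=1..N. (e n)\<^sup>2)" by (intro sum_nonneg) auto
      ultimately have "b j * g_form (\<alpha> j) e N \<le> X" using en[OF N] by linarith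
      then show ?thesis using bj by (simp add: pos_le_divide_eq mult.commute)
    qed
    then have "c j * real K powr (- \<alpha> j / 2) * (\<Sum>n=1..K. real n powr (- \<alpha> j / 2) * (e n)\<^sup>2) \<le> X / b j"
      by (intro coer[OF j] allI impI)
    then show ?thesis using bj by (simp add: pos_le_divide_eq mult.commute)
  qed
  \<comment> \<open>The weight with which the form of order \<open>\<alpha> j\<close> controls \<open>(e n)\<^sup>2\<close>.\<close>
  define h where "h = (\<lambda>j n. c j * real K powr (- \<alpha> j / 2) * real n powr (- \<alpha> j / 2) / \<tau> powr \<alpha> j)"
  have hpos: "h j n > 0" if "j \<in> {1..Q}" "n \<in> {1..K}" for j n using that c[OF that(1)] K \<tau> by (simp add: h_def)
  have Hh: "(\<Sum>n=1..K. \<nu> j * h j n * (e n)\<^sup>2) \<le> X" if j: "j \<in> {1..Q}" for j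
  proof -
    have "(\<Sum>n=1..K. \<nu> j * h j n * (e n)\<^sup>2) = b j * (c j * real K powr (- \<alpha> j / 2) * (\<Sum>n=1..K. real n powr (- \<alpha> j / 2) * (e n)\<^sup>2))"
      unfolding sum_distrib_left by (intro sum.cong refl) (simp add: b_def h_def)
    with H[OF j] show ?thesis by simp
  qed
  \<comment> \<open>Each of the \<open>Q\<close> forms is bounded by \<open>X\<close>, so each may absorb only the fraction \<open>1 / (4 * Q)\<close> of its weighted sum.\<close>
  define q where "q = real Q"
  have q: "q > 0" using Q by (simp add: q_def)
  have young: "\<bar>e n\<bar> * (\<nu> j * R j n) \<le> \<nu> j * h j n * (e n)\<^sup>2 / (4 * q) + \<nu> j * q * ((R j n)\<^sup>2 / h j n)"
    if j: "j \<in> {1..Q}" and n: "n \<in> {1..K}" for j n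
  proof -
    have h: "h j n > 0" by (rule hpos[OF j n])
    define x r where "x = \<bar>e n\<bar>" and "r = R j n"
    have "0 \<le> (h j n * x - 2 * q * r)\<^sup>2 / (4 * q * h j n)" using h q by simp
    also have "\<dots> = h j n * x\<^sup>2 / (4 * q) - x * r + q * (r\<^sup>2 / h j n)"
      using h q by (simp add: power2_diff power2_eq_square field_simps)
    finally have "x * r \<le> h j n * x\<^sup>2 / (4 * q) + q * (r\<^sup>2 / h j n)" by simp
    then have "\<nu> j * (x * r) \<le> \<nu> j * (h j n * x\<^sup>2 / (4 * q) + q * (r\<^sup>2 / h j n))" using \<nu>[OF j] by (rule mult_left_mono)
    then show ?thesis by (simp add: x_def r_def algebra_simps)
  qed
  have X1: "X \<le> (\<Sum>n=1..K. (e n)\<^sup>2) / 4 + real K * R0\<^sup>2 + (\<Sum>j=1..Q. (\<Sum>n=1..K. \<nu> j * h j n * (e n)\<^sup>2) / (4 * q)) + (\<Sum>j=1..Q. \<nu> j * q * (\<Sum>n=1..K. (R j n)\<^sup>2 / h j n))"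
  proof -
    have "X \<le> (\<Sum>n=1..K. (e n)\<^sup>2 / 4 + R0\<^sup>2 + (\<Sum>j=1..Q. \<nu> j * h j n * (e n)\<^sup>2 / (4 * q) + \<nu> j * q * ((R j n)\<^sup>2 / h j n)))"
      unfolding X_def
    proof (rule sum_mono)
      fix n assume n: "n \<in> {1..K}"
      have "\<bar>e n\<bar> * \<bar>\<rho> n\<bar> \<le> \<bar>e n\<bar> * (R0 + (\<Sum>j=1..Q. \<nu> j * R j n))" by (intro mult_left_mono \<rho>[OF n]) simp
      also have "\<dots> = \<bar>e n\<bar> * R0 + (\<Sum>j=1..Q. \<bar>e n\<bar> * (\<nu> j * R j n))" by (simp add: distrib_left sum_distrib_left)
      also have "\<dots> \<le> ((e n)\<^sup>2 / 4 + R0\<^sup>2) + (\<Sum>j=1..Q. \<nu> j * h j n * (e n)\<^sup>2 / (4 * q) + \<nu> j * q * ((R j n)\<^sup>2 / h j n))"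
      proof (intro add_mono sum_mono young n)
        have "0 \<le> (\<bar>e n\<bar> / 2 - R0)\<^sup>2" by simp
        then show "\<bar>e n\<bar> * R0 \<le> (e n)\<^sup>2 / 4 + R0\<^sup>2" by (simp add: power2_diff power_divide)
      qed
      finally show "\<bar>e n\<bar> * \<bar>\<rho> n\<bar> \<le> (e n)\<^sup>2 / 4 + R0\<^sup>2 + (\<Sum>j=1..Q. \<nu> j * h j n * (e n)\<^sup>2 / (4 * q) + \<nu> j * q * ((R j n)\<^sup>2 / h j n))" .
    qed
    also have "\<dots> = (\<Sum>n=1..K. (e n)\<^sup>2) / 4 + real K * R0\<^sup>2 + ((\<Sum>n=1..K. \<Sum>j=1..Q. \<nu> j * h j n * (e n)\<^sup>2 / (4 * q)) + (\<Sum>n=1..K. \<Sum>j=1..Q. \<nu> j * q * ((R j n)\<^sup>2 / h j n)))"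
      by (simp add: sum.distrib sum_divide_distrib)
    also have "(\<Sum>n=1..K. \<Sum>j=1..Q. \<nu> j * h j n * (e n)\<^sup>2 / (4 * q)) = (\<Sum>j=1..Q. (\<Sum>n=1..K. \<nu> j * h j n * (e n)\<^sup>2) / (4 * q))"
      by (subst sum.swap) (simp only: sum_divide_distrib)
    also have "(\<Sum>n=1..K. \<Sum>j=1..Q. \<nu> j * q * ((R j n)\<^sup>2 / h j n)) = (\<Sum>j=1..Q. \<nu> j * q * (\<Sum>n=1..K. (R j n)\<^sup>2 / h j n))"
      by (subst sum.swap) (simp only: sum_distrib_left)
    finally show ?thesis by (simp only: add.assoc)
  qed
  have "(\<Sum>j=1..Q. (\<Sum>n=1..K. \<nu> j * h j n * (e n)\<^sup>2) / (4 * q)) \<le> (\<Sum>j=1..Q. X / (4 * q))"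
    using q by (intro sum_mono divide_right_mono Hh) auto
  also have "\<dots> = X / 4" using q Q by (simp add: q_def)
  finally have s: "(\<Sum>j=1..Q. (\<Sum>n=1..K. \<nu> j * h j n * (e n)\<^sup>2) / (4 * q)) \<le> X / 4" .
  have Rh: "\<nu> j * q * (\<Sum>n=1..K. (R j n)\<^sup>2 / h j n) = \<nu> j * real Q / c j * (\<tau> powr \<alpha> j * real K powr (\<alpha> j / 2) * (\<Sum>n=1..K. (R j n)\<^sup>2 * real n powr (\<alpha> j / 2)))" if j: "j \<in> {1..Q}" for j
  proof -
    have "(R j n)\<^sup>2 / h j n = 1 / c j * (\<tau> powr \<alpha> j * real K powr (\<alpha> j / 2) * ((R j n)\<^sup>2 * real n powr (\<alpha> j / 2)))" if "n \<in> {1..K}" for n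
    proof -
      have "1 / real K powr (- \<alpha> j / 2) = real K powr (\<alpha> j / 2)" "1 / real n powr (- \<alpha> j / 2) = real n powr (\<alpha> j / 2)"
        by (simp_all add: powr_minus_divide[symmetric])
      moreover have "(R j n)\<^sup>2 / h j n = (R j n)\<^sup>2 * (1 / c j) * (1 / real K powr (- \<alpha> j / 2)) * (1 / real n powr (- \<alpha> j / 2)) * \<tau> powr \<alpha> j"
        by (simp add: h_def)
      ultimately show ?thesis by (simp only: mult_ac)
    qed
    then have "(\<Sum>n=1..K. (R j n)\<^sup>2 / h j n) = (\<Sum>n=1..K. 1 / c j * (\<tau> powr \<alpha> j * real K powr (\<alpha> j / 2) * ((R j n)\<^sup>2 * real n powr (\<alpha> j / 2))))"
      by (intro sum.cong refl)
    also have "\<dots> = 1 / c j * (\<tau> powr \<alpha> j * real K powr (\<alpha> j / 2) * (\<Sum>n=1..K. (R j n)\<^sup>2 * real n powr (\<alpha> j / 2)))"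
      by (simp only: sum_distrib_left)
    finally show ?thesis by (simp add: q_def)
  qed
  have "(\<Sum>j=1..Q. \<nu> j * q * (\<Sum>n=1..K. (R j n)\<^sup>2 / h j n)) = (\<Sum>j=1..Q. \<nu> j * real Q / c j * (\<tau> powr \<alpha> j * real K powr (\<alpha> j / 2) * (\<Sum>n=1..K. (R j n)\<^sup>2 * real n powr (\<alpha> j / 2))))"
    by (intro sum.cong refl Rh)
  with X1 s eK show ?thesis by linarith
qed

text \<open>Balance of powers: the sum gives \<open>K powr r\<close> with \<open>\<alpha> / 2 + r = \<alpha> + 2 * max 0 (s - \<alpha> - 3/2)\<close>, and
\<open>(K * \<tau>) powr \<alpha> \<le> T powr \<alpha>\<close> disposes of the extra \<open>\<alpha>\<close>.\<close>
lemma scaled_rate_sum: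
  assumes a: "0 < \<alpha>" and T: "T > 0"
  shows "\<exists>C>0. \<forall>\<tau>>0. \<forall>K\<ge>1. real K * \<tau> \<le> T \<longrightarrow>
    \<tau> * (\<tau> powr \<alpha> * real K powr (\<alpha> / 2) * (\<Sum>n=1..K. (\<tau> powr \<gamma> * defect_rate \<alpha> s n)\<^sup>2 * real n powr (\<alpha> / 2)))
      \<le> C * (\<tau> powr (1/2 + \<gamma>) * real K powr (max 0 (s - \<alpha> - 3/2)))\<^sup>2"
proof -
  define r where "r = max (\<alpha> / 2) (2 * (s - \<alpha> - 2) + \<alpha> / 2 + 1)"
  define b where "b = max 0 (s - \<alpha> - 3/2)"
  obtain C where C: "C > 0 \<and> (\<forall>K\<ge>1. (\<Sum>n=1..K. (defect_rate \<alpha> s n)\<^sup>2 * real n powr (\<alpha> / 2)) \<le> C * real K powr r)"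
    using weighted_sum_bound[OF a, of "s - \<alpha> - 2"] unfolding r_def by (elim exE)
  show ?thesis
  proof (intro exI[of _ "C * T powr \<alpha>"] conjI allI impI)
    show "C * T powr \<alpha> > 0" using C T by simp
    fix \<tau> :: real and K :: nat assume \<tau>: "\<tau> > 0" and K: "K \<ge> 1" and KT: "real K * \<tau> \<le> T"
    define \<Sigma> where "\<Sigma> = (\<Sum>n=1..K. (defect_rate \<alpha> s n)\<^sup>2 * real n powr (\<alpha> / 2))"
    have e: "(\<Sum>n=1..K. (\<tau> powr \<gamma> * defect_rate \<alpha> s n)\<^sup>2 * real n powr (\<alpha> / 2)) = (\<tau> powr \<gamma>)\<^sup>2 * \<Sigma>"
      unfolding \<Sigma>_def sum_distrib_left power_mult_distrib by (simp only: mult.assoc)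
    have p1: "\<tau> * \<tau> powr \<alpha> * (\<tau> powr \<gamma>)\<^sup>2 = \<tau> powr \<alpha> * (\<tau> powr (1/2 + \<gamma>))\<^sup>2"
    proof -
      have "\<tau> powr 1 * \<tau> powr \<alpha> * (\<tau> powr \<gamma> * \<tau> powr \<gamma>) = \<tau> powr \<alpha> * (\<tau> powr (1/2 + \<gamma>) * \<tau> powr (1/2 + \<gamma>))"
        by (simp only: powr_add[symmetric]) (simp add: add_ac)
      then show ?thesis using \<tau> by (simp add: power2_eq_square)
    qed
    have p2: "real K powr (\<alpha> / 2) * real K powr r = real K powr \<alpha> * (real K powr b)\<^sup>2"
    proof -
      have "\<alpha> / 2 + r = \<alpha> + (b + b)" by (simp add: r_def b_def max_def field_simps)
      then show ?thesis by (simp only: power2_eq_square powr_add[symmetric])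
    qed
    have "\<tau> * (\<tau> powr \<alpha> * real K powr (\<alpha> / 2) * ((\<tau> powr \<gamma>)\<^sup>2 * \<Sigma>)) = (\<tau> * \<tau> powr \<alpha> * (\<tau> powr \<gamma>)\<^sup>2) * real K powr (\<alpha> / 2) * \<Sigma>"
      by (simp only: mult_ac)
    also have "\<dots> \<le> (\<tau> * \<tau> powr \<alpha> * (\<tau> powr \<gamma>)\<^sup>2) * real K powr (\<alpha> / 2) * (C * real K powr r)"
      using C K \<tau> by (intro mult_left_mono mult_nonneg_nonneg) (auto simp: \<Sigma>_def)
    also have "\<dots> = C * (\<tau> powr \<alpha> * (\<tau> powr (1/2 + \<gamma>))\<^sup>2) * (real K powr (\<alpha> / 2) * real K powr r)"
      unfolding p1 by (simp only: mult_ac)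
    also have "\<dots> = C * (real K powr \<alpha> * \<tau> powr \<alpha>) * (\<tau> powr (1/2 + \<gamma>) * real K powr b)\<^sup>2"
      unfolding p2 power_mult_distrib by (simp only: mult_ac)
    also have "real K powr \<alpha> * \<tau> powr \<alpha> = (real K * \<tau>) powr \<alpha>" using \<tau> by (simp add: powr_mult)
    also have "C * (real K * \<tau>) powr \<alpha> * (\<tau> powr (1/2 + \<gamma>) * real K powr b)\<^sup>2 \<le> C * T powr \<alpha> * (\<tau> powr (1/2 + \<gamma>) * real K powr b)\<^sup>2"
      using C a \<tau> KT by (intro mult_right_mono mult_left_mono powr_mono2) auto
    finally show "\<tau> * (\<tau> powr \<alpha> * real K powr (\<alpha> / 2) * (\<Sum>n=1..K. (\<tau> powr \<gamma> * defect_rate \<alpha> s n)\<^sup>2 * real n powr (\<alpha> / 2)))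
      \<le> C * T powr \<alpha> * (\<tau> powr (1/2 + \<gamma>) * real K powr (max 0 (s - \<alpha> - 3/2)))\<^sup>2" unfolding e b_def .
  qed
qed

text \<open>For the truncation part the powers of \<open>K\<close> are turned into powers of \<open>1 / \<tau>\<close> by \<open>K * \<tau> \<le> T\<close>, since
\<open>\<theta> - \<alpha> + 1/2\<close> exceeds \<open>min 2 (\<theta> - \<alpha> + 1/2)\<close> by exactly \<open>max 0 (\<theta> - \<alpha> - 3/2)\<close>. For the starting
errors they stay, as they do in the claim.\<close>
lemma residual_sum_bound:
  assumes a: "0 < \<alpha>" and T: "T > 0" and \<eta>: "\<eta> \<le> min 2 (\<theta> - \<alpha> + 1/2)"
  shows "\<exists>C>0. \<forall>\<tau>>0. \<forall>K\<ge>1. \<forall>\<mu>\<ge>0. \<forall>Z. \<tau> \<le> T \<longrightarrow> real K * \<tau> \<le> T \<longrightarrow> \<tau> powr \<eta> \<le> Z \<longrightarrow>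
      \<mu> * (\<tau> powr (1/2 - \<alpha>) * real K powr (max 0 (s - \<alpha> - 3/2))) \<le> Z \<longrightarrow>
    \<tau> * (\<tau> powr \<alpha> * real K powr (\<alpha> / 2) * (\<Sum>n=1..K.
        (A * (\<tau> powr (\<theta> - \<alpha>) * defect_rate \<alpha> \<theta> n)
         + W * \<mu> * (\<tau> powr (- \<alpha>) * defect_rate \<alpha> s n))\<^sup>2 * real n powr (\<alpha> / 2)))
      \<le> C * Z\<^sup>2"
proof -
  define b where "b = max 0 (\<theta> - \<alpha> - 3/2)"
  define F G where "F = (\<lambda>\<tau> n. \<tau> powr (\<theta> - \<alpha>) * defect_rate \<alpha> \<theta> n)"
    and "G = (\<lambda>\<tau> n. \<tau> powr (- \<alpha>) * defect_rate \<alpha> s n)"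
  define p where "p = min 2 (\<theta> - \<alpha> + 1/2)"
  define H where "H = (\<lambda>\<tau> K. \<tau> powr (1/2 - \<alpha>) * real K powr (max 0 (s - \<alpha> - 3/2)))"
  obtain C1 where C1: "C1 > 0 \<and> (\<forall>\<tau>>0. \<forall>K\<ge>1. real K * \<tau> \<le> T \<longrightarrow>
     \<tau> * (\<tau> powr \<alpha> * real K powr (\<alpha> / 2) * (\<Sum>n=1..K. (F \<tau> n)\<^sup>2 * real n powr (\<alpha> / 2))) \<le> C1 * (\<tau> powr (1/2 + (\<theta> - \<alpha>)) * real K powr b)\<^sup>2)"
    using scaled_rate_sum[OF a T, of "\<theta> - \<alpha>" \<theta>] unfolding F_def b_def by (elim exE)
  obtain C2 where C2: "C2 > 0 \<and> (\<forall>\<tau>>0. \<forall>K\<ge>1. real K * \<tau> \<le> T \<longrightarrow>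
     \<tau> * (\<tau> powr \<alpha> * real K powr (\<alpha> / 2) * (\<Sum>n=1..K. (G \<tau> n)\<^sup>2 * real n powr (\<alpha> / 2))) \<le> C2 * (H \<tau> K)\<^sup>2)"
    using scaled_rate_sum[OF a T, of "- \<alpha>" s] unfolding G_def H_def add_uminus_conv_diff by (elim exE)
  define C where "C = 2 * A\<^sup>2 * C1 * (T powr b * T powr (p - \<eta>))\<^sup>2 + 2 * W\<^sup>2 * C2 + 1"
  have C0: "C > 0" using C1 C2 by (auto simp: C_def intro!: add_nonneg_pos)
  have main: "\<tau> * (\<tau> powr \<alpha> * real K powr (\<alpha> / 2) * (\<Sum>n=1..K. (A * F \<tau> n + W * \<mu> * G \<tau> n)\<^sup>2 * real n powr (\<alpha> / 2))) \<le> C * Z\<^sup>2"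
    if \<tau>: "\<tau> > 0" "\<tau> \<le> T" and K: "K \<ge> 1" "real K * \<tau> \<le> T" and \<mu>: "\<mu> \<ge> 0" and Z: "\<tau> powr \<eta> \<le> Z" "\<mu> * H \<tau> K \<le> Z" for \<tau> K \<mu> Z
  proof -
    have H0: "H \<tau> K \<ge> 0" by (simp add: H_def)
    define P where "P = \<tau> * (\<tau> powr \<alpha> * real K powr (\<alpha> / 2))"
    have P: "P \<ge> 0" using \<tau> by (simp add: P_def)
    define f where "f = P * (\<Sum>n=1..K. (F \<tau> n)\<^sup>2 * real n powr (\<alpha> / 2))"
    define g where "g = P * (\<Sum>n=1..K. (G \<tau> n)\<^sup>2 * real n powr (\<alpha> / 2))"
    have "(\<Sum>n=1..K. (A * F \<tau> n + W * \<mu> * G \<tau> n)\<^sup>2 * real n powr (\<alpha> / 2))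
       \<le> (\<Sum>n=1..K. 2 * A\<^sup>2 * ((F \<tau> n)\<^sup>2 * real n powr (\<alpha> / 2)) + 2 * (W * \<mu>)\<^sup>2 * ((G \<tau> n)\<^sup>2 * real n powr (\<alpha> / 2)))"
    proof (rule sum_mono)
      fix n
      define x y z where "x = A * F \<tau> n" and "y = W * \<mu> * G \<tau> n" and "z = real n powr (\<alpha> / 2)"
      have "(x + y)\<^sup>2 \<le> 2 * x\<^sup>2 + 2 * y\<^sup>2" using sum_squares_bound[of x y] by (simp add: power2_sum)
      then have "(x + y)\<^sup>2 * z \<le> (2 * x\<^sup>2 + 2 * y\<^sup>2) * z" by (intro mult_right_mono) (auto simp: z_def)
      also have "\<dots> = 2 * A\<^sup>2 * ((F \<tau> n)\<^sup>2 * z) + 2 * (W * \<mu>)\<^sup>2 * ((G \<tau> n)\<^sup>2 * z)"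
        by (simp only: x_def y_def power_mult_distrib distrib_right mult.assoc)
      finally show "(A * F \<tau> n + W * \<mu> * G \<tau> n)\<^sup>2 * real n powr (\<alpha> / 2) \<le> 2 * A\<^sup>2 * ((F \<tau> n)\<^sup>2 * real n powr (\<alpha> / 2)) + 2 * (W * \<mu>)\<^sup>2 * ((G \<tau> n)\<^sup>2 * real n powr (\<alpha> / 2))"
        by (simp only: x_def y_def z_def)
    qed
    then have "P * (\<Sum>n=1..K. (A * F \<tau> n + W * \<mu> * G \<tau> n)\<^sup>2 * real n powr (\<alpha> / 2)) \<le> P * (\<Sum>n=1..K. 2 * A\<^sup>2 * ((F \<tau> n)\<^sup>2 * real n powr (\<alpha> / 2)) + 2 * (W * \<mu>)\<^sup>2 * ((G \<tau> n)\<^sup>2 * real n powr (\<alpha> / 2)))"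
      using P by (rule mult_left_mono)
    also have "\<dots> = 2 * A\<^sup>2 * f + 2 * (W * \<mu>)\<^sup>2 * g"
      unfolding f_def g_def sum.distrib sum_distrib_left[symmetric] by (simp add: algebra_simps)
    also have "\<dots> \<le> 2 * A\<^sup>2 * (C1 * (T powr b * T powr (p - \<eta>) * Z)\<^sup>2) + 2 * (W * \<mu>)\<^sup>2 * (C2 * (H \<tau> K)\<^sup>2)"
    proof (intro add_mono mult_left_mono)
      have "1/2 + (\<theta> - \<alpha>) = b + p" by (simp add: b_def p_def min_def max_def field_simps)
      then have "\<tau> powr (1/2 + (\<theta> - \<alpha>)) * real K powr b = (real K * \<tau>) powr b * \<tau> powr p"
        using \<tau> by (simp add: powr_add powr_mult)
      also have "\<dots> \<le> T powr b * (T powr (p - \<eta>) * Z)"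
      proof (rule mult_mono)
        have "\<tau> powr p \<le> T powr (p - \<eta>) * \<tau> powr \<eta>" using \<eta> \<tau> by (intro power_split_bound) (auto simp: p_def)
        also have "\<dots> \<le> T powr (p - \<eta>) * Z" using Z(1) by (intro mult_left_mono) auto
        finally show "\<tau> powr p \<le> T powr (p - \<eta>) * Z" .
        show "(real K * \<tau>) powr b \<le> T powr b" using K \<tau> by (intro powr_mono2) (auto simp: b_def)
      qed auto
      finally have "C1 * (\<tau> powr (1/2 + (\<theta> - \<alpha>)) * real K powr b)\<^sup>2 \<le> C1 * (T powr b * T powr (p - \<eta>) * Z)\<^sup>2"
        using C1 unfolding mult.assoc[of "T powr b"] by (intro mult_left_mono power_mono) auto
      moreover have "f \<le> C1 * (\<tau> powr (1/2 + (\<theta> - \<alpha>)) * real K powr b)\<^sup>2" using C1 \<tau> K unfolding f_def P_def by (simp only: mult.assoc)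
      ultimately show "f \<le> C1 * (T powr b * T powr (p - \<eta>) * Z)\<^sup>2" by linarith
      show "g \<le> C2 * (H \<tau> K)\<^sup>2" using C2 \<tau> K unfolding g_def P_def by (simp only: mult.assoc)
    qed auto
    also have "2 * (W * \<mu>)\<^sup>2 * (C2 * (H \<tau> K)\<^sup>2) = 2 * W\<^sup>2 * C2 * (\<mu> * H \<tau> K)\<^sup>2" by (simp only: power_mult_distrib mult_ac)
    also have "\<dots> \<le> 2 * W\<^sup>2 * C2 * Z\<^sup>2" using C2 Z(2) \<mu> H0 by (intro mult_left_mono power_mono) auto
    also have "2 * A\<^sup>2 * (C1 * (T powr b * T powr (p - \<eta>) * Z)\<^sup>2) + 2 * W\<^sup>2 * C2 * Z\<^sup>2 \<le> C * Z\<^sup>2"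
      by (simp add: C_def power_mult_distrib algebra_simps)
    finally show ?thesis unfolding P_def by (simp only: mult.assoc)
  qed
  show ?thesis
  proof (intro exI[of _ C] conjI allI impI C0)
    fix \<tau> :: real and K :: nat and \<mu> Z :: real
    assume "\<tau> > 0" "K \<ge> 1" "\<mu> \<ge> 0" "\<tau> \<le> T" "real K * \<tau> \<le> T" "\<tau> powr \<eta> \<le> Z"
      "\<mu> * (\<tau> powr (1/2 - \<alpha>) * real K powr (max 0 (s - \<alpha> - 3/2))) \<le> Z"
    then show "\<tau> * (\<tau> powr \<alpha> * real K powr (\<alpha> / 2) * (\<Sum>n=1..K.
        (A * (\<tau> powr (\<theta> - \<alpha>) * defect_rate \<alpha> \<theta> n)
         + W * \<mu> * (\<tau> powr (- \<alpha>) * defect_rate \<alpha> s n))\<^sup>2 * real n powr (\<alpha> / 2)))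
      \<le> C * Z\<^sup>2"
      using main[of \<tau> K \<mu> Z] unfolding F_def G_def H_def by blast
  qed
qed

section \<open>The error estimate\<close>

text \<open>All \<open>\<nu> j\<close> are kept outside the brackets, which is the form of the residual that the energy estimate requires.\<close>
lemma error_equation:
  assumes n: "n \<in> {1..nT}" and Y0: "Y 0 = Y0"
    and y: "scheme_solution \<tau> nT Q \<nu> \<alpha> ms w Y0 y"
    and D: "(\<Sum>j=1..Q. \<nu> j * D j) = - Y (real n * \<tau>)"
  defines "e \<equiv> \<lambda>n. Y (real n * \<tau>) - y n"
  shows "e n + (\<Sum>j=1..Q. \<nu> j / \<tau> powr \<alpha> j * (\<Sum>k=1..n. g_coeff (\<alpha> j) (n - k) * e k))
     = - (\<Sum>j=1..Q. \<nu> j * ((D j - A_op \<tau> (w j) (\<alpha> j) n (ms j) (\<lambda>k. Y (real k * \<tau>) - Y0))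
          + \<tau> powr (- \<alpha> j) * (\<Sum>k=1..ms j. w j n k * e k)))"
proof -
  have y0: "y 0 = Y0" and sch: "(\<Sum>j=1..Q. \<nu> j * A_op \<tau> (w j) (\<alpha> j) n (ms j) (\<lambda>k. y k - Y0)) = - y n"
    using y n unfolding scheme_solution_def by auto
  have e0: "e 0 = 0" using y0 Y0 by (simp add: e_def)
  have A: "\<nu> j * A_op \<tau> (w j) (\<alpha> j) n (ms j) (\<lambda>k. y k - Y0)
      = \<nu> j * A_op \<tau> (w j) (\<alpha> j) n (ms j) (\<lambda>k. Y (real k * \<tau>) - Y0)
        - \<nu> j / \<tau> powr \<alpha> j * (\<Sum>k=1..n. g_coeff (\<alpha> j) (n - k) * e k)
        - \<nu> j * (\<tau> powr (- \<alpha> j) * (\<Sum>k=1..ms j. w j n k * e k))" for j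
  proof -
    have "(\<lambda>k. Y (real k * \<tau>) - Y0) = (\<lambda>k. (y k - Y0) + e k)" by (simp add: e_def)
    then have "A_op \<tau> (w j) (\<alpha> j) n (ms j) (\<lambda>k. Y (real k * \<tau>) - Y0)
       = A_op \<tau> (w j) (\<alpha> j) n (ms j) (\<lambda>k. y k - Y0) + A_op \<tau> (w j) (\<alpha> j) n (ms j) e"
      by (simp only: A_op_add)
    moreover have "A_op \<tau> (w j) (\<alpha> j) n (ms j) e
       = 1 / \<tau> powr \<alpha> j * (\<Sum>k=1..n. g_coeff (\<alpha> j) (n - k) * e k) + \<tau> powr (- \<alpha> j) * (\<Sum>k=1..ms j. w j n k * e k)"
    proof -
      have "(\<Sum>k=0..n. g_coeff (\<alpha> j) (n - k) * e k) = (\<Sum>k=1..n. g_coeff (\<alpha> j) (n - k) * e k)"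
        by (subst sum.atLeast_Suc_atMost) (simp_all add: e0)
      then show ?thesis unfolding A_op_def by (simp only: powr_minus_divide)
    qed
    ultimately have "A_op \<tau> (w j) (\<alpha> j) n (ms j) (\<lambda>k. y k - Y0) = A_op \<tau> (w j) (\<alpha> j) n (ms j) (\<lambda>k. Y (real k * \<tau>) - Y0)
       - (1 / \<tau> powr \<alpha> j * (\<Sum>k=1..n. g_coeff (\<alpha> j) (n - k) * e k)) - \<tau> powr (- \<alpha> j) * (\<Sum>k=1..ms j. w j n k * e k)"
      by linarith
    then show ?thesis by (simp only: right_diff_distrib times_divide_eq_left times_divide_eq_right mult_1 mult_1_right)
  qed
  have "e n = Y (real n * \<tau>) - y n" by (simp add: e_def)
  also have "\<dots> = - (\<Sum>j=1..Q. \<nu> j * D j) + (\<Sum>j=1..Q. \<nu> j * A_op \<tau> (w j) (\<alpha> j) n (ms j) (\<lambda>k. y k - Y0))"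
    unfolding D sch by simp
  finally show ?thesis unfolding A sum_subtractf distrib_left right_diff_distrib sum.distrib by linarith
qed

theorem theorem3p3:
  fixes T Y0 q :: real and Q m :: nat
    and \<nu> \<alpha> \<sigma> c :: "nat \<Rightarrow> real"
    and Y :: "real \<Rightarrow> real"
    and ms :: "nat \<Rightarrow> nat"
    and w :: "nat \<Rightarrow> nat \<Rightarrow> nat \<Rightarrow> real"
  assumes "T > 0" and "Q \<ge> 1"
    and "\<nu> 1 > 0" and "\<And>j. j \<in> {2..Q} \<Longrightarrow> \<nu> j \<ge> 0"
    and "\<And>j. j \<in> {1..Q} \<Longrightarrow> 0 < \<alpha> j \<and> \<alpha> j \<le> 1"
    and "\<And>j. j \<in> {1..<Q} \<Longrightarrow> \<alpha> (j + 1) \<le> \<alpha> j"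
    and "multiterm_solution T Q \<nu> \<alpha> Y0 Y"
    and "\<And>k. k \<ge> 1 \<Longrightarrow> 0 < \<sigma> k \<and> \<sigma> k < \<sigma> (k + 1)"
    and "\<And>t. t \<in> {0..T} \<Longrightarrow> (\<lambda>k. c (k + 1) * t powr \<sigma> (k + 1)) sums (Y t - Y 0)"
    and "\<And>j. j \<in> {1..Q} \<Longrightarrow> ms j \<ge> 1 \<and> \<sigma> (ms j) \<le> 2"
    and "\<And>j. j \<in> {1..Q} \<Longrightarrow> starting_weights (\<alpha> j) \<sigma> (ms j) (w j)"
    and "m = Max (ms ` {1..Q})"
    and "q = Min ((\<lambda>j. \<sigma> (ms j + 1) - \<alpha> j) ` {1..Q})"
  shows "\<exists>C>0. \<forall>nT y. m \<le> nT \<longrightarrow> scheme_solution (T / real nT) nT Q \<nu> \<alpha> ms w Y0 y \<longrightarrow>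
           (\<forall>K\<in>{1..nT}.
              let \<tau> = T / real nT;
                  e = (\<lambda>n. Y (real n * \<tau>) - y n)
              in sqrt (\<tau> * (\<Sum>n=1..K. \<bar>e n\<bar>\<^sup>2))
                   \<le> C * \<tau> powr (min 2 (q + 1/2))
                     + C * Max ((\<lambda>r. \<bar>e r\<bar>) ` {1..m})
                         * (\<Sum>j=1..Q. \<tau> powr (1/2 - \<alpha> j)
                              * real K powr (max 0 (\<sigma> m - \<alpha> j - 3/2))))"
proof -
  note T = assms(1) and Q = assms(2) and sol = assms(7) and \<sigma> = assms(8) and ser = assms(9)
  have a: "0 < \<alpha> j" "\<alpha> j \<le> 1" if "j \<in> {1..Q}" for j using assms(5)[OF that] by auto
  have ms: "ms j \<ge> 1" "\<sigma> (ms j) \<le> 2" if "j \<in> {1..Q}" for j using assms(10)[OF that] by auto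
  have \<nu>: "\<nu> j \<ge> 0" if j: "j \<in> {1..Q}" for j
  proof (cases "j = 1")
    case True then show ?thesis using assms(3) by simp
  next
    case False
    with j have "j \<in> {2..Q}" by simp
    then show ?thesis by (rule assms(4))
  qed
  have a1: "\<alpha> j \<le> \<alpha> 1" if j: "j \<in> {1..Q}" for j
  proof -
    have "1 \<le> j" "j \<le> Q" using j by auto
    then show ?thesis
    proof (induction j rule: dec_induct)
      case (step i)
      then have "i \<in> {1..<Q}" "\<alpha> i \<le> \<alpha> 1" by auto
      with assms(6)[of i] show ?case by simp
    qed simp
  qed
  have Y0: "Y 0 = Y0" using sol by (simp add: multiterm_solution_def)
  have m: "ms j \<le> m" if "j \<in> {1..Q}" for j unfolding assms(12) using that by (intro Max_ge) auto
  have q: "q \<le> \<sigma> (ms j + 1) - \<alpha> j" if "j \<in> {1..Q}" for j unfolding assms(13) using that by (intro Min_le) auto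
  have \<sigma>mono: "\<sigma> i \<le> \<sigma> j" if "1 \<le> i" "i \<le> j" for i j
    using that(2)
  proof (induction j rule: dec_induct)
    case (step n)
    then have "\<sigma> n < \<sigma> (n + 1)" using \<sigma>[of n] that(1) by simp
    with step show ?case by simp
  qed simp
  have "\<exists>S d V B. finite S \<and> (\<forall>p\<in>S. p > 0) \<and> V absolutely_integrable_on {0..T} \<and> (\<forall>t\<in>{0..T}. \<bar>V t\<bar> \<le> B)
      \<and> (\<forall>t\<in>{0<..T}. Y t - Y0 = (\<Sum>p\<in>S. d p * t powr p) + frac_int 4 V t)"
    by (rule multiterm_solution_decomposition[OF T Q assms(3) \<nu> _ sol]) (use a a1 Q in auto)
  then obtain S d V B where dec: "finite S" "\<forall>p\<in>S. p > 0" "V absolutely_integrable_on {0..T}" "\<forall>t\<in>{0..T}. \<bar>V t\<bar> \<le> B"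
      "\<forall>t\<in>{0<..T}. Y t - Y 0 = (\<Sum>p\<in>S. d p * t powr p) + frac_int 4 V t"
    unfolding Y0 by (elim exE conjE)
  define \<theta> where "\<theta> = (\<lambda>j. min 4 (\<sigma> (ms j + 1)))"
  define \<eta> where "\<eta> = min 2 (q + 1/2)"
  define x where "x = (\<lambda>j \<tau> n. \<tau> powr (\<theta> j - \<alpha> j) * defect_rate (\<alpha> j) (\<theta> j) n)"
  define z where "z = (\<lambda>j \<tau> n. \<tau> powr (- \<alpha> j) * defect_rate (\<alpha> j) (\<sigma> m) n)"
  have "\<forall>j\<in>{1..Q}. \<exists>A>0. \<forall>nT n D. ms j \<le> nT \<longrightarrow> n \<in> {1..nT} \<longrightarrow> has_caputo_derivative T (\<alpha> j) Y D (real n * (T / real nT)) \<longrightarrow>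
     \<bar>D - A_op (T / real nT) (w j) (\<alpha> j) n (ms j) (\<lambda>k. Y (real k * (T / real nT)) - Y0)\<bar>
      \<le> A * (x j (T / real nT) n + (T / real nT)\<^sup>2)"
  proof
    fix j assume j: "j \<in> {1..Q}"
    have "\<exists>S' d'. finite S' \<and> (\<forall>p\<in>S'. p \<ge> min 4 (\<sigma> (ms j + 1))) \<and>
     (\<forall>t\<in>{0<..T}. Y t - Y 0 = (\<Sum>k=1..ms j. c k * t powr \<sigma> k) + (\<Sum>p\<in>S'. d' p * t powr p) + frac_int 4 V t)"
      by (rule decomposition_matches_expansion[OF T _ _ dec]) (fact \<sigma> ser)+
    then obtain S' d' where S': "finite S' \<and> (\<forall>p\<in>S'. p \<ge> min 4 (\<sigma> (ms j + 1))) \<and>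
     (\<forall>t\<in>{0<..T}. Y t - Y 0 = (\<Sum>k=1..ms j. c k * t powr \<sigma> k) + (\<Sum>p\<in>S'. d' p * t powr p) + frac_int 4 V t)"
      by (elim exE)
    note S = S'[THEN conjunct1] S'[THEN conjunct2, THEN conjunct1] S'[THEN conjunct2, THEN conjunct2, unfolded Y0]
    show "\<exists>A>0. \<forall>nT n D. ms j \<le> nT \<longrightarrow> n \<in> {1..nT} \<longrightarrow> has_caputo_derivative T (\<alpha> j) Y D (real n * (T / real nT)) \<longrightarrow>
     \<bar>D - A_op (T / real nT) (w j) (\<alpha> j) n (ms j) (\<lambda>k. Y (real k * (T / real nT)) - Y0)\<bar>
      \<le> A * (x j (T / real nT) n + (T / real nT)\<^sup>2)"
      unfolding x_def \<theta>_def
      by (rule truncation_bound[where Y = Y and S = S' and d = d' and c = c])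
         (fact T a[OF j] \<sigma> ms[OF j] assms(11)[OF j] S(1) bspec[OF S(2)] dec(3,4) Y0 S(3))+
  qed
  from bchoice[OF this] obtain A where A': "\<forall>j\<in>{1..Q}. A j > 0 \<and> (\<forall>nT n D. ms j \<le> nT \<longrightarrow> n \<in> {1..nT} \<longrightarrow> has_caputo_derivative T (\<alpha> j) Y D (real n * (T / real nT)) \<longrightarrow>
     \<bar>D - A_op (T / real nT) (w j) (\<alpha> j) n (ms j) (\<lambda>k. Y (real k * (T / real nT)) - Y0)\<bar>
      \<le> A j * (x j (T / real nT) n + (T / real nT)\<^sup>2))" by (elim exE)
  note A = A'[THEN bspec, THEN conjunct1] A'[THEN bspec, THEN conjunct2, rule_format]
  have "\<forall>j\<in>{1..Q}. \<exists>W>0. \<forall>n\<ge>1. \<forall>k\<in>{1..ms j}. \<bar>w j n k\<bar> \<le> W * defect_rate (\<alpha> j) (\<sigma> (ms j)) n"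
  proof
    fix j assume j: "j \<in> {1..Q}"
    show "\<exists>W>0. \<forall>n\<ge>1. \<forall>k\<in>{1..ms j}. \<bar>w j n k\<bar> \<le> W * defect_rate (\<alpha> j) (\<sigma> (ms j)) n"
      by (rule starting_weights_bound[OF a[OF j] _ assms(11)[OF j]]) (rule \<sigma>)
  qed
  from bchoice[OF this] obtain W where W': "\<forall>j\<in>{1..Q}. W j > 0 \<and> (\<forall>n\<ge>1. \<forall>k\<in>{1..ms j}. \<bar>w j n k\<bar> \<le> W j * defect_rate (\<alpha> j) (\<sigma> (ms j)) n)" by (elim exE)
  note W = W'[THEN bspec, THEN conjunct1] W'[THEN bspec, THEN conjunct2, rule_format]
  have "\<forall>j\<in>{1..Q}. \<exists>c>0. \<forall>K e X. (\<forall>N\<le>K. g_form (\<alpha> j) e N \<le> X) \<longrightarrow>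
           c * real K powr (- \<alpha> j / 2) * (\<Sum>n=1..K. real n powr (- \<alpha> j / 2) * (e n)\<^sup>2) \<le> X"
    by (intro ballI g_form_coercive a)
  from bchoice[OF this] obtain \<kappa> where \<kappa>': "\<forall>j\<in>{1..Q}. \<kappa> j > 0 \<and> (\<forall>K e X. (\<forall>N\<le>K. g_form (\<alpha> j) e N \<le> X) \<longrightarrow>
           \<kappa> j * real K powr (- \<alpha> j / 2) * (\<Sum>n=1..K. real n powr (- \<alpha> j / 2) * (e n)\<^sup>2) \<le> X)" by (elim exE)
  note \<kappa> = \<kappa>'[THEN bspec, THEN conjunct1] \<kappa>'[THEN bspec, THEN conjunct2, rule_format]
  \<comment> \<open>The part of the residual that belongs to the order \<open>\<alpha> j\<close>, divided by \<open>\<nu> j\<close>: truncation error and starting weights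
      applied to at most \<open>ms j\<close> errors of size at most \<open>\<mu>\<close>.\<close>
  define R where "R = (\<lambda>\<tau> \<mu> j n. A j * x j \<tau> n + (real (ms j) * W j) * \<mu> * z j \<tau> n)"
  have "\<forall>j\<in>{1..Q}. \<exists>D>0. \<forall>\<tau>>0. \<forall>K\<ge>1. \<forall>\<mu>\<ge>0. \<forall>Z. \<tau> \<le> T \<longrightarrow> real K * \<tau> \<le> T \<longrightarrow> \<tau> powr \<eta> \<le> Z \<longrightarrow>
      \<mu> * (\<tau> powr (1/2 - \<alpha> j) * real K powr (max 0 (\<sigma> m - \<alpha> j - 3/2))) \<le> Z \<longrightarrow>
    \<tau> * (\<tau> powr \<alpha> j * real K powr (\<alpha> j / 2) * (\<Sum>n=1..K. (R \<tau> \<mu> j n)\<^sup>2 * real n powr (\<alpha> j / 2))) \<le> D * Z\<^sup>2"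
  proof
    fix j assume j: "j \<in> {1..Q}"
    have "\<eta> \<le> min 2 (\<theta> j - \<alpha> j + 1/2)" using q[OF j] a[OF j] by (simp add: \<eta>_def \<theta>_def)
    then show "\<exists>D>0. \<forall>\<tau>>0. \<forall>K\<ge>1. \<forall>\<mu>\<ge>0. \<forall>Z. \<tau> \<le> T \<longrightarrow> real K * \<tau> \<le> T \<longrightarrow> \<tau> powr \<eta> \<le> Z \<longrightarrow>
      \<mu> * (\<tau> powr (1/2 - \<alpha> j) * real K powr (max 0 (\<sigma> m - \<alpha> j - 3/2))) \<le> Z \<longrightarrow>
    \<tau> * (\<tau> powr \<alpha> j * real K powr (\<alpha> j / 2) * (\<Sum>n=1..K. (R \<tau> \<mu> j n)\<^sup>2 * real n powr (\<alpha> j / 2))) \<le> D * Z\<^sup>2"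
      unfolding R_def x_def z_def by (rule residual_sum_bound[OF a(1)[OF j] T])
  qed
  from bchoice[OF this] obtain L where L': "\<forall>j\<in>{1..Q}. L j > 0 \<and> (\<forall>\<tau>>0. \<forall>K\<ge>1. \<forall>\<mu>\<ge>0. \<forall>Z. \<tau> \<le> T \<longrightarrow> real K * \<tau> \<le> T \<longrightarrow> \<tau> powr \<eta> \<le> Z \<longrightarrow>
      \<mu> * (\<tau> powr (1/2 - \<alpha> j) * real K powr (max 0 (\<sigma> m - \<alpha> j - 3/2))) \<le> Z \<longrightarrow>
    \<tau> * (\<tau> powr \<alpha> j * real K powr (\<alpha> j / 2) * (\<Sum>n=1..K. (R \<tau> \<mu> j n)\<^sup>2 * real n powr (\<alpha> j / 2))) \<le> L j * Z\<^sup>2)" by (elim exE)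
  note L = L'[THEN bspec, THEN conjunct1] L'[THEN bspec, THEN conjunct2, rule_format]
  define A0 where "A0 = (\<Sum>j=1..Q. \<nu> j * A j)"
  have A0: "A0 \<ge> 0" unfolding A0_def using \<nu> A(1) by (intro sum_nonneg mult_nonneg_nonneg) (auto intro: less_imp_le)
  define M where "M = 2 * T * (A0 * T powr (2 - \<eta>))\<^sup>2 + 2 * (\<Sum>j=1..Q. \<nu> j * real Q / \<kappa> j * L j) + 1"
  have M: "M > 0"
  proof -
    have "0 \<le> (\<Sum>j=1..Q. \<nu> j * real Q / \<kappa> j * L j)"
      using \<nu> \<kappa>(1) L(1) by (intro sum_nonneg mult_nonneg_nonneg divide_nonneg_nonneg) (auto intro: less_imp_le)
    moreover have "0 \<le> 2 * T * (A0 * T powr (2 - \<eta>))\<^sup>2" using T by simp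
    ultimately show ?thesis unfolding M_def by linarith
  qed
  have main: "sqrt (\<tau> * (\<Sum>n=1..K. \<bar>e n\<bar>\<^sup>2)) \<le> sqrt M * \<tau> powr \<eta> + sqrt M * Max ((\<lambda>r. \<bar>e r\<bar>) ` {1..m})
           * (\<Sum>j=1..Q. \<tau> powr (1/2 - \<alpha> j) * real K powr (max 0 (\<sigma> m - \<alpha> j - 3/2)))"
    if nT: "m \<le> nT" and \<tau>def: "\<tau> = T / real nT" and y: "scheme_solution \<tau> nT Q \<nu> \<alpha> ms w Y0 y" and K: "K \<in> {1..nT}"
      and edef: "e = (\<lambda>n. Y (real n * \<tau>) - y n)" for nT y \<tau> K e
  proof -
    have nT0: "real nT \<ge> 1" using K by simp
    have \<tau>: "\<tau> > 0" "\<tau> \<le> T" "real nT * \<tau> = T" using T nT0 by (auto simp: \<tau>def field_simps)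
    have kt: "real k * \<tau> \<le> T" if "k \<le> nT" for k
    proof -
      have "real k * \<tau> \<le> real nT * \<tau>" using that \<tau>(1) by (intro mult_right_mono) auto
      then show ?thesis using \<tau>(3) by simp
    qed
    have m1: "1 \<le> m" using m[of 1] ms(1)[of 1] Q by simp
    define \<mu> where "\<mu> = Max ((\<lambda>r. \<bar>e r\<bar>) ` {1..m})"
    have \<mu>: "\<bar>e r\<bar> \<le> \<mu>" if "r \<in> {1..m}" for r unfolding \<mu>_def using that by (intro Max_ge) auto
    have \<mu>0: "\<mu> \<ge> 0" using \<mu>[of 1] m1 by simp
    define b where "b = (\<lambda>j. \<tau> powr (1/2 - \<alpha> j) * real K powr (max 0 (\<sigma> m - \<alpha> j - 3/2)))"
    \<comment> \<open>The claimed bound without its constant: every term of the energy estimate is at most a multiple of \<open>Z\<^sup>2\<close>.\<close>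
    define Z where "Z = \<tau> powr \<eta> + \<mu> * (\<Sum>j=1..Q. b j)"
    have b0: "b j \<ge> 0" for j by (simp add: b_def)
    have Z1: "\<tau> powr \<eta> \<le> Z" unfolding Z_def using \<mu>0 b0 by (simp add: sum_nonneg)
    have Z0: "Z \<ge> 0" using Z1 powr_ge_zero[of \<tau> \<eta>] by linarith
    have Z2: "\<mu> * b j \<le> Z" if "j \<in> {1..Q}" for j
    proof -
      have "\<mu> * b j \<le> \<mu> * (\<Sum>j=1..Q. b j)" using that b0 \<mu>0 by (intro mult_left_mono member_le_sum) auto
      then show ?thesis unfolding Z_def using powr_ge_zero[of \<tau> \<eta>] by linarith
    qed
    define \<rho> where "\<rho> = (\<lambda>n. e n + (\<Sum>j=1..Q. \<nu> j / \<tau> powr \<alpha> j * (\<Sum>k=1..n. g_coeff (\<alpha> j) (n - k) * e k)))"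
    have \<rho>: "\<bar>\<rho> n\<bar> \<le> A0 * \<tau>\<^sup>2 + (\<Sum>j=1..Q. \<nu> j * R \<tau> \<mu> j n)" if n: "n \<in> {1..K}" for n
    proof -
      have n': "n \<in> {1..nT}" "n \<ge> 1" "real n \<ge> 1" using n K by auto
      have tn: "real n * \<tau> \<in> {0<..T}" using n' kt[of n] \<tau>(1) by simp
      obtain D where D: "\<And>j. j \<in> {1..Q} \<Longrightarrow> has_caputo_derivative T (\<alpha> j) Y (D j) (real n * \<tau>)"
        "(\<Sum>j=1..Q. \<nu> j * D j) = - Y (real n * \<tau>)"
        proof -
          from sol tn obtain D where "(\<forall>j\<in>{1..Q}. has_caputo_derivative T (\<alpha> j) Y (D j) (real n * \<tau>)) \<and> (\<Sum>j=1..Q. \<nu> j * D j) = - Y (real n * \<tau>)"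
            unfolding multiterm_solution_def by (elim conjE) (drule (1) bspec, elim exE)
          then show thesis by (intro that[of D]) auto
        qed
      define \<delta> where "\<delta> = (\<lambda>j. D j - A_op \<tau> (w j) (\<alpha> j) n (ms j) (\<lambda>k. Y (real k * \<tau>) - Y0))"
      define s where "s = (\<lambda>j. \<tau> powr (- \<alpha> j) * (\<Sum>k=1..ms j. w j n k * e k))"
      have "\<rho> n = - (\<Sum>j=1..Q. \<nu> j * (\<delta> j + s j))"
        unfolding \<rho>_def \<delta>_def s_def edef by (rule error_equation[OF n'(1) Y0 y D(2)])
      then have "\<bar>\<rho> n\<bar> = \<bar>\<Sum>j=1..Q. \<nu> j * (\<delta> j + s j)\<bar>" by simp
      also have "\<dots> \<le> (\<Sum>j=1..Q. \<bar>\<nu> j * (\<delta> j + s j)\<bar>)" by (rule sum_abs)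
      also have "\<dots> \<le> (\<Sum>j=1..Q. \<nu> j * A j * \<tau>\<^sup>2 + \<nu> j * R \<tau> \<mu> j n)"
      proof (rule sum_mono)
        fix j assume j: "j \<in> {1..Q}"
        have d: "\<bar>\<delta> j\<bar> \<le> A j * (x j \<tau> n + \<tau>\<^sup>2)"
          unfolding \<delta>_def \<tau>def using order.trans[OF m[OF j] nT] n'(1) D(1)[OF j] unfolding \<tau>def by (intro A(2)[OF j])
        have "\<bar>w j n k * e k\<bar> \<le> (W j * defect_rate (\<alpha> j) (\<sigma> m) n) * \<mu>" if k: "k \<in> {1..ms j}" for k
        proof -
          have "real n powr (\<sigma> (ms j) - \<alpha> j - 2) \<le> real n powr (\<sigma> m - \<alpha> j - 2)"
            using \<sigma>mono[OF ms(1)[OF j] m[OF j]] n'(3) by (intro powr_mono) auto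
          then have "W j * defect_rate (\<alpha> j) (\<sigma> (ms j)) n \<le> W j * defect_rate (\<alpha> j) (\<sigma> m) n"
            using W(1)[OF j] by (intro mult_left_mono) auto
          with W(2)[OF j n'(2) k] have "\<bar>w j n k\<bar> \<le> W j * defect_rate (\<alpha> j) (\<sigma> m) n" by linarith
          moreover have "\<bar>e k\<bar> \<le> \<mu>" using k m[OF j] by (intro \<mu>) simp
          ultimately show ?thesis unfolding abs_mult by (intro mult_mono) auto
        qed
        then have "(\<Sum>k=1..ms j. \<bar>w j n k * e k\<bar>) \<le> real (card {1..ms j}) * ((W j * defect_rate (\<alpha> j) (\<sigma> m) n) * \<mu>)"
          by (rule sum_bounded_above)
        then have "\<bar>\<Sum>k=1..ms j. w j n k * e k\<bar> \<le> real (ms j) * ((W j * defect_rate (\<alpha> j) (\<sigma> m) n) * \<mu>)"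
          by (intro order.trans[OF sum_abs]) simp
        then have "\<tau> powr (- \<alpha> j) * \<bar>\<Sum>k=1..ms j. w j n k * e k\<bar> \<le> \<tau> powr (- \<alpha> j) * (real (ms j) * ((W j * defect_rate (\<alpha> j) (\<sigma> m) n) * \<mu>))"
          by (intro mult_left_mono) auto
        also have "\<dots> = real (ms j) * W j * \<mu> * z j \<tau> n" unfolding z_def by (simp only: mult_ac)
        finally have s: "\<bar>s j\<bar> \<le> real (ms j) * W j * \<mu> * z j \<tau> n" unfolding s_def abs_mult by simp
        have "\<bar>\<delta> j + s j\<bar> \<le> A j * \<tau>\<^sup>2 + R \<tau> \<mu> j n"
          using d s unfolding R_def distrib_left by linarith
        then have "\<nu> j * \<bar>\<delta> j + s j\<bar> \<le> \<nu> j * (A j * \<tau>\<^sup>2 + R \<tau> \<mu> j n)" using \<nu>[OF j] by (rule mult_left_mono)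
        then show "\<bar>\<nu> j * (\<delta> j + s j)\<bar> \<le> \<nu> j * A j * \<tau>\<^sup>2 + \<nu> j * R \<tau> \<mu> j n"
          unfolding abs_mult abs_of_nonneg[OF \<nu>[OF j]] by (simp only: distrib_left[of "\<nu> j" "A j * \<tau>\<^sup>2"] mult.assoc)
      qed
      also have "\<dots> = A0 * \<tau>\<^sup>2 + (\<Sum>j=1..Q. \<nu> j * R \<tau> \<mu> j n)"
        by (simp only: A0_def sum.distrib sum_distrib_right)
      finally show ?thesis .
    qed
    have K1: "K \<ge> 1" "K \<le> nT" using K by auto
    have KT: "real K * \<tau> \<le> T" by (rule kt[OF K1(2)])
    define V where "V = (\<lambda>j. \<tau> powr \<alpha> j * real K powr (\<alpha> j / 2) * (\<Sum>n=1..K. (R \<tau> \<mu> j n)\<^sup>2 * real n powr (\<alpha> j / 2)))"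
    have "(\<Sum>n=1..K. (e n)\<^sup>2) \<le> 2 * (real K * (A0 * \<tau>\<^sup>2)\<^sup>2) + 2 * (\<Sum>j=1..Q. \<nu> j * real Q / \<kappa> j * V j)"
      unfolding V_def
      by (rule energy_estimate[OF Q \<nu> _ \<kappa>(1) \<kappa>(2)[rule_format] \<tau>(1) K1(1) \<rho>_def[THEN fun_cong, symmetric] \<rho>]) (use a in auto)
    then have "\<tau> * (\<Sum>n=1..K. (e n)\<^sup>2) \<le> \<tau> * (2 * (real K * (A0 * \<tau>\<^sup>2)\<^sup>2) + 2 * (\<Sum>j=1..Q. \<nu> j * real Q / \<kappa> j * V j))"
      using \<tau>(1) by (intro mult_left_mono) auto
    also have "\<dots> = 2 * (real K * \<tau>) * (A0 * \<tau>\<^sup>2)\<^sup>2 + 2 * (\<Sum>j=1..Q. \<nu> j * real Q / \<kappa> j * (\<tau> * V j))"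
    proof -
      have "\<tau> * (\<Sum>j=1..Q. \<nu> j * real Q / \<kappa> j * V j) = (\<Sum>j=1..Q. \<nu> j * real Q / \<kappa> j * (\<tau> * V j))"
        unfolding sum_distrib_left by (intro sum.cong refl) (simp only: mult.left_commute)
      then show ?thesis by (simp only: distrib_left mult_ac)
    qed
    also have "\<dots> \<le> 2 * T * (A0 * T powr (2 - \<eta>) * Z)\<^sup>2 + 2 * (\<Sum>j=1..Q. \<nu> j * real Q / \<kappa> j * (L j * Z\<^sup>2))"
    proof (rule add_mono)
      have "\<tau>\<^sup>2 = \<tau> powr 2" using \<tau>(1) by simp
      also have "\<dots> \<le> T powr (2 - \<eta>) * \<tau> powr \<eta>" using \<tau> by (intro power_split_bound) (auto simp: \<eta>_def)
      also have "\<dots> \<le> T powr (2 - \<eta>) * Z" using Z1 by (intro mult_left_mono) auto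
      finally have "A0 * \<tau>\<^sup>2 \<le> A0 * (T powr (2 - \<eta>) * Z)" using A0 by (rule mult_left_mono)
      then have "(A0 * \<tau>\<^sup>2)\<^sup>2 \<le> (A0 * T powr (2 - \<eta>) * Z)\<^sup>2" using A0 unfolding mult.assoc by (intro power_mono) auto
      then show "2 * (real K * \<tau>) * (A0 * \<tau>\<^sup>2)\<^sup>2 \<le> 2 * T * (A0 * T powr (2 - \<eta>) * Z)\<^sup>2"
        using KT T \<tau>(1) by (intro mult_mono) auto
      have "\<nu> j * real Q / \<kappa> j * (\<tau> * V j) \<le> \<nu> j * real Q / \<kappa> j * (L j * Z\<^sup>2)" if j: "j \<in> {1..Q}" for j
      proof (rule mult_left_mono)
        show "\<tau> * V j \<le> L j * Z\<^sup>2"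
          unfolding V_def by (rule L(2)[OF j \<tau>(1) K1(1) \<mu>0 \<tau>(2) KT Z1]) (rule Z2[OF j, unfolded b_def])
        show "0 \<le> \<nu> j * real Q / \<kappa> j" using \<nu>[OF j] \<kappa>(1)[OF j] by simp
      qed
      then show "2 * (\<Sum>j=1..Q. \<nu> j * real Q / \<kappa> j * (\<tau> * V j)) \<le> 2 * (\<Sum>j=1..Q. \<nu> j * real Q / \<kappa> j * (L j * Z\<^sup>2))"
        by (intro mult_left_mono[OF sum_mono]) auto
    qed
    also have "\<dots> = (2 * T * (A0 * T powr (2 - \<eta>))\<^sup>2 + 2 * (\<Sum>j=1..Q. \<nu> j * real Q / \<kappa> j * L j)) * Z\<^sup>2"
      by (simp only: power_mult_distrib distrib_right sum_distrib_right mult.assoc)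
    also have "\<dots> \<le> M * Z\<^sup>2" unfolding M_def by (intro mult_right_mono) auto
    finally have "sqrt (\<tau> * (\<Sum>n=1..K. (e n)\<^sup>2)) \<le> sqrt (M * Z\<^sup>2)" by (rule real_sqrt_le_mono)
    also have "\<dots> = sqrt M * Z" using Z0 by (simp add: real_sqrt_mult)
    also have "\<dots> = sqrt M * \<tau> powr \<eta> + sqrt M * \<mu> * (\<Sum>j=1..Q. b j)" by (simp only: Z_def distrib_left mult.assoc)
    finally show ?thesis unfolding power2_abs \<mu>_def b_def .
  qed
  show ?thesis
    unfolding Let_def \<eta>_def[symmetric]
    by (intro exI[of _ "sqrt M"] conjI allI impI ballI) (use M in simp, rule main[OF _ refl _ _ refl])
qed

end
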